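(* Let $0<\rho\le1$, $T>0$, and let $A(D)=\sum_{|\alpha|=m}a_\alpha D^\alpha$ be a homogeneous symmetric positive elliptic differential operator of order $m$ with constant coefficients. Let $\tau>\frac N2$ and $\varphi\in L_2^\tau(\mathbb{T}^N)$. Moreover, let $f(\cdot,t)\in L_2^\tau(\mathbb{T}^N)$ for any $t\in[0,T]$ and let the function $F(t)=\hat A^{\tau/m}f(\cdot,t)$ be continuous in the norm of $L_2(\mathbb{T}^N)$ for all $t\in[0,T]$. Then there exists a (regular) solution, $2\pi$-periodic in each $x_j$, of the problem $$\partial_t^\rho u(x,t)+A(D)u(x,t)=f(x,t),\quad x\in\mathbb{T}^N,\ 0<t\le T,$$ $$\lim_{t\to0}\partial_t^{\rho-1}u(x,t)=\varphi(x),\quad x\in\mathbb{T}^N,$$ and it has the form $$u(x,t)=\sum_{n\in\mathbb{Z}^N}\Big[\varphi_nt^{\rho-1}E_{\rho,\rho}(-A(n)t^\rho)+\int_0^tf_n(t-\xi)\,\xi^{\rho-1}E_{\rho,\rho}(-A(n)\xi^\rho)\,d\xi\Big]e^{inx},$$ where the series converges absolutely and uniformly in $x\in\mathbb{T}^N$ for each $t\in(0,T]$, and $\varphi_n$ and $f_n(t)$ are the corresponding Fourier coefficients of $\varphi$ and $f(\cdot,t)$.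
   Context: **Setting.** $\mathbb{T}^N=(-\pi,\pi]^N$; functions on $\mathbb{T}^N$, in particular $\varphi(x)$ and $f(x,t)$, are regarded as $2\pi$-periodic in each argument $x_j$, and $nx=n_1x_1+\dots+n_Nx_N$ for $n\in\mathbb{Z}^N$. $D=(D_1,\dots,D_N)$ with $D_j=\frac1i\frac{\partial}{\partial x_j}$, so that $A(D)e^{inx}=A(n)e^{inx}$ with $A(n)=\sum_{|\alpha|=m}a_\alpha n^\alpha$; ellipticity and positivity mean $A(\xi)=\sum_{|\alpha|=m}a_\alpha\xi^\alpha>0$ for all $\xi\in\mathbb{R}^N$, $\xi\neq0$ (so $m$ is even). The Fourier coefficients $g_n$ of $g\in L_2(\mathbb{T}^N)$ are those in the expansion $g=\sum_{n\in\mathbb{Z}^N}g_ne^{inx}$, i.e. $g_n=(2\pi)^{-N}\int_{\mathbb{T}^N}g(x)e^{-inx}dx$. **Powers of the operator.** $\hat A$ is the closure in $L_2(\mathbb{T}^N)$ of the operator $A(D)$ defined on $2\pi$-periodic functions from $C^m(\mathbb{R}^N)$; it is selfadjoint. For $\sigma>0$, $\hat A^\sigma g(x)=\sum_{n\in\mathbb{Z}^N}A^\sigma(n)g_ne^{inx}$ with domain $D(\hat A^\sigma)=\{g\in L_2(\mathbb{T}^N):\sum_{n\in\mathbb{Z}^N}A^{2\sigma}(n)|g_n|^2<\infty\}$. **Sobolev (Liouville) spaces.** For real $a>0$, $L_2^a(\mathbb{T}^N)$ is the set of $g\in L_2(\mathbb{T}^N)$ with $\|g\|^2_{L_2^a(\mathbb{T}^N)}=\sum_{n\in\mathbb{Z}^N}(1+|n|^2)^a|g_n|^2<\infty$.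 **Fractional derivatives (Riemann–Liouville, in $t$).** For $\rho<0$, $\partial_t^\rho h(t)=\frac{1}{\Gamma(-\rho)}\int_0^t\frac{h(\xi)}{(t-\xi)^{\rho+1}}\,d\xi$, $t>0$, provided the right-hand side exists; $\partial_t^0$ is the identity. For $0<\rho\le1$, $\partial_t^\rho h(t)=\frac{d}{dt}\partial_t^{\rho-1}h(t)$; in particular $\partial_t^1=\frac{d}{dt}$. **Mittag-Leffler function.** $E_{\rho,\mu}(t)=\sum_{k=0}^\infty\frac{t^k}{\Gamma(\rho k+\mu)}$. **Regular solution** ("solution" always means regular solution). A function $u(x,t)$, $2\pi$-periodic in each $x_j$, such that $\partial_t^\rho u(x,t)$ and $A(D)u(x,t)$ are continuous on $\mathbb{T}^N\times(0,T]$ (this is understood as a requirement of continuity of all the derivatives appearing in the equation), $\partial_t^{\rho-1}u(x,t)$ is continuous on $\mathbb{T}^N\times[0,T]$ (continuity being that of the periodic extensions), and the equation and the initial condition are satisfied in the classical sense.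
   Formalization: Added: the mean f_0(t) is continuous on [0,T] (as A(0)=0, F does not see this mode, and f(x,t)=g(t) with g discontinuous is a counterexample); φ and f(·,t) are taken as their continuous representatives, so that the equation and initial condition make sense at every x. *)

theory Defs
  imports "HOL-Analysis.Analysis"
begin

section \<open>Periodic functions and Fourier coefficients on the torus\<close>

definition torus :: "(real^'n) set" where
  "torus = {x. \<forall>j. - pi < x $ j \<and> x $ j \<le> pi}"

definition periodic :: "(real^'n \<Rightarrow> complex) \<Rightarrow> bool" where
  "periodic g \<longleftrightarrow> (\<forall>x j. g (x + (2 * pi) *\<^sub>R axis j 1) = g x)"

definition lattice_vec :: "int^'n \<Rightarrow> real^'n" where
  "lattice_vec n = (\<chi> j. real_of_int (n $ j))"

definition expi :: "int^'n \<Rightarrow> real^'n \<Rightarrow> complex" where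
  "expi n x = cis (lattice_vec n \<bullet> x)"

text \<open>Elements of \<open>L\<^sub>2\<close> are represented by functions, not by almost-everywhere classes.\<close>

definition L2 :: "(real^'n \<Rightarrow> complex) set" where
  "L2 = {g. g \<in> borel_measurable (lebesgue_on torus) \<and>
            integrable (lebesgue_on torus) (\<lambda>x. (cmod (g x))\<^sup>2)}"

definition L2_norm :: "(real^'n \<Rightarrow> complex) \<Rightarrow> real" where
  "L2_norm g = sqrt (LINT x|lebesgue_on torus. (cmod (g x))\<^sup>2)"

definition fourier_coeff :: "(real^'n \<Rightarrow> complex) \<Rightarrow> int^'n \<Rightarrow> complex" where
  "fourier_coeff g n =
     (LINT x|lebesgue_on torus. g x * expi (- n) x) / of_real ((2 * pi) ^ CARD('n))"

definition L2_sobolev :: "real \<Rightarrow> (real^'n \<Rightarrow> complex) set" where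
  "L2_sobolev s = {g \<in> L2.
     (\<lambda>n. (1 + (norm (lattice_vec n))\<^sup>2) powr s * (cmod (fourier_coeff g n))\<^sup>2) summable_on UNIV}"


section \<open>The differential operator and its powers\<close>

definition partial :: "'n \<Rightarrow> (real^'n \<Rightarrow> complex) \<Rightarrow> real^'n \<Rightarrow> complex" where
  "partial j g x = vector_derivative (\<lambda>s. g (x + s *\<^sub>R axis j 1)) (at 0)"

fun Ck :: "nat \<Rightarrow> (real^'n \<Rightarrow> complex) \<Rightarrow> bool" where
  "Ck 0 g \<longleftrightarrow> continuous_on UNIV g"
| "Ck (Suc k) g \<longleftrightarrow> continuous_on UNIV g \<and>
     (\<forall>j. (\<forall>x. (\<lambda>s. g (x + s *\<^sub>R axis j 1)) differentiable (at 0)) \<and> Ck k (partial j g))"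

definition multi_indices :: "nat \<Rightarrow> (nat^'n) set" where
  "multi_indices m = {\<alpha>. (\<Sum>j\<in>UNIV. \<alpha> $ j) = m}"

definition Dj :: "'n \<Rightarrow> (real^'n \<Rightarrow> complex) \<Rightarrow> real^'n \<Rightarrow> complex" where
  "Dj j g x = (1 / \<i>) * partial j g x"

text \<open>The order in which the \<open>D\<^sub>j\<close> are applied is left open: on functions satisfying
  \<^term>\<open>Ck m\<close> it does not matter, by the symmetry of mixed partial derivatives.\<close>

definition D_multi :: "nat^'n \<Rightarrow> (real^'n \<Rightarrow> complex) \<Rightarrow> real^'n \<Rightarrow> complex" where
  "D_multi \<alpha> g = foldr Dj (SOME js. \<forall>j. count_list js j = \<alpha> $ j) g"

text \<open>A homogeneous operator of order \<open>m\<close> is given by its coefficient family \<open>a\<close>, of which only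
  the values on \<^term>\<open>multi_indices m\<close> are used.\<close>

definition AD :: "(nat^'n \<Rightarrow> complex) \<Rightarrow> nat \<Rightarrow> (real^'n \<Rightarrow> complex) \<Rightarrow> real^'n \<Rightarrow> complex" where
  "AD a m g x = (\<Sum>\<alpha>\<in>multi_indices m. a \<alpha> * D_multi \<alpha> g x)"

definition symb :: "(nat^'n \<Rightarrow> complex) \<Rightarrow> nat \<Rightarrow> real^'n \<Rightarrow> complex" where
  "symb a m \<xi> = (\<Sum>\<alpha>\<in>multi_indices m. a \<alpha> * of_real (\<Prod>j\<in>UNIV. (\<xi> $ j) ^ (\<alpha> $ j)))"

definition symbZ :: "(nat^'n \<Rightarrow> complex) \<Rightarrow> nat \<Rightarrow> int^'n \<Rightarrow> complex" where
  "symbZ a m n = symb a m (lattice_vec n)"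

definition symmetric_op :: "(nat^'n \<Rightarrow> complex) \<Rightarrow> nat \<Rightarrow> bool" where
  "symmetric_op a m \<longleftrightarrow>
     (\<forall>g h. periodic g \<and> Ck m g \<and> periodic h \<and> Ck m h \<longrightarrow>
        (LINT x|lebesgue_on torus. AD a m g x * cnj (h x)) =
        (LINT x|lebesgue_on torus. g x * cnj (AD a m h x)))"

definition positive_elliptic :: "(nat^'n \<Rightarrow> complex) \<Rightarrow> nat \<Rightarrow> bool" where
  "positive_elliptic a m \<longleftrightarrow>
     (\<forall>\<xi>. \<xi> \<noteq> 0 \<longrightarrow> symb a m \<xi> \<in> \<real> \<and> 0 < Re (symb a m \<xi>))"

text \<open>\<^term>\<open>A_power a m \<sigma> g h\<close> says that \<open>g\<close> lies in the domain of the power \<open>\<sigma> > 0\<close> of the closure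
  of \<open>A(D)\<close> and that \<open>h\<close> is (a representative of) the image of \<open>g\<close>, i.e. the \<open>L\<^sub>2\<close>-sum of the
  series \<open>\<Sum>\<^sub>n A(n)\<^sup>\<sigma> g\<^sub>n e\<^sup>i\<^sup>n\<^sup>x\<close>. For an operator of positive order,
  \<open>A(0) = 0\<close>, and \<open>0 powr \<sigma> = 0\<close>.\<close>

definition A_power ::
  "(nat^'n \<Rightarrow> complex) \<Rightarrow> nat \<Rightarrow> real \<Rightarrow> (real^'n \<Rightarrow> complex) \<Rightarrow> (real^'n \<Rightarrow> complex) \<Rightarrow> bool" where
  "A_power a m \<sigma> g h \<longleftrightarrow>
     g \<in> L2 \<and>
     (\<lambda>n. cmod (symbZ a m n powr of_real (2 * \<sigma>)) * (cmod (fourier_coeff g n))\<^sup>2) summable_on UNIV \<and>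
     h \<in> L2 \<and>
     ((\<lambda>S. L2_norm (\<lambda>x.
          (\<Sum>n\<in>S. symbZ a m n powr of_real \<sigma> * fourier_coeff g n * expi n x) - h x)) \<longlongrightarrow> 0)
       (finite_subsets_at_top UNIV)"


section \<open>Fractional derivatives and the Mittag-Leffler function\<close>

text \<open>Riemann--Liouville operator of order \<open>\<rho> \<le> 0\<close>, together with the existence of the integral
  defining it.\<close>

definition rl_integral_exists :: "real \<Rightarrow> (real \<Rightarrow> complex) \<Rightarrow> real \<Rightarrow> bool" where
  "rl_integral_exists \<rho> h t \<longleftrightarrow>
     (\<rho> < 0 \<longrightarrow> set_integrable lborel {0<..<t} (\<lambda>\<xi>. h \<xi> / of_real ((t - \<xi>) powr (\<rho> + 1))))"

definition rl_integral :: "real \<Rightarrow> (real \<Rightarrow> complex) \<Rightarrow> real \<Rightarrow> complex" where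
  "rl_integral \<rho> h t =
     (if \<rho> < 0
      then (LINT \<xi>:{0<..<t}|lborel. h \<xi> / of_real ((t - \<xi>) powr (\<rho> + 1))) / of_real (Gamma (- \<rho>))
      else h t)"

text \<open>\<^term>\<open>has_rl_derivative T \<rho> h v t\<close>: the derivative of order \<open>0 < \<rho> \<le> 1\<close> at \<open>t\<close> of a
  function \<open>h\<close> given on \<open>(0, T]\<close> exists and equals \<open>v\<close>. It is one-sided at \<open>t = T\<close>.\<close>

definition has_rl_derivative ::
  "real \<Rightarrow> real \<Rightarrow> (real \<Rightarrow> complex) \<Rightarrow> complex \<Rightarrow> real \<Rightarrow> bool" where
  "has_rl_derivative T \<rho> h v t \<longleftrightarrow>
     (\<forall>s\<in>{0<..T}. rl_integral_exists (\<rho> - 1) h s) \<and>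
     (rl_integral (\<rho> - 1) h has_vector_derivative v) (at t within {0<..T})"

definition mittag_leffler :: "real \<Rightarrow> real \<Rightarrow> complex \<Rightarrow> complex" where
  "mittag_leffler \<rho> \<mu> z = (\<Sum>k. z ^ k / of_real (Gamma (\<rho> * real k + \<mu>)))"


section \<open>Regular solutions\<close>

text \<open>\<open>v\<close> is the fractional time derivative of \<open>u\<close>, and \<open>w\<close> is the continuous function on
  \<open>\<real>\<^sup>N \<times> [0, T]\<close> which the integral of order \<open>\<rho> - 1\<close> of \<open>u\<close> has to be. For \<open>\<rho> < 1\<close> that
  integral is defined only for \<open>t > 0\<close>, so \<open>w\<close> is its continuous extension to \<open>t = 0\<close>; for
  \<open>\<rho> = 1\<close> it is \<open>u\<close> itself, also at \<open>t = 0\<close>.\<close>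

definition regular_solution ::
  "(nat^'n \<Rightarrow> complex) \<Rightarrow> nat \<Rightarrow> real \<Rightarrow> real \<Rightarrow> (real^'n \<Rightarrow> complex) \<Rightarrow>
   (real^'n \<Rightarrow> real \<Rightarrow> complex) \<Rightarrow> (real^'n \<Rightarrow> real \<Rightarrow> complex) \<Rightarrow> bool" where
  "regular_solution a m \<rho> T \<phi> f u \<longleftrightarrow>
     (\<forall>t\<in>{0<..T}. periodic (\<lambda>x. u x t) \<and> Ck m (\<lambda>x. u x t)) \<and>
     (\<forall>\<alpha>\<in>multi_indices m.
        continuous_on (UNIV \<times> {0<..T}) (\<lambda>(x, t). D_multi \<alpha> (\<lambda>y. u y t) x)) \<and>
     continuous_on (UNIV \<times> {0<..T}) (\<lambda>(x, t). AD a m (\<lambda>y. u y t) x) \<and>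
     (\<exists>v. continuous_on (UNIV \<times> {0<..T}) (\<lambda>(x, t). v x t) \<and>
          (\<forall>x. \<forall>t\<in>{0<..T}. has_rl_derivative T \<rho> (u x) (v x t) t \<and>
                            v x t + AD a m (\<lambda>y. u y t) x = f x t)) \<and>
     (\<exists>w. continuous_on (UNIV \<times> {0..T}) (\<lambda>(x, t). w x t) \<and>
          (\<forall>x. \<forall>t\<in>{0..T}. 0 < t \<or> \<rho> = 1 \<longrightarrow> w x t = rl_integral (\<rho> - 1) (u x) t)) \<and>
     (\<forall>x. (rl_integral (\<rho> - 1) (u x) \<longlongrightarrow> \<phi> x) (at_right 0))"

text \<open>The \<open>n\<close>-th coefficient of the series for the solution.\<close>

definition solution_coeff ::
  "(nat^'n \<Rightarrow> complex) \<Rightarrow> nat \<Rightarrow> real \<Rightarrow> (real^'n \<Rightarrow> complex) \<Rightarrow>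
   (real^'n \<Rightarrow> real \<Rightarrow> complex) \<Rightarrow> int^'n \<Rightarrow> real \<Rightarrow> complex" where
  "solution_coeff a m \<rho> \<phi> f n t =
     fourier_coeff \<phi> n * of_real (t powr (\<rho> - 1)) *
       mittag_leffler \<rho> \<rho> (- symbZ a m n * of_real (t powr \<rho>)) +
     (LINT \<xi>:{0<..<t}|lborel.
        fourier_coeff (\<lambda>x. f x (t - \<xi>)) n * of_real (\<xi> powr (\<rho> - 1)) *
        mittag_leffler \<rho> \<rho> (- symbZ a m n * of_real (\<xi> powr \<rho>)))"

end

theory Submission
  imports Defs
begin

text \<open>The \<open>n\<close>-th Fourier mode solves a scalar relaxation equation whose fundamental solution is
  \<open>e(t) = t\<^bsup>\<rho>-1\<^esup> E\<^bsub>\<rho>,\<rho>\<^esub>(-\<kappa> t\<^sup>\<rho>)\<close> with \<open>\<kappa> = A(n)\<close>. Everything rests on \<open>0 \<le> e\<close> and \<open>\<kappa> e(t) \<le> \<rho> / t\<close>.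
  Both are obtained without contour integrals: positivity from the Volterra equation of \<open>e\<close> with
  the log-convex Abel kernel, and the decay from the convolution identity \<open>t e = \<rho> (y * e)\<close>, where
  \<open>y = 1 - \<kappa> \<integral> e\<close> takes values in \<open>[0, 1]\<close>. Interpolation gives
  \<open>(1 + \<kappa>) e(t) \<le> C (1 + \<kappa>)\<^sup>\<epsilon> t\<^bsup>\<epsilon>\<rho>-1\<^esup>\<close>, so that \<open>A(D) u\<close> converges absolutely, uniformly for \<open>t\<close> away
  from \<open>0\<close>, as soon as \<open>\<Sum>\<^sub>n (1 + A(n))\<^sup>\<epsilon> |f\<^sub>n(t)|\<close> converges uniformly in \<open>t\<close>. Since \<open>\<tau> > N/2\<close>, for small
  \<open>\<epsilon>\<close> the latter follows by Cauchy--Schwarz from Bessel's inequality for \<open>F(t)\<close>.\<close>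

section \<open>Mittag-Leffler functions\<close>

text \<open>The decay bound alone is too weak: \<rho> / t is not integrable at 0, so it cannot be
  convolved with f. Paying the factor (1 + \<kappa>)^\<epsilon> yields a majorant kernel that is
  integrable and the same for all modes, so that summation over modes acts on the data only.
  Uniformity in t then needs only boundedness of F: Cauchy-Schwarz leaves the tail of one fixed
  convergent series times a Bessel bound. F is blind to the mode n = 0, because A(0) = 0; that mode
  is a single term, and its continuity in t is a separate hypothesis. For \<rho> < 1 the series for
  u is singular at t = 0, and f is merely continuous in t, so u itself is never differentiated in
  time. What is carried down to t = 0 and differentiated is its fractional integral of order 1 -
  \<rho>, in the closed form y p + y * f; its derivative f - \<kappa> u is read off from y = 1 -
  \<kappa> \<integral> e. The equation has to hold pointwise. This rests on inversion for continuous
  periodic functions with absolutely summable Fourier coefficients, proved via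
  Stone-Weierstrass.\<close>

lemma set_integral_series:
  fixes f :: "nat \<Rightarrow> 'a \<Rightarrow> 'b::{banach, second_countable_topology}"
  assumes int: "\<And>i. set_integrable M A (f i)"
    and summ: "\<And>x. x \<in> A \<Longrightarrow> summable (\<lambda>i. norm (f i x))"
    and summ_int: "summable (\<lambda>i. LINT x:A|M. norm (f i x))"
  shows "set_integrable M A (\<lambda>x. \<Sum>i. f i x)"
    and "(\<lambda>i. LINT x:A|M. f i x) sums (LINT x:A|M. (\<Sum>i. f i x))"
proof -
  let ?g = "\<lambda>i x. indicat_real A x *\<^sub>R f i x"
  have 1: "integrable M (?g i)" for i
    using int by (simp add: set_integrable_def)
  have 2: "AE x in M. summable (\<lambda>i. norm (?g i x))"
  proof (rule AE_I2)
    fix x show "summable (\<lambda>i. norm (?g i x))"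
      using summ[of x] by (cases "x \<in> A") auto
  qed
  have 3: "summable (\<lambda>i. LINT x|M. norm (?g i x))"
    using summ_int by (simp add: set_lebesgue_integral_def)
  have eq: "(\<lambda>x. \<Sum>i. ?g i x) = (\<lambda>x. indicat_real A x *\<^sub>R (\<Sum>i. f i x))"
    by (auto simp: indicator_def)
  show "set_integrable M A (\<lambda>x. \<Sum>i. f i x)"
    using integrable_suminf[OF 1 2 3] by (simp add: set_integrable_def eq)
  show "(\<lambda>i. LINT x:A|M. f i x) sums (LINT x:A|M. (\<Sum>i. f i x))"
    using sums_integral[OF 1 2 3] by (simp add: set_lebesgue_integral_def eq)
qed

text \<open>For nonnegative integrands gauge integrability is absolute, which carries the Beta
  integral over to \<open>lborel\<close>. The open interval keeps the singular endpoints
  out.\<close>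

lemma set_integral_nonneg_has_integral:
  fixes f :: "real \<Rightarrow> real"
  assumes f: "(f has_integral I) {a..b}"
    and nonneg: "\<And>x. x \<in> {a<..<b} \<Longrightarrow> 0 \<le> f x"
    and meas: "set_borel_measurable borel {a<..<b} f"
  shows "set_integrable lborel {a<..<b} f" and "(LINT x:{a<..<b}|lborel. f x) = I"
proof -
  have f': "(f has_integral I) {a<..<b}"
    using f by (simp add: has_integral_Icc_iff_Ioo)
  then have "f absolutely_integrable_on {a<..<b}"
    using nonneg by (intro nonnegative_absolutely_integrable_1) auto
  then have "integrable lebesgue (\<lambda>x. indicat_real {a<..<b} x *\<^sub>R f x)"
    by (simp add: set_integrable_def)
  then show *: "set_integrable lborel {a<..<b} f"
    using meas by (simp add: set_integrable_def set_borel_measurable_def integrable_completion)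
  show "(LINT x:{a<..<b}|lborel. f x) = I"
    using set_borel_integral_eq_integral(2)[OF *] f' by (simp add: integral_unique)
qed

section \<open>Abel kernels and growth of the Gamma function\<close>

text \<open>The kernel of fractional integration of order \<gamma>, normalised so that convolution
  adds the orders.\<close>

definition abel_kernel :: "real \<Rightarrow> real \<Rightarrow> real" where
  "abel_kernel \<gamma> s = s powr (\<gamma> - 1) / Gamma \<gamma>"

lemma abel_kernel_pos: "0 < \<gamma> \<Longrightarrow> 0 < s \<Longrightarrow> 0 < abel_kernel \<gamma> s"
  by (simp add: abel_kernel_def)

lemma abel_kernel_nonneg: "0 < \<gamma> \<Longrightarrow> 0 \<le> abel_kernel \<gamma> s"
  by (simp add: abel_kernel_def Gamma_real_pos less_imp_le)

lemma abel_kernel_1: "0 < s \<Longrightarrow> abel_kernel 1 s = 1"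
  by (simp add: abel_kernel_def)

lemma abel_kernel_plus_1: "0 < x \<Longrightarrow> 0 < s \<Longrightarrow> abel_kernel (x + 1) s = s / x * abel_kernel x s"
  using Gamma_plus1[of x] nonpos_Ints_nonpos[of x]
  by (auto simp: abel_kernel_def powr_diff field_simps)

lemma abel_kernel_measurable [measurable]: "abel_kernel \<gamma> \<in> borel_measurable borel"
  unfolding abel_kernel_def by measurable

text \<open>The semigroup law of fractional integration. Scaling (0, t) to (0, 1) turns it into
  Euler's Beta integral, whose value cancels the Gamma normalisations.\<close>

lemma abel_kernel_Beta:
  assumes "0 < \<gamma>" "0 < \<beta>" "0 < t"
  shows "set_integrable lborel {0<..<t} (\<lambda>s. abel_kernel \<gamma> (t - s) * abel_kernel \<beta> s)"
    and "(LINT s:{0<..<t}|lborel. abel_kernel \<gamma> (t - s) * abel_kernel \<beta> s)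
          = abel_kernel (\<gamma> + \<beta>) t"
proof -
  have "((\<lambda>s. s powr (\<beta> - 1) * (1 - s) powr (\<gamma> - 1)) has_integral Beta \<beta> \<gamma>) {0..1}"
    using assms by (intro has_integral_Beta_real)
  then have "((\<lambda>s. s powr (\<beta> - 1) * (1 - s) powr (\<gamma> - 1)) has_integral Beta \<beta> \<gamma>) (cbox 0 1)"
    by simp
  from has_integral_affinity[OF this, of "1/t" 0]
  have "((\<lambda>x. (x / t) powr (\<beta> - 1) * (1 - x / t) powr (\<gamma> - 1)) has_integral t * Beta \<beta> \<gamma>) {0..t}"
    using assms by (simp add: image_affinity_atLeastAtMost_div image_mult_atLeastAtMost)
  from has_integral_mult_right[OF this, of "t powr (\<beta> - 1) * t powr (\<gamma> - 1) / (Gamma \<beta> * Gamma \<gamma>)"]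
  have "((\<lambda>x. (t powr (\<beta> - 1) * t powr (\<gamma> - 1) / (Gamma \<beta> * Gamma \<gamma>)) *
      ((x / t) powr (\<beta> - 1) * (1 - x / t) powr (\<gamma> - 1)))
      has_integral abel_kernel (\<gamma> + \<beta>) t) {0..t}"
  proof (rule has_integral_eq_rhs)
    have "t powr (\<beta> - 1) * t powr (\<gamma> - 1) * t = t powr (\<gamma> + \<beta> - 1)"
      using assms by (simp add: powr_diff powr_add)
    then show "abel_kernel (\<gamma> + \<beta>) t =
        t powr (\<beta> - 1) * t powr (\<gamma> - 1) / (Gamma \<beta> * Gamma \<gamma>) * (t * Beta \<beta> \<gamma>)"
      using assms Gamma_real_pos[of \<beta>] Gamma_real_pos[of \<gamma>]
      by (simp add: abel_kernel_def Beta_def field_simps less_imp_neq[THEN not_sym])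
  qed
  then have "((\<lambda>s. abel_kernel \<gamma> (t - s) * abel_kernel \<beta> s)
      has_integral abel_kernel (\<gamma> + \<beta>) t) {0..t}"
  proof (rule has_integral_eq[rotated])
    fix s assume s: "s \<in> {0..t}"
    have "1 - s / t = (t - s) / t" using assms by (simp add: field_simps)
    then show "(t powr (\<beta> - 1) * t powr (\<gamma> - 1) / (Gamma \<beta> * Gamma \<gamma>)) *
      ((s / t) powr (\<beta> - 1) * (1 - s / t) powr (\<gamma> - 1)) = abel_kernel \<gamma> (t - s) * abel_kernel \<beta> s"
      using s assms by (simp add: powr_divide abel_kernel_def mult.commute)
  qed
  note * = set_integral_nonneg_has_integral[OF this]
  have m: "set_borel_measurable borel {0<..<t} (\<lambda>s. abel_kernel \<gamma> (t - s) * abel_kernel \<beta> s)"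
    unfolding set_borel_measurable_def by measurable
  have n: "0 \<le> abel_kernel \<gamma> (t - s) * abel_kernel \<beta> s" for s
    using assms by (simp add: abel_kernel_nonneg)
  show "set_integrable lborel {0<..<t} (\<lambda>s. abel_kernel \<gamma> (t - s) * abel_kernel \<beta> s)"
    and "(LINT s:{0<..<t}|lborel. abel_kernel \<gamma> (t - s) * abel_kernel \<beta> s)
          = abel_kernel (\<gamma> + \<beta>) t"
    using *[OF n m] by simp_all
qed

text \<open>Keep only the window [R, R+1] of Euler's integral and estimate both factors at its worse
  end. Since R is free, Gamma outgrows every geometric sequence; this takes the place of Stirling's
  formula.\<close>

lemma Gamma_real_lower_bound:
  fixes x R :: real
  assumes "1 \<le> x" "0 < R"
  shows "R powr (x - 1) / exp (R + 1) \<le> Gamma x"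
proof -
  have "((\<lambda>_. R powr (x - 1) / exp (R + 1)) has_integral R powr (x - 1) / exp (R + 1)) {R..R+1}"
    using has_integral_const_real[of "R powr (x - 1) / exp (R + 1)" R "R + 1"] by simp
  moreover have "((\<lambda>t. if t \<in> {R..R+1} then t powr (x - 1) / exp t else 0) has_integral
      integral {R..R+1} (\<lambda>t. t powr (x - 1) / exp t)) UNIV"
    using integrable_on_subinterval[OF has_integral_integrable[OF Gamma_integral_real], of x R "R + 1"] assms
    by (subst has_integral_restrict_UNIV) (auto intro!: integrable_integral)
  moreover have G: "((\<lambda>t. if t \<in> {0..} then t powr (x - 1) / exp t else 0) has_integral Gamma x) UNIV"
    using Gamma_integral_real[of x] assms by (subst has_integral_restrict_UNIV) auto
  ultimately have "((\<lambda>t. if t \<in> {R..R+1} then R powr (x - 1) / exp (R + 1) else 0) has_integral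
      R powr (x - 1) / exp (R + 1)) UNIV"
    by (subst has_integral_restrict_UNIV)
  from has_integral_le[OF this G] show ?thesis
  proof -
    have "(if t \<in> {R..R+1} then R powr (x - 1) / exp (R + 1) else 0)
        \<le> (if t \<in> {0..} then t powr (x - 1) / exp t else 0)" for t
      using assms by (auto intro!: frac_le powr_mono2)
    then show ?thesis
      using \<open>(\<And>xa. xa \<in> UNIV \<Longrightarrow> _ xa \<le> _ xa) \<Longrightarrow> _\<close> by blast
  qed
qed

section \<open>Mittag-Leffler kernels as series of Abel kernels\<close>

text \<open>This is \<open>s powr (\<beta> - 1)\<close> times the Mittag-Leffler function at
  \<open>z * s powr \<rho>\<close> (\<open>ml_kernel_eq_ml_fun\<close>). As a series of Abel kernels
  it is convolved by adding orders term by term.\<close>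

definition ml_kernel :: "real \<Rightarrow> real \<Rightarrow> real \<Rightarrow> real \<Rightarrow> real" where
  "ml_kernel \<rho> \<beta> z s = (\<Sum>k. z ^ k * abel_kernel (\<rho> * real k + \<beta>) s)"

lemma ml_series_summable:
  assumes "0 < \<rho>" "0 < \<beta>"
  shows "summable (\<lambda>k. \<bar>z\<bar> ^ k / Gamma (\<rho> * real k + \<beta>))"
proof -
  \<comment> \<open>Chosen so that R^\<rho> = 2|z| + 1: the Gamma bound at this R leaves a geometric
    series of ratio |z| / (2|z| + 1), at most 1/2.\<close>
  define R where "R = (2 * \<bar>z\<bar> + 1) powr (1 / \<rho>)"
  have R: "0 < R" "R powr \<rho> = 2 * \<bar>z\<bar> + 1"
    using assms by (auto simp: R_def powr_powr)
  define C where "C = exp (R + 1) / R powr (\<beta> - 1)"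
  \<comment> \<open>From K on the argument of Gamma is at least 1, as
    \<open>Gamma_real_lower_bound\<close> requires.\<close>
  obtain K :: nat where K: "1 / \<rho> < real K"
    using reals_Archimedean2 by blast
  show ?thesis
  proof (rule summable_comparison_test')
    show "summable (\<lambda>k. C * (1/2) ^ k)"
      by (intro summable_mult summable_geometric) auto
    fix k assume k: "K \<le> k"
    have "1 < \<rho> * real K" using K assms by (simp add: field_simps)
    also have "\<dots> \<le> \<rho> * real k" using k assms by simp
    finally have "1 \<le> \<rho> * real k + \<beta>" using assms by simp
    from Gamma_real_lower_bound[OF this R(1)]
    have G: "R powr (\<rho> * real k + \<beta> - 1) / exp (R + 1) \<le> Gamma (\<rho> * real k + \<beta>)" .
    have "R powr (\<rho> * real k + \<beta> - 1) = (R powr \<rho>) ^ k * R powr (\<beta> - 1)"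
      using R(1) by (simp add: powr_realpow[symmetric] powr_powr powr_add[symmetric] algebra_simps)
    with G have G': "(2 * \<bar>z\<bar> + 1) ^ k / C \<le> Gamma (\<rho> * real k + \<beta>)"
      using R by (simp add: C_def)
    have Gp: "0 < (2 * \<bar>z\<bar> + 1) ^ k / C"
      using R by (simp add: C_def)
    have "\<bar>z\<bar> ^ k / Gamma (\<rho> * real k + \<beta>) \<le> \<bar>z\<bar> ^ k / ((2 * \<bar>z\<bar> + 1) ^ k / C)"
      using G' Gp by (intro divide_left_mono mult_pos_pos) auto
    also have "\<dots> = C * (\<bar>z\<bar> / (2 * \<bar>z\<bar> + 1)) ^ k"
      by (simp add: power_divide)
    also have "\<dots> \<le> C * (1/2) ^ k"
      by (intro mult_left_mono power_mono) (auto simp: C_def field_simps)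
    finally show "norm (\<bar>z\<bar> ^ k / Gamma (\<rho> * real k + \<beta>)) \<le> C * (1/2) ^ k"
      using Gp G' by (simp add: abs_mult)
  qed
qed

lemma ml_series_summable':
  assumes "0 < \<rho>" "0 < \<beta>"
  shows "summable (\<lambda>k. z ^ k / Gamma (\<rho> * real k + \<beta>))"
proof (rule summable_rabs_cancel)
  have "0 < Gamma (\<rho> * real k + \<beta>)" for k
    using assms by (simp add: add_nonneg_pos Gamma_real_pos)
  then have "\<bar>z ^ k / Gamma (\<rho> * real k + \<beta>)\<bar> = \<bar>z\<bar> ^ k / Gamma (\<rho> * real k + \<beta>)" for k
    by (simp add: power_abs less_imp_le)
  then show "summable (\<lambda>k. \<bar>z ^ k / Gamma (\<rho> * real k + \<beta>)\<bar>)"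
    using ml_series_summable[OF assms, of z] by simp
qed

lemma abel_kernel_scale:
  assumes "0 < s"
  shows "z ^ k * abel_kernel (\<rho> * real k + \<beta>) s
    = s powr (\<beta> - 1) * ((z * s powr \<rho>) ^ k / Gamma (\<rho> * real k + \<beta>))"
proof -
  have "s powr (\<rho> * real k + \<beta> - 1) = s powr (\<beta> - 1) * (s powr \<rho>) ^ k"
    using assms by (simp add: powr_realpow[symmetric] powr_powr powr_add[symmetric] algebra_simps)
  then show ?thesis by (simp add: abel_kernel_def power_mult_distrib)
qed

lemma ml_kernel_summable:
  assumes "0 < \<rho>" "0 < \<beta>" "0 < s"
  shows "summable (\<lambda>k. \<bar>z ^ k * abel_kernel (\<rho> * real k + \<beta>) s\<bar>)"
proof -
  have "\<bar>z ^ k * abel_kernel (\<rho> * real k + \<beta>) s\<bar>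
      = s powr (\<beta> - 1) * (\<bar>z * s powr \<rho>\<bar> ^ k / Gamma (\<rho> * real k + \<beta>))" for k
    using assms Gamma_real_pos[of "\<rho> * real k + \<beta>"]
    by (subst abel_kernel_scale) (auto simp: abs_mult power_abs add_nonneg_pos)
  moreover have "summable (\<lambda>k. s powr (\<beta> - 1) * (\<bar>z * s powr \<rho>\<bar> ^ k / Gamma (\<rho> * real k + \<beta>)))"
    using assms by (intro summable_mult ml_series_summable)
  ultimately show ?thesis by simp
qed

lemma ml_kernel_sums:
  assumes "0 < \<rho>" "0 < \<beta>" "0 < s"
  shows "(\<lambda>k. z ^ k * abel_kernel (\<rho> * real k + \<beta>) s) sums ml_kernel \<rho> \<beta> z s"
  unfolding ml_kernel_def
  by (rule summable_sums[OF summable_rabs_cancel[OF ml_kernel_summable[OF assms]]])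

text \<open>Fractional integration of order \<gamma> raises \<beta> by \<gamma>, term by term
  through the semigroup law. The Abel kernels are nonnegative, so the series of norms is the same
  series at |z|, which justifies the interchange.\<close>

lemma ml_kernel_abel:
  assumes "0 < \<rho>" "0 < \<beta>" "0 < \<gamma>" "0 < t"
  shows "set_integrable lborel {0<..<t} (\<lambda>s. abel_kernel \<gamma> (t - s) * ml_kernel \<rho> \<beta> z s)"
    and "(LINT s:{0<..<t}|lborel. abel_kernel \<gamma> (t - s) * ml_kernel \<rho> \<beta> z s) = ml_kernel \<rho> (\<beta> + \<gamma>) z t"
proof -
  let ?f = "\<lambda>k s. z ^ k * (abel_kernel \<gamma> (t - s) * abel_kernel (\<rho> * real k + \<beta>) s)"
  have b: "0 < \<rho> * real k + \<beta>" for k using assms by (simp add: add_nonneg_pos)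
  have 1: "set_integrable lborel {0<..<t} (?f k)" for k
    using abel_kernel_Beta(1)[OF \<open>0 < \<gamma>\<close> b \<open>0 < t\<close>] by simp
  have 2: "summable (\<lambda>k. norm (?f k s))" if "s \<in> {0<..<t}" for s
  proof -
    have "norm (?f k s) = \<bar>abel_kernel \<gamma> (t - s)\<bar> * \<bar>z ^ k * abel_kernel (\<rho> * real k + \<beta>) s\<bar>" for k
      by (simp add: abs_mult)
    then show ?thesis
      using ml_kernel_summable[of \<rho> \<beta> s z] assms that by (simp add: summable_mult del: abs_mult)
  qed
  have I: "(LINT s:{0<..<t}|lborel. w * (abel_kernel \<gamma> (t - s) * abel_kernel (\<rho> * real k + \<beta>) s))
      = w * abel_kernel (\<rho> * real k + (\<beta> + \<gamma>)) t" for k w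
    using abel_kernel_Beta(2)[OF \<open>0 < \<gamma>\<close> b \<open>0 < t\<close>, of k] by (simp add: add_ac)
  have "norm (?f k s) = \<bar>z\<bar> ^ k * (abel_kernel \<gamma> (t - s) * abel_kernel (\<rho> * real k + \<beta>) s)" for k s
    using abel_kernel_nonneg[OF \<open>0 < \<gamma>\<close>] abel_kernel_nonneg[OF b] by (simp add: abs_mult power_abs)
  then have "(LINT s:{0<..<t}|lborel. norm (?f k s)) = \<bar>z\<bar> ^ k * abel_kernel (\<rho> * real k + (\<beta> + \<gamma>)) t" for k
    by (simp only: I)
  moreover have "summable (\<lambda>k. \<bar>z\<bar> ^ k * abel_kernel (\<rho> * real k + (\<beta> + \<gamma>)) t)"
    using assms by (intro sums_summable[OF ml_kernel_sums]) auto
  ultimately have 3: "summable (\<lambda>k. LINT s:{0<..<t}|lborel. norm (?f k s))"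
    by (simp only:)
  have eq: "(\<Sum>k. ?f k s) = abel_kernel \<gamma> (t - s) * ml_kernel \<rho> \<beta> z s" if "s \<in> {0<..<t}" for s
  proof -
    have "(\<lambda>k. abel_kernel \<gamma> (t - s) * (z ^ k * abel_kernel (\<rho> * real k + \<beta>) s)) sums
        (abel_kernel \<gamma> (t - s) * ml_kernel \<rho> \<beta> z s)"
      using assms that by (intro sums_mult ml_kernel_sums) auto
    then show ?thesis by (simp add: sums_iff mult.left_commute)
  qed
  note * = set_integral_series[OF 1 2 3]
  have "set_integrable lborel {0<..<t} (\<lambda>s. \<Sum>k. ?f k s) \<longleftrightarrow>
      set_integrable lborel {0<..<t} (\<lambda>s. abel_kernel \<gamma> (t - s) * ml_kernel \<rho> \<beta> z s)"
    by (intro set_integrable_cong refl eq)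
  then show "set_integrable lborel {0<..<t} (\<lambda>s. abel_kernel \<gamma> (t - s) * ml_kernel \<rho> \<beta> z s)"
    using *(1) by simp
  have "(LINT s:{0<..<t}|lborel. (\<Sum>k. ?f k s)) =
      (LINT s:{0<..<t}|lborel. abel_kernel \<gamma> (t - s) * ml_kernel \<rho> \<beta> z s)"
    by (intro set_lebesgue_integral_cong) (auto simp: eq)
  then have "(\<lambda>k. z ^ k * abel_kernel (\<rho> * real k + (\<beta> + \<gamma>)) t) sums
     (LINT s:{0<..<t}|lborel. abel_kernel \<gamma> (t - s) * ml_kernel \<rho> \<beta> z s)"
    using *(2) by (simp only: I)
  then show "(LINT s:{0<..<t}|lborel. abel_kernel \<gamma> (t - s) * ml_kernel \<rho> \<beta> z s) = ml_kernel \<rho> (\<beta> + \<gamma>) z t"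
    using ml_kernel_sums[of \<rho> "\<beta> + \<gamma>" t z] assms sums_unique2 by fastforce
qed

definition ml_fun :: "real \<Rightarrow> real \<Rightarrow> real \<Rightarrow> real" where
  "ml_fun \<rho> \<beta> z = (\<Sum>k. z ^ k / Gamma (\<rho> * real k + \<beta>))"

lemma isCont_ml_fun:
  assumes "0 < \<rho>" "0 < \<beta>"
  shows "isCont (ml_fun \<rho> \<beta>) z"
proof -
  have "summable (\<lambda>k. 1 / Gamma (\<rho> * real k + \<beta>) * w ^ k)" for w
    using ml_series_summable'[OF assms, of w] by simp
  then have "isCont (\<lambda>x. \<Sum>k. 1 / Gamma (\<rho> * real k + \<beta>) * x ^ k) z"
    by (intro isCont_powser_converges_everywhere) auto
  then show ?thesis unfolding ml_fun_def[abs_def] by simp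
qed

lemma ml_kernel_eq_ml_fun:
  assumes "0 < \<rho>" "0 < \<beta>" "0 < s"
  shows "ml_kernel \<rho> \<beta> z s = s powr (\<beta> - 1) * ml_fun \<rho> \<beta> (z * s powr \<rho>)"
  unfolding ml_kernel_def ml_fun_def abel_kernel_scale[OF assms(3)]
  by (intro suminf_mult ml_series_summable' assms)

lemma ml_fun_0: "ml_fun \<rho> \<beta> 0 = 1 / Gamma \<beta>"
  using powser_zero[of "\<lambda>k. 1 / Gamma (\<rho> * real k + \<beta>)"] by (simp add: ml_fun_def)

lemma continuous_on_ml_kernel:
  assumes "0 < \<rho>" "0 < \<beta>"
  shows "continuous_on {0<..} (ml_kernel \<rho> \<beta> z)"
proof -
  have "continuous_on UNIV (ml_fun \<rho> \<beta>)"
    using isCont_ml_fun[OF assms] by (simp add: continuous_at_imp_continuous_on)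
  then have "continuous_on {0<..} (\<lambda>s. ml_fun \<rho> \<beta> (z * s powr \<rho>))"
    by (rule continuous_on_compose2) (auto intro!: continuous_intros)
  then have "continuous_on {0<..} (\<lambda>s. s powr (\<beta> - 1) * ml_fun \<rho> \<beta> (z * s powr \<rho>))"
    by (intro continuous_intros) auto
  then show ?thesis
    by (rule continuous_on_eq) (simp add: ml_kernel_eq_ml_fun assms)
qed

text \<open>Splitting off the term k = 0. Combined with \<open>ml_kernel_abel\<close> it yields the
  Volterra equation of the resolvent and the relation between the relaxation function and the
  integral of the resolvent.\<close>

lemma ml_kernel_shift:
  assumes "0 < \<rho>" "0 < \<beta>" "0 < s"
  shows "ml_kernel \<rho> \<beta> z s = abel_kernel \<beta> s + z * ml_kernel \<rho> (\<beta> + \<rho>) z s"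
proof -
  have "(\<lambda>k. z ^ Suc k * abel_kernel (\<rho> * real (Suc k) + \<beta>) s) sums
      (ml_kernel \<rho> \<beta> z s - z ^ 0 * abel_kernel (\<rho> * real 0 + \<beta>) s)"
    by (rule iffD2[OF sums_Suc_iff]) (use ml_kernel_sums[OF assms, of z] in simp)
  moreover have "(\<lambda>k. z * (z ^ k * abel_kernel (\<rho> * real k + (\<beta> + \<rho>)) s)) sums
      (z * ml_kernel \<rho> (\<beta> + \<rho>) z s)"
    using assms by (intro sums_mult ml_kernel_sums) auto
  ultimately show ?thesis
    using sums_unique2 by (fastforce simp: algebra_simps)
qed

lemma set_integral_split:
  fixes f :: "real \<Rightarrow> 'a::{banach, second_countable_topology}"
  assumes f: "set_integrable lborel {a<..<c} f" and "a < b" "b < c"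
  shows "(LINT s:{a<..<c}|lborel. f s) = (LINT s:{a<..<b}|lborel. f s) + (LINT s:{b<..<c}|lborel. f s)"
proof -
  have 1: "set_integrable lborel {a<..<b} f" "set_integrable lborel {b<..<c} f"
    using assms by (auto intro: set_integrable_subset[OF f])
  have *: "{a<..<c} = ({a<..<b} \<union> {b<..<c}) \<union> {b}"
    using assms by auto
  have ae: "AE x in lborel. x \<noteq> b" by (rule AE_lborel_singleton)
  have "(LINT s:{a<..<c}|lborel. f s) = (LINT s:{a<..<b} \<union> {b<..<c}|lborel. f s)"
    unfolding set_lebesgue_integral_def
  proof (rule integral_cong_AE)
    show "(\<lambda>x. indicat_real {a<..<c} x *\<^sub>R f x) \<in> borel_measurable lborel"
      using f by (auto simp: set_integrable_def)
    have "set_integrable lborel ({a<..<b} \<union> {b<..<c}) f"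
      using 1 by (intro set_integrable_Un) auto
    then show "(\<lambda>x. indicat_real ({a<..<b} \<union> {b<..<c}) x *\<^sub>R f x) \<in> borel_measurable lborel"
      by (auto simp: set_integrable_def)
    show "AE x in lborel. indicat_real {a<..<c} x *\<^sub>R f x = indicat_real ({a<..<b} \<union> {b<..<c}) x *\<^sub>R f x"
      using ae by eventually_elim (auto simp: * indicator_def)
  qed
  also have "\<dots> = (LINT s:{a<..<b}|lborel. f s) + (LINT s:{b<..<c}|lborel. f s)"
    using 1 assms by (intro set_integral_Un) auto
  finally show ?thesis .
qed

lemma set_integral_shift:
  fixes f :: "real \<Rightarrow> 'a::{banach, second_countable_topology}"
  shows "(LINT s:{a<..<b}|lborel. f s) = (LINT r:{0<..<b - a}|lborel. f (a + r))"
    and "set_integrable lborel {a<..<b} f \<longleftrightarrow> set_integrable lborel {0<..<b - a} (\<lambda>r. f (a + r))"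
proof -
  have eq: "indicat_real {a<..<b} (a + 1 * r) *\<^sub>R f (a + 1 * r) = indicat_real {0<..<b - a} r *\<^sub>R f (a + r)" for r
    by (auto simp: indicator_def)
  show "(LINT s:{a<..<b}|lborel. f s) = (LINT r:{0<..<b - a}|lborel. f (a + r))"
    unfolding set_lebesgue_integral_def
    by (subst lborel_integral_real_affine[where c = 1 and t = a]) (simp_all only: eq, simp_all)
  show "set_integrable lborel {a<..<b} f \<longleftrightarrow> set_integrable lborel {0<..<b - a} (\<lambda>r. f (a + r))"
    unfolding set_integrable_def
    by (subst lborel_integrable_real_affine_iff[where c = 1 and t = a, symmetric]) (simp, simp only: eq)
qed

lemma set_integral_flip:
  fixes f :: "real \<Rightarrow> 'a::{banach, second_countable_topology}"
  shows "(LINT s:{0<..<t}|lborel. f (t - s)) = (LINT s:{0<..<t}|lborel. f s)"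
    and "set_integrable lborel {0<..<t} (\<lambda>s. f (t - s)) \<longleftrightarrow> set_integrable lborel {0<..<t} f"
proof -
  have eq: "indicat_real {0<..<t} (t + -1 * r) *\<^sub>R f (t + -1 * r) = indicat_real {0<..<t} r *\<^sub>R f (t - r)" for r
    by (auto simp: indicator_def)
  show "(LINT s:{0<..<t}|lborel. f (t - s)) = (LINT s:{0<..<t}|lborel. f s)"
    unfolding set_lebesgue_integral_def
    by (subst (2) lborel_integral_real_affine[where c = "-1" and t = t]) (simp_all only: eq, simp_all)
  show "set_integrable lborel {0<..<t} (\<lambda>s. f (t - s)) \<longleftrightarrow> set_integrable lborel {0<..<t} f"
    unfolding set_integrable_def
    by (subst (2) lborel_integrable_real_affine_iff[where c = "-1" and t = t, symmetric]) (simp, simp only: eq)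
qed

lemma set_integral_nonneg:
  fixes f :: "'a \<Rightarrow> real"
  assumes "\<And>x. x \<in> A \<Longrightarrow> 0 \<le> f x"
  shows "0 \<le> (LINT x:A|M. f x)"
  unfolding set_lebesgue_integral_def
  by (intro integral_nonneg_AE AE_I2) (use assms in \<open>auto simp: indicator_def\<close>)

lemma abel_kernel_integral:
  assumes "0 < \<gamma>" "0 < t"
  shows "set_integrable lborel {0<..<t} (\<lambda>s. abel_kernel \<gamma> (t - s))"
    and "(LINT s:{0<..<t}|lborel. abel_kernel \<gamma> (t - s)) = abel_kernel (\<gamma> + 1) t"
proof -
  have "set_integrable lborel {0<..<t} (\<lambda>s. abel_kernel \<gamma> (t - s) * abel_kernel 1 s) \<longleftrightarrow>
      set_integrable lborel {0<..<t} (\<lambda>s. abel_kernel \<gamma> (t - s))"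
    by (intro set_integrable_cong) (auto simp: abel_kernel_1)
  then show "set_integrable lborel {0<..<t} (\<lambda>s. abel_kernel \<gamma> (t - s))"
    using abel_kernel_Beta(1)[of \<gamma> 1 t] assms by simp
  have "(LINT s:{0<..<t}|lborel. abel_kernel \<gamma> (t - s) * abel_kernel 1 s) =
      (LINT s:{0<..<t}|lborel. abel_kernel \<gamma> (t - s))"
    by (intro set_lebesgue_integral_cong) (auto simp: abel_kernel_1)
  then show "(LINT s:{0<..<t}|lborel. abel_kernel \<gamma> (t - s)) = abel_kernel (\<gamma> + 1) t"
    using abel_kernel_Beta(2)[of \<gamma> 1 t] assms by simp
qed

section \<open>Resolvent and relaxation function: positivity, mass and decay\<close>

text \<open>The function e: t^(\<rho>-1) times the Mittag-Leffler function of parameters \<rho>,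
  \<rho> at -\<kappa> t^\<rho>.\<close>

definition resolvent :: "real \<Rightarrow> real \<Rightarrow> real \<Rightarrow> real" where
  "resolvent \<rho> \<kappa> = ml_kernel \<rho> \<rho> (- \<kappa>)"

text \<open>The function y: the Mittag-Leffler function of parameters \<rho>, 1 at -\<kappa>
  t^\<rho>. For \<rho> < 1 it is the fractional integral of order 1 - \<rho> of e
  (\<open>resolvent_abel\<close>).\<close>

definition relaxation :: "real \<Rightarrow> real \<Rightarrow> real \<Rightarrow> real" where
  "relaxation \<rho> \<kappa> = ml_kernel \<rho> 1 (- \<kappa>)"

lemma resolvent_Volterra:
  assumes "0 < \<rho>" "0 < t"
  shows "resolvent \<rho> \<kappa> t =
    abel_kernel \<rho> t - \<kappa> * (LINT s:{0<..<t}|lborel. abel_kernel \<rho> (t - s) * resolvent \<rho> \<kappa> s)"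
  using ml_kernel_shift[of \<rho> \<rho> t "- \<kappa>"] ml_kernel_abel(2)[of \<rho> \<rho> \<rho> t "- \<kappa>"] assms
  by (simp add: resolvent_def)

text \<open>The factor s^(\<rho>-1) is positive and the remaining entire factor tends to 1 / Gamma
  \<rho>. This keeps the times of failed positivity away from 0, so that there is a first
  one.\<close>

lemma resolvent_pos_near_0:
  assumes "0 < \<rho>"
  obtains \<delta> where "0 < \<delta>" "\<And>s. 0 < s \<Longrightarrow> s < \<delta> \<Longrightarrow> 0 < resolvent \<rho> \<kappa> s"
proof -
  have "((\<lambda>s. s powr \<rho>) \<longlongrightarrow> 0) (at_right 0)"
    using tendsto_powr'[of "\<lambda>s::real. s" 0 "at_right 0" "\<lambda>_. \<rho>" \<rho>] assms
    by (auto simp: eventually_at_filter)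
  then have "((\<lambda>s. - \<kappa> * s powr \<rho>) \<longlongrightarrow> - \<kappa> * 0) (at_right 0)"
    by (intro tendsto_intros)
  then have "((\<lambda>s. ml_fun \<rho> \<rho> (- \<kappa> * s powr \<rho>)) \<longlongrightarrow> ml_fun \<rho> \<rho> (- \<kappa> * 0)) (at_right 0)"
    by (rule isCont_tendsto_compose[OF isCont_ml_fun[OF assms assms]])
  then have "((\<lambda>s. ml_fun \<rho> \<rho> (- \<kappa> * s powr \<rho>)) \<longlongrightarrow> 1 / Gamma \<rho>) (at_right 0)"
    by (simp add: ml_fun_0)
  from order_tendstoD(1)[OF this, of 0]
  have "eventually (\<lambda>s. 0 < ml_fun \<rho> \<rho> (- \<kappa> * s powr \<rho>)) (at_right 0)"
    using assms by simp
  then obtain \<delta> where "0 < \<delta>" "\<And>s. 0 < s \<Longrightarrow> s < \<delta> \<Longrightarrow> 0 < ml_fun \<rho> \<rho> (- \<kappa> * s powr \<rho>)"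
    by (auto simp: eventually_at_right_field)
  then show ?thesis
    using that[of \<delta>] assms by (auto simp: resolvent_def ml_kernel_eq_ml_fun)
qed

text \<open>At a first zero \<open>t\<^sub>0\<close> the Volterra equations at \<open>t\<^sub>0\<close> and at a slightly earlier \<open>t\<close> are compared:
  by log-convexity of the Abel kernel \<open>k\<close>, \<open>k (t\<^sub>0 - s) / k (t - s) \<le> k t\<^sub>0 / k t\<close>, so the history on
  \<open>(0, t)\<close> contributes at most \<open>k t\<^sub>0 - (k t\<^sub>0 / k t) e t\<close>, and the contribution of \<open>(t, t\<^sub>0)\<close> is too
  small to cancel the remaining \<open>(k t\<^sub>0 / k t) e t\<close>.\<close>

lemma resolvent_nonneg:
  assumes \<rho>: "0 < \<rho>" "\<rho> \<le> 1" and \<kappa>: "0 \<le> \<kappa>" and "0 < t"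
  shows "0 \<le> resolvent \<rho> \<kappa> t"
proof (rule ccontr)
  let ?e = "resolvent \<rho> \<kappa>" and ?k = "abel_kernel \<rho>"
  assume "\<not> 0 \<le> ?e t"
  then have neg: "?e t < 0" by simp
  have cont: "continuous_on {0<..} ?e"
    using continuous_on_ml_kernel[of \<rho> \<rho>] \<rho> by (simp add: resolvent_def)
  obtain \<delta> where \<delta>: "0 < \<delta>" "\<And>s. 0 < s \<Longrightarrow> s < \<delta> \<Longrightarrow> 0 < ?e s"
    using resolvent_pos_near_0[OF \<rho>(1)] by metis
  define K where "K = {s \<in> {\<delta>..t}. ?e s \<le> 0}"
  have "\<delta> \<le> t" using \<delta>(2)[of t] neg \<open>0 < t\<close> by force
  then have "t \<in> K" using neg by (simp add: K_def)
  moreover have "continuous_on {\<delta>..t} ?e"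
    using \<delta>(1) by (intro continuous_on_subset[OF cont]) auto
  then have "closed ({\<delta>..t} \<inter> ?e -` {..0})"
    by (intro continuous_closed_preimage) auto
  then have "compact ({\<delta>..t} \<inter> ({\<delta>..t} \<inter> ?e -` {..0}))"
    by (intro compact_Int_closed) auto
  then have "compact K" unfolding K_def by (rule back_subst) auto
  ultimately obtain t0 where t0: "t0 \<in> K" "\<And>s. s \<in> K \<Longrightarrow> t0 \<le> s"
    using compact_attains_inf[of K] by auto
  have t0': "\<delta> \<le> t0" "0 < t0" "?e t0 \<le> 0" "t0 \<le> t" using t0 \<delta>(1) by (auto simp: K_def)
  have pos: "0 < ?e s" if "0 < s" "s < t0" for s
  proof (rule ccontr)
    assume "\<not> 0 < ?e s"
    moreover from this have "\<delta> \<le> s" using \<delta>(2)[of s] that by force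
    ultimately have "s \<in> K" using that t0' by (auto simp: K_def)
    then show False using t0(2) that by force
  qed
  have "((\<lambda>s. \<kappa> * abel_kernel (\<rho> + 1) s) \<longlongrightarrow> \<kappa> * 0) (at_right 0)"
  proof (intro tendsto_intros)
    have "((\<lambda>s. s powr \<rho>) \<longlongrightarrow> 0) (at_right 0)"
      using tendsto_powr'[of "\<lambda>s::real. s" 0 "at_right 0" "\<lambda>_. \<rho>" \<rho>] \<rho>
      by (auto simp: eventually_at_filter)
    then show "(abel_kernel (\<rho> + 1) \<longlongrightarrow> 0) (at_right 0)"
      by (simp add: abel_kernel_def[abs_def] tendsto_divide_zero)
  qed
  then have "eventually (\<lambda>s. \<kappa> * abel_kernel (\<rho> + 1) s < 1 / 2) (at_right 0)"
    by (rule order_tendstoD) simp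
  then obtain h where h: "0 < h" "\<And>s. 0 < s \<Longrightarrow> s < h \<Longrightarrow> \<kappa> * abel_kernel (\<rho> + 1) s < 1 / 2"
    by (auto simp: eventually_at_right_field)
  \<comment> \<open>The first entry forces b / t0 to be at least 1/2, hence r at least 1/2; the
    second forces t0 - b < h, so that the kernel mass between b and t0, times \<kappa>, is below
    1/2.\<close>
  define t1 where "t1 = max (t0 / 2) (t0 - h / 2)"
  have t1: "t0 / 2 \<le> t1" "t1 < t0" "0 < t1" "t0 - t1 < h" using h(1) t0'(2) by (auto simp: t1_def max_def)
  have "continuous_on {t1..t0} ?e"
    using t1 by (intro continuous_on_subset[OF cont]) auto
  \<comment> \<open>The earlier time is taken at the maximum of the resolvent on [t1, t0], so that
    the resolvent on (b, t0) is bounded by its value at b.\<close>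
  then obtain b where b: "b \<in> {t1..t0}" "\<And>s. s \<in> {t1..t0} \<Longrightarrow> ?e s \<le> ?e b"
    using continuous_attains_sup[of "{t1..t0}" ?e] t1 by auto
  have eb: "0 < ?e b" using b(2)[of t1] pos[of t1] t1 by auto
  then have bt: "b < t0" "0 < b" using b(1) t0'(3) t1 by (cases "b = t0"; auto)+
  define r where "r = ?k t0 / ?k b"
  have kp: "0 < ?k b" "0 < ?k t0" using \<rho> bt t0' by (auto intro: abel_kernel_pos)
  have ratio: "?k (t0 - s) \<le> r * ?k (b - s)" if "0 \<le> s" "s < b" for s
  proof -
    have "t0 / b \<le> (t0 - s) / (b - s)"
      using that bt mult_left_mono[of b t0 s] by (simp add: field_simps)
    then have "((t0 - s) / (b - s)) powr (\<rho> - 1) \<le> (t0 / b) powr (\<rho> - 1)"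
      using \<rho> bt t0' by (intro powr_mono2') auto
    then show ?thesis
      using that bt Gamma_real_pos[of \<rho>] \<rho>
      by (simp add: r_def abel_kernel_def powr_divide field_simps)
  qed
  have "Gamma \<rho> \<noteq> 0" using Gamma_real_pos[OF \<rho>(1)] by simp
  have rhalf: "1 / 2 \<le> r"
  proof -
    have "(1/2) \<le> (b / t0) powr 1" using b(1) t1 bt t0' by (simp add: field_simps)
    also have "\<dots> \<le> (b / t0) powr (1 - \<rho>)"
      using \<rho> bt t0' by (intro powr_mono') auto
    also have "\<dots> = r"
      using bt t0' Gamma_real_pos[of \<rho>] \<rho>
      by (simp add: r_def abel_kernel_def powr_divide powr_diff field_simps \<open>Gamma \<rho> \<noteq> 0\<close>)
    finally show ?thesis .
  qed
  have int0: "set_integrable lborel {0<..<t0} (\<lambda>s. ?k (t0 - s) * ?e s)"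
    unfolding resolvent_def using \<rho> t0' by (intro ml_kernel_abel) auto
  have intb: "set_integrable lborel {0<..<b} (\<lambda>s. ?k (b - s) * ?e s)"
    unfolding resolvent_def using \<rho> bt by (intro ml_kernel_abel) auto
  have "(LINT s:{0<..<b}|lborel. ?k (t0 - s) * ?e s) \<le> (LINT s:{0<..<b}|lborel. r * (?k (b - s) * ?e s))"
  proof (rule set_integral_mono)
    show "set_integrable lborel {0<..<b} (\<lambda>s. ?k (t0 - s) * ?e s)"
      using bt by (intro set_integrable_subset[OF int0]) auto
    show "set_integrable lborel {0<..<b} (\<lambda>s. r * (?k (b - s) * ?e s))"
      using intb by simp
    fix s assume "s \<in> {0<..<b}"
    then show "?k (t0 - s) * ?e s \<le> r * (?k (b - s) * ?e s)"
      using mult_right_mono[OF ratio[of s], of "?e s"] pos[of s] bt by (simp add: mult.assoc)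
  qed
  then have "\<kappa> * (LINT s:{0<..<b}|lborel. ?k (t0 - s) * ?e s)
      \<le> r * (\<kappa> * (LINT s:{0<..<b}|lborel. ?k (b - s) * ?e s))"
    using \<kappa> by (simp add: mult_left_mono mult.left_commute)
  also have "\<dots> = r * (?k b - ?e b)"
    using resolvent_Volterra[OF \<rho>(1) bt(2), of \<kappa>] by simp
  also have "\<dots> = ?k t0 - r * ?e b"
    using kp by (simp add: r_def field_simps)
  finally have A: "\<kappa> * (LINT s:{0<..<b}|lborel. ?k (t0 - s) * ?e s) \<le> ?k t0 - r * ?e b" .
  have eqk: "?k (t0 - (b + s)) = ?k (t0 - b - s)" for s by (simp add: algebra_simps)
  have intk: "set_integrable lborel {b<..<t0} (\<lambda>s. ?k (t0 - s))"
    using abel_kernel_integral(1)[of \<rho> "t0 - b"] \<rho> bt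
    by (subst set_integral_shift(2)) (simp add: eqk)
  have "(LINT s:{b<..<t0}|lborel. ?k (t0 - s) * ?e s) \<le> (LINT s:{b<..<t0}|lborel. ?k (t0 - s) * ?e b)"
  proof (rule set_integral_mono)
    show "set_integrable lborel {b<..<t0} (\<lambda>s. ?k (t0 - s) * ?e s)"
      using bt by (intro set_integrable_subset[OF int0]) auto
    show "set_integrable lborel {b<..<t0} (\<lambda>s. ?k (t0 - s) * ?e b)"
      using intk by simp
    fix s assume "s \<in> {b<..<t0}"
    then show "?k (t0 - s) * ?e s \<le> ?k (t0 - s) * ?e b"
      using b \<rho> by (intro mult_left_mono abel_kernel_nonneg) auto
  qed
  also have "\<dots> = abel_kernel (\<rho> + 1) (t0 - b) * ?e b"
    using abel_kernel_integral(2)[of \<rho> "t0 - b"] \<rho> bt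
    by (subst set_integral_shift(1)) (simp add: eqk)
  finally have "\<kappa> * (LINT s:{b<..<t0}|lborel. ?k (t0 - s) * ?e s) \<le> \<kappa> * (abel_kernel (\<rho> + 1) (t0 - b) * ?e b)"
    using \<kappa> by (rule mult_left_mono)
  also have "\<dots> = \<kappa> * abel_kernel (\<rho> + 1) (t0 - b) * ?e b" by (simp add: mult.assoc)
  also have "\<dots> < 1 / 2 * ?e b"
    using h(2)[of "t0 - b"] bt t1 b(1) eb by (intro mult_strict_right_mono) auto
  also have "\<dots> \<le> r * ?e b"
    using rhalf eb by (intro mult_right_mono) auto
  finally have B: "\<kappa> * (LINT s:{b<..<t0}|lborel. ?k (t0 - s) * ?e s) < r * ?e b" .
  have "\<kappa> * (LINT s:{0<..<t0}|lborel. ?k (t0 - s) * ?e s) < ?k t0"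
    using A B bt by (simp add: set_integral_split[OF int0] distrib_left)
  then have "0 < ?e t0"
    using resolvent_Volterra[OF \<rho>(1) t0'(2), of \<kappa>] by simp
  with t0'(3) show False by simp
qed

lemma resolvent_le_abel_kernel:
  assumes "0 < \<rho>" "\<rho> \<le> 1" "0 \<le> \<kappa>" "0 < t"
  shows "resolvent \<rho> \<kappa> t \<le> abel_kernel \<rho> t"
proof -
  have "0 \<le> (LINT s:{0<..<t}|lborel. abel_kernel \<rho> (t - s) * resolvent \<rho> \<kappa> s)"
    using assms by (intro set_integral_nonneg mult_nonneg_nonneg abel_kernel_nonneg resolvent_nonneg) auto
  then show ?thesis
    using resolvent_Volterra[of \<rho> t \<kappa>] assms by simp
qed

lemma abel_kernel_1_cong:
  fixes f :: "real \<Rightarrow> real"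
  shows "set_integrable lborel {0<..<t} (\<lambda>s. abel_kernel 1 (t - s) * f s) \<longleftrightarrow> set_integrable lborel {0<..<t} f"
    and "(LINT s:{0<..<t}|lborel. abel_kernel 1 (t - s) * f s) = (LINT s:{0<..<t}|lborel. f s)"
  by (intro set_integrable_cong set_lebesgue_integral_cong; simp add: abel_kernel_1)+

lemma resolvent_integral:
  assumes "0 < \<rho>" "0 < t"
  shows "set_integrable lborel {0<..<t} (resolvent \<rho> \<kappa>)"
    and "relaxation \<rho> \<kappa> t = 1 - \<kappa> * (LINT s:{0<..<t}|lborel. resolvent \<rho> \<kappa> s)"
  using ml_kernel_abel[of \<rho> \<rho> 1 t "-\<kappa>"] ml_kernel_shift[of \<rho> 1 t "- \<kappa>"] assms
  by (simp_all add: resolvent_def relaxation_def abel_kernel_1_cong abel_kernel_1 add.commute)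

lemma resolvent_integral_nonneg:
  assumes "0 < \<rho>" "\<rho> \<le> 1" "0 \<le> \<kappa>"
  shows "0 \<le> (LINT s:{0<..<t}|lborel. resolvent \<rho> \<kappa> s)"
  using assms by (intro set_integral_nonneg resolvent_nonneg) auto

lemma resolvent_abel:
  assumes "0 < \<rho>" "\<rho> < 1" "0 < t"
  shows "set_integrable lborel {0<..<t} (\<lambda>s. abel_kernel (1 - \<rho>) (t - s) * resolvent \<rho> \<kappa> s)"
    and "(LINT s:{0<..<t}|lborel. abel_kernel (1 - \<rho>) (t - s) * resolvent \<rho> \<kappa> s) = relaxation \<rho> \<kappa> t"
  using ml_kernel_abel[of \<rho> \<rho> "1 - \<rho>" t "-\<kappa>"] assms by (simp_all add: resolvent_def relaxation_def)

lemma resolvent_1_eq_relaxation: "resolvent 1 = relaxation 1"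
  by (simp add: resolvent_def relaxation_def fun_eq_iff)

text \<open>For \<rho> < 1 it is an Abel integral of the nonnegative resolvent. At \<rho> = 1 that
  kernel would have order 0, but there both functions are the same exponential.\<close>

lemma relaxation_nonneg:
  assumes "0 < \<rho>" "\<rho> \<le> 1" "0 \<le> \<kappa>" "0 < t"
  shows "0 \<le> relaxation \<rho> \<kappa> t"
proof (cases "\<rho> = 1")
  case True
  then show ?thesis using resolvent_nonneg[of \<rho> \<kappa> t] assms by (simp add: resolvent_1_eq_relaxation)
next
  case False
  then have "0 \<le> (LINT s:{0<..<t}|lborel. abel_kernel (1 - \<rho>) (t - s) * resolvent \<rho> \<kappa> s)"
    using assms by (intro set_integral_nonneg mult_nonneg_nonneg abel_kernel_nonneg resolvent_nonneg) auto
  then show ?thesis using resolvent_abel(2)[of \<rho> t \<kappa>] False assms by simp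
qed

lemma relaxation_le_1:
  assumes "0 < \<rho>" "\<rho> \<le> 1" "0 \<le> \<kappa>" "0 < t"
  shows "relaxation \<rho> \<kappa> t \<le> 1"
  using resolvent_integral(2)[of \<rho> t \<kappa>] resolvent_integral_nonneg[of \<rho> \<kappa> t] assms by simp

text \<open>Nonnegativity of y, read as a mass bound: \<kappa> e is a subprobability density on (0,
  t).\<close>

lemma resolvent_integral_bound:
  assumes "0 < \<rho>" "\<rho> \<le> 1" "0 \<le> \<kappa>" "0 < t"
  shows "\<kappa> * (LINT s:{0<..<t}|lborel. resolvent \<rho> \<kappa> s) \<le> 1"
  using resolvent_integral(2)[of \<rho> t \<kappa>] relaxation_nonneg[OF assms] assms by simp

text \<open>In terms of Laplace transforms this is
  \<open>- d/dp 1/(p\<^sup>\<rho> + \<kappa>) = \<rho> (p\<^bsup>\<rho>-1\<^esup>/(p\<^sup>\<rho> + \<kappa>)) (1/(p\<^sup>\<rho> + \<kappa>))\<close>.\<close>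

lemma resolvent_convolution_identity:
  assumes "0 < \<rho>" "0 < t"
  shows "set_integrable lborel {0<..<t} (\<lambda>s. relaxation \<rho> \<kappa> (t - s) * resolvent \<rho> \<kappa> s)"
    and "t * resolvent \<rho> \<kappa> t = \<rho> * (LINT s:{0<..<t}|lborel. relaxation \<rho> \<kappa> (t - s) * resolvent \<rho> \<kappa> s)"
proof -
  define z where "z = - \<kappa>"
  define a where "a = (\<lambda>k. abel_kernel (\<rho> * real k + 1))"
  define b where "b = (\<lambda>k. abel_kernel (\<rho> * real k + \<rho>))"
  define f where "f = (\<lambda>n s. z ^ n * (\<Sum>i\<le>n. a i (t - s) * b (n - i) s))"
  have p: "0 < \<rho> * real k + 1" "0 < \<rho> * real k + \<rho>" for k
    using assms by (auto simp: add_nonneg_pos)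
  have nn: "0 \<le> a k s" "0 \<le> b k s" for k s
    using p by (auto simp: a_def b_def abel_kernel_nonneg)
  have sum_eq: "w ^ n * (\<Sum>i\<le>n. a i (t - s) * b (n - i) s)
      = (\<Sum>i\<le>n. (w ^ i * a i (t - s)) * (w ^ (n - i) * b (n - i) s))" for n s and w :: real
    unfolding sum_distrib_left
    by (intro sum.cong refl) (simp add: power_add[symmetric] mult_ac flip: power_add)
  have cauchy: "(\<lambda>n. w ^ n * (\<Sum>i\<le>n. a i (t - s) * b (n - i) s)) sums
      (ml_kernel \<rho> 1 w (t - s) * ml_kernel \<rho> \<rho> w s)" if s: "s \<in> {0<..<t}" for s w
  proof -
    have "summable (\<lambda>k. norm (w ^ k * a k (t - s)))" "summable (\<lambda>k. norm (w ^ k * b k s))"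
      using ml_kernel_summable[of \<rho> 1 "t - s" w] ml_kernel_summable[of \<rho> \<rho> s w] assms s
      unfolding a_def b_def real_norm_def by auto
    from Cauchy_product_sums[OF this] show ?thesis
      unfolding sum_eq by (simp add: ml_kernel_def a_def b_def)
  qed
  have int1: "set_integrable lborel {0<..<t} (\<lambda>s. a i (t - s) * b j s)"
    and I1: "(LINT s:{0<..<t}|lborel. a i (t - s) * b j s) = abel_kernel (\<rho> * real (i + j + 1) + 1) t" for i j
    using abel_kernel_Beta[OF p(1)[of i] p(2)[of j] assms(2)]
    by (simp_all add: a_def b_def algebra_simps)
  have ints: "set_integrable lborel {0<..<t} (\<lambda>s. \<Sum>i\<le>n. a i (t - s) * b (n - i) s)" for n
    using int1 unfolding set_integrable_def scaleR_sum_right by (intro Bochner_Integration.integrable_sum)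
  have I: "(LINT s:{0<..<t}|lborel. w * (\<Sum>i\<le>n. a i (t - s) * b (n - i) s))
      = t / \<rho> * (w ^ 0 * w * b n t)" for n w
  proof -
    have "(LINT s:{0<..<t}|lborel. (\<Sum>i\<le>n. a i (t - s) * b (n - i) s))
       = (\<Sum>i\<le>n. LINT s:{0<..<t}|lborel. a i (t - s) * b (n - i) s)"
      using int1 unfolding set_integrable_def set_lebesgue_integral_def scaleR_sum_right
      by (intro Bochner_Integration.integral_sum) auto
    \<comment> \<open>All n + 1 products in the n-th Cauchy coefficient have the same convolution,
      of order \<rho> (n + 1) + 1. Their number cancels against the recursion of Gamma, leaving t /
      \<rho> times one kernel.\<close>
    also have "\<dots> = real (n + 1) * abel_kernel (\<rho> * real (n + 1) + 1) t"
      by (simp add: I1)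
    also have "\<dots> = t / \<rho> * b n t"
      using assms abel_kernel_plus_1[of "\<rho> * real (n + 1)" t]
      by (simp add: b_def algebra_simps del: of_nat_Suc) (simp add: field_simps)
    finally show ?thesis by simp
  qed
  have 1: "set_integrable lborel {0<..<t} (f n)" for n
    unfolding f_def using ints by simp
  have 2: "summable (\<lambda>n. norm (f n s))" if "s \<in> {0<..<t}" for s
  proof -
    have "norm (f n s) = \<bar>z\<bar> ^ n * (\<Sum>i\<le>n. a i (t - s) * b (n - i) s)" for n
      by (simp add: f_def abs_mult power_abs sum_nonneg nn)
    then show ?thesis using sums_summable[OF cauchy[OF that, of "\<bar>z\<bar>"]] by simp
  qed
  have "(LINT s:{0<..<t}|lborel. norm (f n s)) = t / \<rho> * (\<bar>z\<bar> ^ n * b n t)" for n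
  proof -
    have "norm (f n s) = \<bar>z\<bar> ^ n * (\<Sum>i\<le>n. a i (t - s) * b (n - i) s)" for s
      by (simp add: f_def abs_mult power_abs sum_nonneg nn)
    then show ?thesis by (simp only: I) simp
  qed
  moreover have "summable (\<lambda>n. t / \<rho> * (\<bar>z\<bar> ^ n * b n t))"
    unfolding b_def using assms by (intro summable_mult sums_summable[OF ml_kernel_sums]) auto
  ultimately have 3: "summable (\<lambda>n. LINT s:{0<..<t}|lborel. norm (f n s))"
    by (simp only:)
  have eq: "(\<Sum>n. f n s) = relaxation \<rho> \<kappa> (t - s) * resolvent \<rho> \<kappa> s" if "s \<in> {0<..<t}" for s
    using cauchy[OF that, of z] by (simp add: f_def sums_iff relaxation_def resolvent_def z_def)
  note * = set_integral_series[of lborel "{0<..<t}" f, OF 1 2 3]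
  have "set_integrable lborel {0<..<t} (\<lambda>s. \<Sum>n. f n s) \<longleftrightarrow>
      set_integrable lborel {0<..<t} (\<lambda>s. relaxation \<rho> \<kappa> (t - s) * resolvent \<rho> \<kappa> s)"
    by (intro set_integrable_cong refl eq)
  then show "set_integrable lborel {0<..<t} (\<lambda>s. relaxation \<rho> \<kappa> (t - s) * resolvent \<rho> \<kappa> s)"
    using *(1) by simp
  have If: "(LINT s:{0<..<t}|lborel. f n s) = t / \<rho> * (z ^ n * b n t)" for n
    unfolding f_def I by simp
  have "(LINT s:{0<..<t}|lborel. (\<Sum>n. f n s)) =
      (LINT s:{0<..<t}|lborel. relaxation \<rho> \<kappa> (t - s) * resolvent \<rho> \<kappa> s)"
    by (intro set_lebesgue_integral_cong) (auto simp: eq)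
  then have "(\<lambda>n. t / \<rho> * (z ^ n * b n t)) sums
     (LINT s:{0<..<t}|lborel. relaxation \<rho> \<kappa> (t - s) * resolvent \<rho> \<kappa> s)"
    using *(2) by (simp only: If)
  moreover have "(\<lambda>n. t / \<rho> * (z ^ n * b n t)) sums (t / \<rho> * resolvent \<rho> \<kappa> t)"
    unfolding b_def resolvent_def z_def using assms by (intro sums_mult ml_kernel_sums) auto
  ultimately have "(LINT s:{0<..<t}|lborel. relaxation \<rho> \<kappa> (t - s) * resolvent \<rho> \<kappa> s) = t / \<rho> * resolvent \<rho> \<kappa> t"
    by (rule sums_unique2)
  then show "t * resolvent \<rho> \<kappa> t = \<rho> * (LINT s:{0<..<t}|lborel. relaxation \<rho> \<kappa> (t - s) * resolvent \<rho> \<kappa> s)"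
    using assms by simp
qed

text \<open>As y is at most 1, the identity bounds t e(t) by \<rho> times the mass of e on (0, t),
  and \<kappa> times that mass is at most 1.\<close>

lemma resolvent_decay:
  assumes "0 < \<rho>" "\<rho> \<le> 1" "0 \<le> \<kappa>" "0 < t"
  shows "\<kappa> * resolvent \<rho> \<kappa> t \<le> \<rho> / t"
proof -
  have "(LINT s:{0<..<t}|lborel. relaxation \<rho> \<kappa> (t - s) * resolvent \<rho> \<kappa> s)
      \<le> (LINT s:{0<..<t}|lborel. resolvent \<rho> \<kappa> s)"
  proof (rule set_integral_mono)
    fix s assume "s \<in> {0<..<t}"
    then show "relaxation \<rho> \<kappa> (t - s) * resolvent \<rho> \<kappa> s \<le> resolvent \<rho> \<kappa> s"
      using assms by (intro mult_left_le_one_le relaxation_le_1 relaxation_nonneg resolvent_nonneg) auto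
  qed (use assms resolvent_convolution_identity resolvent_integral in auto)
  then have "\<kappa> * (t * resolvent \<rho> \<kappa> t) \<le> \<kappa> * (\<rho> * (LINT s:{0<..<t}|lborel. resolvent \<rho> \<kappa> s))"
    using assms by (subst resolvent_convolution_identity) (auto intro!: mult_left_mono)
  also have "\<dots> \<le> \<rho>"
    using resolvent_integral_bound[OF assms] assms mult_left_le[of "\<kappa> * (LINT s:{0<..<t}|lborel. resolvent \<rho> \<kappa> s)" \<rho>]
    by (simp add: mult.left_commute)
  finally show ?thesis using assms by (simp add: field_simps)
qed

text \<open>Interpolation between \<open>(1 + \<kappa>) e(t) = O(1/t)\<close> and \<open>e(t) = O(t\<^bsup>\<rho>-1\<^esup>)\<close>.\<close>

lemma resolvent_interpolation:
  assumes "0 < \<rho>" "\<rho> \<le> 1" "0 < \<epsilon>" "\<epsilon> < 1" "0 < T"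
  obtains C where "0 < C"
    "\<And>\<kappa> t :: real. 0 \<le> \<kappa> \<Longrightarrow> t \<in> {0<..T} \<Longrightarrow> (1 + \<kappa>) * resolvent \<rho> \<kappa> t \<le> C / t"
    "\<And>\<kappa> t :: real. 0 \<le> \<kappa> \<Longrightarrow> t \<in> {0<..T} \<Longrightarrow>
      (1 + \<kappa>) * resolvent \<rho> \<kappa> t \<le> C * (1 + \<kappa>) powr \<epsilon> * t powr (\<epsilon> * \<rho> - 1)"
proof -
  define G where "G = 1 / Gamma \<rho>"
  have G: "0 < G" using assms by (simp add: G_def)
  \<comment> \<open>In 1 + \<kappa> the summand 1 is paid for by the Abel kernel bound, with
    t^\<rho> \<le> T^\<rho>, and the summand \<kappa> by the decay bound.\<close>
  define A where "A = G * T powr \<rho> + \<rho>"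
  have A: "0 < A" using G assms by (simp add: A_def add_nonneg_pos)
  have 1: "(1 + \<kappa>) * resolvent \<rho> \<kappa> t \<le> A / t" if "0 \<le> \<kappa>" "t \<in> {0<..T}" for \<kappa> t :: real
  proof -
    have "resolvent \<rho> \<kappa> t \<le> G * t powr (\<rho> - 1)"
      using resolvent_le_abel_kernel[of \<rho> \<kappa> t] that assms by (simp add: abel_kernel_def G_def)
    also have "\<dots> = G * t powr \<rho> / t"
      using that by (simp add: powr_diff)
    also have "\<dots> \<le> G * T powr \<rho> / t"
      using that assms G by (intro divide_right_mono mult_left_mono powr_mono2) auto
    finally show ?thesis
      using resolvent_decay[of \<rho> \<kappa> t] that assms by (simp add: A_def add_divide_distrib algebra_simps)
  qed
  have 2: "(1 + \<kappa>) * resolvent \<rho> \<kappa> t \<le> A powr (1 - \<epsilon>) * G powr \<epsilon> * (1 + \<kappa>) powr \<epsilon> * t powr (\<epsilon> * \<rho> - 1)"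
    if k: "0 \<le> \<kappa>" and t: "t \<in> {0<..T}" for \<kappa> t :: real
  proof -
    define X where "X = (1 + \<kappa>) * resolvent \<rho> \<kappa> t"
    have X: "0 \<le> X" using resolvent_nonneg[of \<rho> \<kappa> t] k t assms by (simp add: X_def)
    have "resolvent \<rho> \<kappa> t \<le> G * t powr (\<rho> - 1)"
      using resolvent_le_abel_kernel[of \<rho> \<kappa> t] k t assms by (simp add: abel_kernel_def G_def)
    then have "X \<le> (1 + \<kappa>) * (G * t powr (\<rho> - 1))"
      unfolding X_def using k by (intro mult_left_mono) auto
    then have B: "X powr \<epsilon> \<le> ((1 + \<kappa>) * (G * t powr (\<rho> - 1))) powr \<epsilon>"
      using X assms by (intro powr_mono2) auto
    have A': "X powr (1 - \<epsilon>) \<le> (A / t) powr (1 - \<epsilon>)"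
      using 1[OF k t] X assms by (intro powr_mono2) (auto simp: X_def)
    \<comment> \<open>The geometric mean of the two bounds: the powers of t add up to -(1 -
      \<epsilon>) + (\<rho> - 1) \<epsilon> = \<epsilon> \<rho> - 1, which exceeds -1 and is
      therefore integrable at 0.\<close>
    have "X = X powr (1 - \<epsilon>) * X powr \<epsilon>"
      using X by (simp add: powr_add[symmetric])
    also have "\<dots> \<le> (A / t) powr (1 - \<epsilon>) * ((1 + \<kappa>) * (G * t powr (\<rho> - 1))) powr \<epsilon>"
      using A' B by (intro mult_mono) auto
    also have "\<dots> = A powr (1 - \<epsilon>) * G powr \<epsilon> * (1 + \<kappa>) powr \<epsilon> * (t powr (- (1 - \<epsilon>)) * t powr ((\<rho> - 1) * \<epsilon>))"
    proof -
      have "(A / t) powr (1 - \<epsilon>) = A powr (1 - \<epsilon>) * t powr (- (1 - \<epsilon>))"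
        using A t by (subst powr_minus) (simp add: powr_divide divide_simps)
      moreover have "((1 + \<kappa>) * (G * t powr (\<rho> - 1))) powr \<epsilon> = (1 + \<kappa>) powr \<epsilon> * (G powr \<epsilon> * t powr ((\<rho> - 1) * \<epsilon>))"
        using G k t by (simp add: powr_mult powr_powr del: distrib_right distrib_left)
      ultimately show ?thesis by (simp only: mult_ac)
    qed
    also have "t powr (- (1 - \<epsilon>)) * t powr ((\<rho> - 1) * \<epsilon>) = t powr (\<epsilon> * \<rho> - 1)"
      by (simp add: powr_add[symmetric] algebra_simps)
    finally show ?thesis by (simp add: X_def)
  qed
  define C where "C = max A (A powr (1 - \<epsilon>) * G powr \<epsilon>)"
  show ?thesis
  proof
    show "0 < C" using A by (simp add: C_def)
    fix \<kappa> t :: real assume k: "0 \<le> \<kappa>" and t: "t \<in> {0<..T}"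
    have "A / t \<le> C / t" using t by (intro divide_right_mono) (auto simp: C_def)
    then show "(1 + \<kappa>) * resolvent \<rho> \<kappa> t \<le> C / t" using 1[OF k t] by simp
    have "A powr (1 - \<epsilon>) * G powr \<epsilon> * (1 + \<kappa>) powr \<epsilon> * t powr (\<epsilon> * \<rho> - 1)
        \<le> C * (1 + \<kappa>) powr \<epsilon> * t powr (\<epsilon> * \<rho> - 1)"
      by (intro mult_right_mono) (auto simp: C_def)
    then show "(1 + \<kappa>) * resolvent \<rho> \<kappa> t \<le> C * (1 + \<kappa>) powr \<epsilon> * t powr (\<epsilon> * \<rho> - 1)"
      using 2[OF k t] by simp
  qed
qed

section \<open>Convolution on the half-line\<close>

definition conv :: "(real \<Rightarrow> real) \<Rightarrow> (real \<Rightarrow> 'a::{banach, second_countable_topology}) \<Rightarrow> real \<Rightarrow> 'a" where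
  "conv k g t = (LINT s:{0<..<t}|lborel. k (t - s) *\<^sub>R g s)"

lemma ml_kernel_measurable [measurable]: "ml_kernel \<rho> \<beta> z \<in> borel_measurable borel"
  unfolding ml_kernel_def by measurable

lemma conv_flip: "conv k g t = (LINT s:{0<..<t}|lborel. k s *\<^sub>R g (t - s))"
  using set_integral_flip(1)[of t "\<lambda>s. k s *\<^sub>R g (t - s)"] by (simp add: conv_def)

lemma conv_cong:
  assumes "\<And>s. 0 < s \<Longrightarrow> s < t \<Longrightarrow> k s = k' s" "\<And>s. 0 < s \<Longrightarrow> s < t \<Longrightarrow> g s = g' s"
  shows "conv k g t = conv k' g' t"
  unfolding conv_def by (intro set_lebesgue_integral_cong) (auto simp: assms)

lemma set_integrable_bounded_scaleR:
  fixes f :: "real \<Rightarrow> 'a::{banach, second_countable_topology}" and k :: "real \<Rightarrow> real"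
  assumes k: "set_integrable lborel A k"
    and f: "f \<in> borel_measurable borel" "\<And>s. norm (f s) \<le> B"
  shows "set_integrable lborel A (\<lambda>s. k s *\<^sub>R f s)"
proof -
  have "integrable lborel (\<lambda>s. (indicat_real A s *\<^sub>R k s) *\<^sub>R f s)"
  proof (rule Bochner_Integration.integrable_bound)
    show "integrable lborel (\<lambda>s. B * (indicat_real A s *\<^sub>R k s))"
      using k by (simp add: set_integrable_def)
    show "(\<lambda>s. (indicat_real A s *\<^sub>R k s) *\<^sub>R f s) \<in> borel_measurable lborel"
      by (rule borel_measurable_scaleR[OF borel_measurable_integrable[OF k[unfolded set_integrable_def]]])
        (use f(1) in simp)
    have "norm ((indicat_real A s *\<^sub>R k s) *\<^sub>R f s) \<le> norm (B * (indicat_real A s *\<^sub>R k s))" for s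
    proof -
      have "\<bar>indicat_real A s *\<^sub>R k s\<bar> * norm (f s) \<le> \<bar>indicat_real A s *\<^sub>R k s\<bar> * \<bar>B\<bar>"
        using f(2)[of s] by (intro mult_left_mono) auto
      then show ?thesis by (simp add: abs_mult mult_ac)
    qed
    then show "AE s in lborel. norm ((indicat_real A s *\<^sub>R k s) *\<^sub>R f s) \<le> norm (B * (indicat_real A s *\<^sub>R k s))"
      by simp
  qed
  then show ?thesis by (simp add: set_integrable_def)
qed

text \<open>After flipping, the possibly singular kernel stays fixed and only the continuous factor
  moves, so dominated convergence applies with majorant |k| B. The moving upper end matters only at
  s = t, a null set. Shifts of f may leave [0, T], hence continuity on the whole line.\<close>

lemma continuous_on_conv:
  fixes f :: "real \<Rightarrow> 'a::{banach, second_countable_topology}"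
  assumes k: "set_integrable lborel {0<..<T} k"
    and f: "continuous_on UNIV f" "\<And>s. norm (f s) \<le> B"
  shows "continuous_on {0..T} (conv k f)"
  unfolding continuous_on_sequentially
proof (intro allI ballI impI)
  fix x :: "nat \<Rightarrow> real" and t
  assume t: "t \<in> {0..T}" and x: "(\<forall>n. x n \<in> {0..T}) \<and> x \<longlonglongrightarrow> t"
  have [measurable]: "f \<in> borel_measurable borel"
    using f(1) by (rule borel_measurable_continuous_onI)
  define K where "K = (\<lambda>s. indicat_real {0<..<T} s *\<^sub>R k s)"
  have K: "integrable lborel K" using k by (simp add: K_def set_integrable_def)
  then have [measurable]: "K \<in> borel_measurable borel" by auto
  have eq: "conv k f r = (LINT s|lborel. K s *\<^sub>R (indicat_real {..<r} s *\<^sub>R f (r - s)))" if "r \<in> {0..T}" for r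
    unfolding conv_flip set_lebesgue_integral_def
    by (rule Bochner_Integration.integral_cong) (use that in \<open>auto simp: K_def indicator_def\<close>)
  have "(\<lambda>n. LINT s|lborel. K s *\<^sub>R (indicat_real {..<x n} s *\<^sub>R f (x n - s)))
      \<longlonglongrightarrow> (LINT s|lborel. K s *\<^sub>R (indicat_real {..<t} s *\<^sub>R f (t - s)))"
  proof (rule integral_dominated_convergence)
    show "(\<lambda>s. K s *\<^sub>R (indicat_real {..<t} s *\<^sub>R f (t - s))) \<in> borel_measurable lborel"
      by measurable
    show "(\<lambda>s. K s *\<^sub>R (indicat_real {..<x n} s *\<^sub>R f (x n - s))) \<in> borel_measurable lborel" for n
      by measurable
    show "integrable lborel (\<lambda>s. \<bar>K s\<bar> * B)" using K by simp
    show "AE s in lborel. norm (K s *\<^sub>R (indicat_real {..<x n} s *\<^sub>R f (x n - s))) \<le> \<bar>K s\<bar> * B" for n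
    proof (rule AE_I2)
      fix s
      have "0 \<le> B" using f(2)[of 0] norm_ge_zero order_trans by blast
      then show "norm (K s *\<^sub>R (indicat_real {..<x n} s *\<^sub>R f (x n - s))) \<le> \<bar>K s\<bar> * B"
        using f(2)[of "x n - s"] by (auto simp: indicator_def intro!: mult_left_mono)
    qed
    have "AE s in lborel. s \<noteq> t" by (rule AE_lborel_singleton)
    then show "AE s in lborel. (\<lambda>n. K s *\<^sub>R (indicat_real {..<x n} s *\<^sub>R f (x n - s)))
        \<longlonglongrightarrow> K s *\<^sub>R (indicat_real {..<t} s *\<^sub>R f (t - s))"
    proof eventually_elim
      fix s :: real assume "s \<noteq> t"
      then have "eventually (\<lambda>n. indicat_real {..<x n} s = indicat_real {..<t} s) sequentially"
      proof (cases "s < t")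
        case True
        then have "eventually (\<lambda>n. s < x n) sequentially" using x order_tendstoD(1) by blast
        then show ?thesis by eventually_elim (use True in auto)
      next
        case False
        then have "t < s" using \<open>s \<noteq> t\<close> by simp
        then have "eventually (\<lambda>n. x n < s) sequentially" using x order_tendstoD(2) by blast
        then show ?thesis by eventually_elim (use False in auto)
      qed
      then have 1: "(\<lambda>n. indicat_real {..<x n} s) \<longlonglongrightarrow> indicat_real {..<t} s"
        by (rule tendsto_eventually)
      have "isCont f (t - s)" using f(1) by (simp add: continuous_on_eq_continuous_at)
      then have "(\<lambda>n. f (x n - s)) \<longlonglongrightarrow> f (t - s)"
        using x by (intro isCont_tendsto_compose[of _ f] tendsto_intros) auto
      with 1 show "(\<lambda>n. K s *\<^sub>R (indicat_real {..<x n} s *\<^sub>R f (x n - s)))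
        \<longlonglongrightarrow> K s *\<^sub>R (indicat_real {..<t} s *\<^sub>R f (t - s))"
        by (intro tendsto_intros)
    qed
  qed
  then show "(conv k f \<circ> x) \<longlonglongrightarrow> conv k f t"
    using x t by (simp add: comp_def eq)
qed

text \<open>Fubini on the triangle 0 < r < s < t. Integrability is checked by integrating the norm
  over s first: as the kernels are nonnegative, this gives exactly \<open>conv k e (t - r)\<close>
  times the norm of f, an integrable function times a bounded one.\<close>

lemma conv_assoc:
  fixes f :: "real \<Rightarrow> 'a::{banach, second_countable_topology}"
  assumes [measurable]: "k \<in> borel_measurable borel" "e \<in> borel_measurable borel" "f \<in> borel_measurable borel"
    and nonneg: "\<And>s. 0 < s \<Longrightarrow> 0 \<le> k s" "\<And>s. 0 < s \<Longrightarrow> 0 \<le> e s"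
    and int: "\<And>r. r \<in> {0<..<t} \<Longrightarrow> set_integrable lborel {0<..<r} (\<lambda>s. k (r - s) * e s)"
    and intc: "set_integrable lborel {0<..<t} (conv k e)"
    and f: "\<And>s. norm (f s) \<le> B"
  shows "set_integrable lborel {0<..<t} (\<lambda>s. k (t - s) *\<^sub>R conv e f s)"
    and "conv k (conv e f) t = conv (conv k e) f t"
proof -
  define G where "G = (\<lambda>(r, s). (if 0 < r \<and> r < s \<and> s < t then k (t - s) * e (s - r) else 0) *\<^sub>R f r)"
  have G [measurable]: "G \<in> borel_measurable (lborel \<Otimes>\<^sub>M lborel)"
    unfolding G_def by measurable
  define J where "J = (\<lambda>r s. indicat_real {r<..<t} s *\<^sub>R (k (t - s) * e (s - r)))"
  have GJ: "G (r, s) = (indicat_real {0<..<t} r * J r s) *\<^sub>R f r" for r s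
    by (auto simp: G_def J_def indicator_def)
  have Jint: "integrable lborel (J r)" and JI: "(LINT s|lborel. J r s) = conv k e (t - r)"
    if "r \<in> {0<..<t}" for r
  proof -
    have eq: "k (t - (r + s)) * e (r + s - r) = k (t - r - s) * e s" for s
      by (simp add: algebra_simps)
    have "set_integrable lborel {r<..<t} (\<lambda>s. k (t - s) * e (s - r))"
      using int[of "t - r"] that unfolding set_integral_shift(2)[of r t] eq by simp
    then show "integrable lborel (J r)" by (simp add: J_def set_integrable_def)
    show "(LINT s|lborel. J r s) = conv k e (t - r)"
      using set_integral_shift(1)[of r t "\<lambda>s. k (t - s) * e (s - r)"]
      unfolding eq by (simp add: J_def conv_def set_lebesgue_integral_def)
  qed
  have Jnn: "0 \<le> J r s" for r s by (auto simp: J_def indicator_def nonneg)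
  have normG: "(LINT s|lborel. norm (G (r, s))) = indicat_real {0<..<t} r *\<^sub>R (conv k e (t - r) *\<^sub>R norm (f r))" for r
  proof (cases "r \<in> {0<..<t}")
    case True
    then show ?thesis using Jnn by (simp add: GJ abs_mult JI)
  qed (simp add: GJ)
  have flip: "set_integrable lborel {0<..<t} (\<lambda>r. conv k e (t - r))"
    using intc by (simp add: set_integral_flip(2))
  have int2: "integrable (lborel \<Otimes>\<^sub>M lborel) G"
  proof (rule lborel_pair.Fubini_integrable)
    have "set_integrable lborel {0<..<t} (\<lambda>r. conv k e (t - r) *\<^sub>R norm (f r))"
      using f by (intro set_integrable_bounded_scaleR[OF flip, of _ B]) auto
    then show "integrable lborel (\<lambda>r. LINT s|lborel. norm (G (r, s)))"
      by (simp add: normG set_integrable_def)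
    show "AE r in lborel. integrable lborel (\<lambda>s. G (r, s))"
    proof (rule AE_I2)
      fix r show "integrable lborel (\<lambda>s. G (r, s))"
        using Jint[of r] by (cases "r \<in> {0<..<t}") (auto simp: GJ)
    qed
  qed (rule G)
  then have int2': "integrable (lborel \<Otimes>\<^sub>M lborel) (case_prod (\<lambda>r s. G (r, s)))" by simp
  have inner_s: "(LINT s|lborel. G (r, s)) = indicat_real {0<..<t} r *\<^sub>R (conv k e (t - r) *\<^sub>R f r)" for r
    using Jint[of r] by (cases "r \<in> {0<..<t}") (auto simp: GJ JI)
  have inner_r: "(LINT r|lborel. G (r, s)) = indicat_real {0<..<t} s *\<^sub>R (k (t - s) *\<^sub>R conv e f s)" for s
  proof -
    have "G (r, s) = (indicat_real {0<..<t} s * k (t - s)) *\<^sub>R (indicat_real {0<..<s} r *\<^sub>R (e (s - r) *\<^sub>R f r))" for r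
      by (auto simp: G_def indicator_def)
    then have "(LINT r|lborel. G (r, s)) = (indicat_real {0<..<t} s * k (t - s)) *\<^sub>R conv e f s"
      by (simp add: conv_def set_lebesgue_integral_def del: scaleR_scaleR)
    then show ?thesis by simp
  qed
  show "set_integrable lborel {0<..<t} (\<lambda>s. k (t - s) *\<^sub>R conv e f s)"
    using lborel_pair.integrable_snd[OF int2'] by (simp add: inner_r set_integrable_def)
  have "conv k (conv e f) t = (LINT s|lborel. LINT r|lborel. G (r, s))"
    by (simp add: inner_r conv_def[of k] set_lebesgue_integral_def)
  also have "\<dots> = (LINT r|lborel. LINT s|lborel. G (r, s))"
    by (rule lborel_pair.Fubini_integral[OF int2'])
  also have "\<dots> = conv (conv k e) f t"
    by (simp add: inner_s conv_def[of "conv k e"] set_lebesgue_integral_def)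
  finally show "conv k (conv e f) t = conv (conv k e) f t" .
qed

section \<open>Uniformly convergent series\<close>

text \<open>The uniform Cauchy criterion for series of nonnegative terms: blocks starting at one N
  dominate all later blocks. With finite blocks, integrals and majorants pass through without any
  exchange of limits.\<close>

definition unif_sum :: "'a set \<Rightarrow> (nat \<Rightarrow> 'a \<Rightarrow> real) \<Rightarrow> bool" where
  "unif_sum I g \<longleftrightarrow> (\<forall>e>0. \<exists>N. \<forall>t\<in>I. \<forall>M. (\<Sum>k=N..<M. g k t) \<le> e)"

lemma unif_sumD:
  assumes "unif_sum I g" "0 < e"
  obtains N where "\<And>t M. t \<in> I \<Longrightarrow> (\<Sum>k=N..<M. g k t) \<le> e"
  using assms unfolding unif_sum_def by metis

lemma unif_sum_comparison:
  assumes g: "unif_sum I g" and h: "\<And>k t. t \<in> I \<Longrightarrow> h k t \<le> C * g k t" and "0 \<le> C"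
  shows "unif_sum I h"
  unfolding unif_sum_def
proof (intro allI impI)
  fix e :: real assume "0 < e"
  then obtain N where N: "\<And>t M. t \<in> I \<Longrightarrow> (\<Sum>k=N..<M. g k t) \<le> e / (C + 1)"
    using unif_sumD[OF g, of "e / (C + 1)"] \<open>0 \<le> C\<close> by auto
  have "(\<Sum>k=N..<M. h k t) \<le> e" if "t \<in> I" for t M
  proof -
    have "(\<Sum>k=N..<M. h k t) \<le> C * (\<Sum>k=N..<M. g k t)"
      unfolding sum_distrib_left using that by (intro sum_mono h)
    also have "\<dots> \<le> C * (e / (C + 1))"
      using N[OF that] \<open>0 \<le> C\<close> by (intro mult_left_mono) auto
    also have "\<dots> \<le> e" using \<open>0 \<le> C\<close> \<open>0 < e\<close> by (simp add: field_simps)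
    finally show ?thesis .
  qed
  then show "\<exists>N. \<forall>t\<in>I. \<forall>M. (\<Sum>k=N..<M. h k t) \<le> e" by blast
qed

lemma unif_sum_mono:
  assumes "unif_sum I g" and "\<And>k t. t \<in> J \<Longrightarrow> h k t \<le> g k t" and "J \<subseteq> I"
  shows "unif_sum J h"
proof (rule unif_sum_comparison[where C = 1 and g = g])
  show "unif_sum J g"
    using assms(1,3) unfolding unif_sum_def by (meson subsetD)
qed (use assms in auto)

lemma unif_sum_summable:
  assumes g: "unif_sum I g" and t: "t \<in> I" and nonneg: "\<And>k. 0 \<le> g k t"
  shows "summable (\<lambda>k. g k t)"
  unfolding summable_Cauchy
proof (intro allI impI)
  fix e :: real assume "0 < e"
  then obtain N where N: "\<And>t M. t \<in> I \<Longrightarrow> (\<Sum>k=N..<M. g k t) \<le> e / 2"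
    using unif_sumD[OF g, of "e / 2"] by auto
  have "norm (\<Sum>k=m..<n. g k t) < e" if "N \<le> m" for m n
  proof -
    have "(\<Sum>k=m..<n. g k t) \<le> (\<Sum>k=N..<n. g k t)"
      using that nonneg by (intro sum_mono2) auto
    then show ?thesis using N[OF t, of n] \<open>0 < e\<close> nonneg by (simp add: sum_nonneg)
  qed
  then show "\<exists>N. \<forall>m\<ge>N. \<forall>n. norm (\<Sum>k=m..<n. g k t) < e" by blast
qed

lemma unif_sum_add:
  assumes g: "unif_sum I g" and h: "unif_sum I h"
    and nonneg: "\<And>k t. t \<in> I \<Longrightarrow> 0 \<le> g k t" "\<And>k t. t \<in> I \<Longrightarrow> 0 \<le> h k t"
  shows "unif_sum I (\<lambda>k t. g k t + h k t)"
  unfolding unif_sum_def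
proof (intro allI impI)
  fix e :: real assume "0 < e"
  then obtain N N' where N: "\<And>t M. t \<in> I \<Longrightarrow> (\<Sum>k=N..<M. g k t) \<le> e / 2"
    and N': "\<And>t M. t \<in> I \<Longrightarrow> (\<Sum>k=N'..<M. h k t) \<le> e / 2"
    using unif_sumD[OF g, of "e / 2"] unif_sumD[OF h, of "e / 2"] by (metis half_gt_zero)
  have "(\<Sum>k=max N N'..<M. g k t + h k t) \<le> e" if "t \<in> I" for t M
  proof -
    have "(\<Sum>k=max N N'..<M. g k t) \<le> (\<Sum>k=N..<M. g k t)"
      "(\<Sum>k=max N N'..<M. h k t) \<le> (\<Sum>k=N'..<M. h k t)"
      using nonneg that by (auto intro!: sum_mono2)
    then show ?thesis using N[OF that, of M] N'[OF that, of M] by (simp add: sum.distrib)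
  qed
  then show "\<exists>N. \<forall>t\<in>I. \<forall>M. (\<Sum>k=N..<M. g k t + h k t) \<le> e" by blast
qed

lemma unif_sum_const:
  assumes "summable g" "\<And>k. 0 \<le> g k"
  shows "unif_sum I (\<lambda>k t. g k)"
  unfolding unif_sum_def
proof (intro allI impI)
  fix e :: real assume "0 < e"
  with assms(1) obtain N where "\<And>m n. N \<le> m \<Longrightarrow> norm (\<Sum>k=m..<n. g k) < e"
    unfolding summable_Cauchy by metis
  from this[of N] have "(\<Sum>k=N..<M. g k) \<le> e" for M
    using less_imp_le[of "norm (\<Sum>k=N..<M. g k)" e] by (simp add: abs_le_iff)
  then show "\<exists>N. \<forall>t\<in>I. \<forall>M. (\<Sum>k=N..<M. g k) \<le> e" by blast
qed

lemma unif_sum_uniform_limit: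
  fixes g :: "nat \<Rightarrow> 'a \<Rightarrow> 'b::banach"
  assumes "unif_sum I (\<lambda>k t. norm (g k t))"
  shows "uniform_limit I (\<lambda>N t. \<Sum>k<N. g k t) (\<lambda>t. \<Sum>k. g k t) sequentially"
proof (rule uniform_limitI)
  fix e :: real assume "0 < e"
  then obtain N where N: "\<And>t M. t \<in> I \<Longrightarrow> (\<Sum>k=N..<M. norm (g k t)) \<le> e / 2"
    using unif_sumD[OF assms, of "e / 2"] by auto
  have "dist (\<Sum>k<n. g k t) (\<Sum>k. g k t) < e" if "N \<le> n" "t \<in> I" for n t
  proof -
    have s: "summable (\<lambda>k. norm (g k t))"
      using unif_sum_summable[OF assms that(2)] by simp
    then have s': "summable (\<lambda>k. g k t)" by (rule summable_norm_cancel)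
    have sN: "summable (\<lambda>k. norm (g (k + n) t))" using s by (rule summable_ignore_initial_segment)
    have "norm (\<Sum>k. g (k + n) t) \<le> (\<Sum>k. norm (g (k + n) t))"
      by (rule summable_norm[OF sN])
    also have "\<dots> \<le> e / 2"
    proof (rule suminf_le_const[OF sN])
      fix j
      have "(\<Sum>k<j. norm (g (k + n) t)) = (\<Sum>k=n..<n+j. norm (g k t))"
        using sum.shift_bounds_nat_ivl[of "\<lambda>k. norm (g k t)" 0 n j] by (simp add: atLeast0LessThan add.commute)
      also have "\<dots> \<le> (\<Sum>k=N..<n+j. norm (g k t))"
        using that by (intro sum_mono2) auto
      finally show "(\<Sum>k<j. norm (g (k + n) t)) \<le> e / 2" using N[OF that(2), of "n + j"] by simp
    qed
    finally show ?thesis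
      using suminf_minus_initial_segment[OF s', of n] \<open>0 < e\<close> by (simp add: dist_norm norm_minus_commute)
  qed
  then show "\<forall>\<^sub>F n in sequentially. \<forall>t\<in>I. dist (\<Sum>k<n. g k t) (\<Sum>k. g k t) < e"
    by (auto simp: eventually_sequentially)
qed

lemma unif_sum_bounded:
  assumes g: "unif_sum I g" and bd: "\<And>k. \<exists>B. \<forall>t\<in>I. g k t \<le> B"
  obtains B where "0 < B" "\<And>t M. t \<in> I \<Longrightarrow> (\<Sum>k<M. g k t) \<le> B"
proof -
  obtain N where N: "\<And>t M. t \<in> I \<Longrightarrow> (\<Sum>k=N..<M. g k t) \<le> 1"
    using unif_sumD[OF g, of 1] by auto
  obtain B where B: "\<And>k t. t \<in> I \<Longrightarrow> g k t \<le> B k" using bd by metis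
  define B' where "B' = (\<Sum>k<N. \<bar>B k\<bar>) + 1"
  have "(\<Sum>k<M. g k t) \<le> B'" if "t \<in> I" for t M
  proof -
    have "(\<Sum>k<M. g k t) = (\<Sum>k<min M N. g k t) + (\<Sum>k=N..<M. g k t)"
    proof (cases "M \<le> N")
      case False
      then show ?thesis
        by (subst sum.union_disjoint[symmetric]) (auto intro!: sum.cong)
    qed auto
    also have "\<dots> \<le> (\<Sum>k<min M N. \<bar>B k\<bar>) + 1"
      using N[OF that] B[OF that] order_trans[OF _ abs_ge_self] by (intro add_mono sum_mono) blast+
    also have "\<dots> \<le> B'" unfolding B'_def by (intro add_mono sum_mono2) auto
    finally show ?thesis .
  qed
  moreover have "0 < B'" unfolding B'_def by (intro add_nonneg_pos sum_nonneg) auto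
  ultimately show ?thesis using that by blast
qed

text \<open>Distributes the weight c between kernel and datum under the integral. With c = 1 +
  \<kappa> and the interpolated bound, q receives a kernel free of \<kappa>, and h receives the
  factor (1 + \<kappa>)^\<epsilon>.\<close>

lemma conv_le:
  fixes f :: "real \<Rightarrow> 'a::{banach, second_countable_topology}" and h :: "real \<Rightarrow> real"
  assumes q: "set_integrable lborel {0<..<T} q" and k: "set_integrable lborel {0<..<T} k"
    and f: "f \<in> borel_measurable borel" "\<And>s. norm (f s) \<le> B"
    and h: "h \<in> borel_measurable borel" "\<And>s. norm (h s) \<le> B'"
    and le: "\<And>s r. s \<in> {0<..<T} \<Longrightarrow> c * (\<bar>k s\<bar> * norm (f r)) \<le> q s * h r"
    and "0 \<le> c" "t \<le> T"
  shows "c * norm (conv k f t) \<le> conv q h t"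
proof -
  have [measurable]: "f \<in> borel_measurable borel" "h \<in> borel_measurable borel" using f h by auto
  have i1: "set_integrable lborel {0<..<t} (\<lambda>s. k s *\<^sub>R f (t - s))"
    using \<open>t \<le> T\<close> f by (intro set_integrable_bounded_scaleR[of _ _ _ B] set_integrable_subset[OF k]) auto
  have i2: "set_integrable lborel {0<..<t} (\<lambda>s. q s *\<^sub>R h (t - s))"
    using \<open>t \<le> T\<close> h by (intro set_integrable_bounded_scaleR[of _ _ _ B'] set_integrable_subset[OF q]) auto
  have "c * norm (conv k f t) \<le> c * (LINT s:{0<..<t}|lborel. norm (k s *\<^sub>R f (t - s)))"
    unfolding conv_flip using \<open>0 \<le> c\<close> by (intro mult_left_mono set_integral_norm_bound i1)
  also have "\<dots> = (LINT s:{0<..<t}|lborel. c * norm (k s *\<^sub>R f (t - s)))" by simp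
  also have "\<dots> \<le> (LINT s:{0<..<t}|lborel. q s *\<^sub>R h (t - s))"
  proof (rule set_integral_mono[OF _ i2])
    show "set_integrable lborel {0<..<t} (\<lambda>s. c * norm (k s *\<^sub>R f (t - s)))"
      using set_integrable_norm[OF i1] by simp
  qed (use le \<open>t \<le> T\<close> in auto)
  also have "\<dots> = conv q h t" by (simp only: conv_flip)
  finally show ?thesis .
qed

lemma conv_sum_le:
  fixes h :: "nat \<Rightarrow> real \<Rightarrow> real"
  assumes q: "set_integrable lborel {0<..<T} q" "\<And>s. s \<in> {0<..<T} \<Longrightarrow> 0 \<le> q s"
    and h: "\<And>k. h k \<in> borel_measurable borel" "\<And>k s. norm (h k s) \<le> B k"
    and le: "\<And>s. (\<Sum>k\<in>S. h k s) \<le> \<eta>" and t: "t \<le> T"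
  shows "(\<Sum>k\<in>S. conv q (h k) t) \<le> \<eta> * (LINT s:{0<..<t}|lborel. q s)"
proof -
  have qt: "set_integrable lborel {0<..<t} q" using t by (intro set_integrable_subset[OF q(1)]) auto
  have i: "set_integrable lborel {0<..<t} (\<lambda>s. q s *\<^sub>R h k (t - s))" for k
    using h by (intro set_integrable_bounded_scaleR[OF qt, of _ "B k"]) (auto intro!: measurable_compose[OF _ h(1)])
  have eq: "(\<lambda>s. \<Sum>k\<in>S. indicat_real {0<..<t} s *\<^sub>R q s *\<^sub>R h k (t - s))
      = (\<lambda>s. indicat_real {0<..<t} s *\<^sub>R (q s * (\<Sum>k\<in>S. h k (t - s))))"
    by (simp add: sum_distrib_left)
  have "(\<Sum>k\<in>S. conv q (h k) t) = (LINT s:{0<..<t}|lborel. q s * (\<Sum>k\<in>S. h k (t - s)))"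
    unfolding conv_flip set_lebesgue_integral_def eq[symmetric]
    by (rule Bochner_Integration.integral_sum[symmetric]) (use i in \<open>simp add: set_integrable_def\<close>)
  also have "\<dots> \<le> (LINT s:{0<..<t}|lborel. q s * \<eta>)"
  proof (rule set_integral_mono)
    have "integrable lborel (\<lambda>s. \<Sum>k\<in>S. indicat_real {0<..<t} s *\<^sub>R q s *\<^sub>R h k (t - s))"
      using i by (intro Bochner_Integration.integrable_sum) (simp add: set_integrable_def)
    then show "set_integrable lborel {0<..<t} (\<lambda>s. q s * (\<Sum>k\<in>S. h k (t - s)))"
      by (simp only: set_integrable_def eq)
    show "set_integrable lborel {0<..<t} (\<lambda>s. q s * \<eta>)" using qt by simp
    show "q s * (\<Sum>k\<in>S. h k (t - s)) \<le> q s * \<eta>" if "s \<in> {0<..<t}" for s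
      using q(2)[of s] le[of "t - s"] that t by (intro mult_left_mono) auto
  qed
  finally show ?thesis by (simp add: mult.commute)
qed

text \<open>As q is the same for all k, a tail of the convolved series is the convolution of q with
  a tail of h, hence at most that tail's uniform bound times the mass of q.\<close>

lemma unif_sum_conv:
  fixes h :: "nat \<Rightarrow> real \<Rightarrow> real"
  assumes q: "set_integrable lborel {0<..<T} q" "\<And>s. s \<in> {0<..<T} \<Longrightarrow> 0 \<le> q s"
    and h: "\<And>k. h k \<in> borel_measurable borel" "\<And>k s. norm (h k s) \<le> B k" and u: "unif_sum UNIV h"
  shows "unif_sum {0..T} (\<lambda>k. conv q (h k))"
  unfolding unif_sum_def
proof (intro allI impI)
  fix e :: real assume "0 < e"
  define Q where "Q = (LINT s:{0<..<T}|lborel. q s)"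
  have Q: "0 \<le> Q" unfolding Q_def using q by (intro set_integral_nonneg)
  obtain N where N: "\<And>t M. (\<Sum>k=N..<M. h k t) \<le> e / (Q + 1)"
    using unif_sumD[OF u, of "e / (Q + 1)"] \<open>0 < e\<close> Q by auto
  have "(\<Sum>k=N..<M. conv q (h k) t) \<le> e" if "t \<in> {0..T}" for t M
  proof -
    have 1: "(\<Sum>k=N..<M. conv q (h k) t) \<le> e / (Q + 1) * (LINT s:{0<..<t}|lborel. q s)"
      using that by (intro conv_sum_le[OF q h] N) auto
    have "(LINT s:{0<..<t}|lborel. q s) \<le> Q"
      unfolding Q_def set_lebesgue_integral_def
    proof (rule integral_mono)
      show "integrable lborel (\<lambda>s. indicat_real {0<..<t} s *\<^sub>R q s)"
        by (rule set_integrable_subset[OF q(1), unfolded set_integrable_def]) (use that in auto)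
      show "integrable lborel (\<lambda>s. indicat_real {0<..<T} s *\<^sub>R q s)"
        using q(1) by (simp add: set_integrable_def)
      show "indicat_real {0<..<t} s *\<^sub>R q s \<le> indicat_real {0<..<T} s *\<^sub>R q s" for s
        using q(2)[of s] that by (auto simp: indicator_def)
    qed
    then have 2: "e / (Q + 1) * (LINT s:{0<..<t}|lborel. q s) \<le> e / (Q + 1) * Q"
      using Q \<open>0 < e\<close> by (intro mult_left_mono) auto
    have "e / (Q + 1) * Q \<le> e" using Q \<open>0 < e\<close> by (simp add: field_simps)
    with 1 2 show ?thesis by linarith
  qed
  then show "\<exists>N. \<forall>t\<in>{0..T}. \<forall>M. (\<Sum>k=N..<M. conv q (h k) t) \<le> e" by blast
qed

text \<open>Used twice: in time on [\<delta>, T], with a one-sided derivative at T, and in space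
  along coordinate lines, where S is the whole line.\<close>

lemma series_has_vector_derivative:
  fixes f :: "nat \<Rightarrow> real \<Rightarrow> 'a::banach"
  assumes S: "convex S"
    and f: "\<And>k r. r \<in> S \<Longrightarrow> (f k has_vector_derivative f' k r) (at r within S)"
    and lim: "uniform_limit S (\<lambda>n r. \<Sum>k<n. f' k r) g' sequentially"
    and summ: "\<And>r. r \<in> S \<Longrightarrow> summable (\<lambda>k. f k r)"
    and t: "t \<in> S"
  shows "((\<lambda>r. \<Sum>k. f k r) has_vector_derivative g' t) (at t within S)"
proof -
  have "\<exists>g. \<forall>r\<in>S. (\<lambda>k. f k r) sums g r \<and> (g has_derivative (\<lambda>h. h *\<^sub>R g' r)) (at r within S)"
  proof (rule has_derivative_series[where f' = "\<lambda>k r h. h *\<^sub>R f' k r" and x = t and l = "\<Sum>k. f k t", OF S])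
    show "(f k has_derivative (\<lambda>h. h *\<^sub>R f' k r)) (at r within S)" if "r \<in> S" for k r
      using f[OF that] by (simp add: has_vector_derivative_def)
    fix e :: real assume "0 < e"
    from uniform_limitD[OF lim this]
    show "\<forall>\<^sub>F n in sequentially. \<forall>r\<in>S. \<forall>h. norm ((\<Sum>k<n. h *\<^sub>R f' k r) - h *\<^sub>R g' r) \<le> e * norm h"
    proof eventually_elim
      case (elim n)
      show ?case
      proof (intro ballI allI)
        fix r h :: real assume "r \<in> S"
        then have "dist (\<Sum>k<n. f' k r) (g' r) \<le> e" using elim by force
        then have "\<bar>h\<bar> * norm ((\<Sum>k<n. f' k r) - g' r) \<le> \<bar>h\<bar> * e"
          by (intro mult_left_mono) (auto simp: dist_norm)
        then show "norm ((\<Sum>k<n. h *\<^sub>R f' k r) - h *\<^sub>R g' r) \<le> e * norm h"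
          by (simp only: scaleR_sum_right[symmetric] scaleR_diff_right[symmetric] norm_scaleR real_norm_def mult.commute[of e])
      qed
    qed
  next
    show "t \<in> S" "(\<lambda>k. f k t) sums (\<Sum>k. f k t)" using t summ by (auto intro: summable_sums)
  qed
  then obtain g where g: "\<And>r. r \<in> S \<Longrightarrow> (\<lambda>k. f k r) sums g r"
    "\<And>r. r \<in> S \<Longrightarrow> (g has_derivative (\<lambda>h. h *\<^sub>R g' r)) (at r within S)" by blast
  show ?thesis
  proof (rule has_vector_derivative_transform[OF t])
    show "(\<Sum>k. f k r) = g r" if "r \<in> S" for r using sums_unique[OF g(1)[OF that]] by simp
    show "(g has_vector_derivative g' t) (at t within S)"
      using g(2)[OF t] by (simp add: has_vector_derivative_def)
  qed
qed

section \<open>Systems of fractional relaxation equations\<close>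

lemma resolvent_measurable [measurable]: "resolvent \<rho> \<kappa> \<in> borel_measurable borel"
  unfolding resolvent_def by measurable

lemma relaxation_measurable [measurable]: "relaxation \<rho> \<kappa> \<in> borel_measurable borel"
  unfolding relaxation_def by measurable

lemma powr_set_integrable:
  fixes a T :: real
  assumes "-1 < a" "0 < T"
  shows "set_integrable lborel {0<..<T} (\<lambda>s. s powr a)"
proof -
  have "set_integrable lborel {0<..<T} (abel_kernel (a + 1))"
    using abel_kernel_integral(1)[of "a + 1" T] assms by (simp add: set_integral_flip(2))
  then have "set_integrable lborel {0<..<T} (\<lambda>s. Gamma (a + 1) * abel_kernel (a + 1) s)"
    by simp
  moreover have "Gamma (a + 1) \<noteq> 0" using less_imp_neq[OF Gamma_real_pos[of "a + 1"]] assms by auto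
  ultimately show ?thesis by (simp add: abel_kernel_def)
qed

lemma set_integrable_one: "set_integrable lborel {0<..<T::real} (\<lambda>_. 1 :: real)"
  by (rule set_integrable_subset[OF borel_integrable_atLeastAtMost'[of 0 T]]) auto

text \<open>The problem in Fourier space: countably many decoupled scalar equations with rates
  \<kappa>, data p and forcing f. The forcing lives on the whole line, as
  \<open>continuous_on_conv\<close> demands; \<open>f_sum\<close> is the trace left of the spatial
  smoothness, an extra \<epsilon>-power of the operator.\<close>

locale relaxation_system =
  fixes \<rho> T \<epsilon> :: real and \<kappa> :: "nat \<Rightarrow> real" and p :: "nat \<Rightarrow> complex" and f :: "nat \<Rightarrow> real \<Rightarrow> complex"
  assumes \<rho>: "0 < \<rho>" "\<rho> \<le> 1" and T: "0 < T" and \<epsilon>: "0 < \<epsilon>" "\<epsilon> < 1"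
    and \<kappa>: "\<And>k. 0 \<le> \<kappa> k"
    and p: "summable (\<lambda>k. norm (p k))"
    and f_cont: "\<And>k. continuous_on UNIV (f k)"
    and f_bdd: "\<And>k. bounded (range (f k))"
    and f_sum: "unif_sum UNIV (\<lambda>k t. (1 + \<kappa> k) powr \<epsilon> * norm (f k t))"
begin

abbreviation "e \<equiv> \<lambda>k. resolvent \<rho> (\<kappa> k)"

text \<open>Duhamel's formula. The datum is multiplied by e rather than by y, because it is
  prescribed for the fractional integral of the solution and not for the solution itself.\<close>

definition u :: "nat \<Rightarrow> real \<Rightarrow> complex" where
  "u k t = e k t *\<^sub>R p k + conv (e k) (f k) t"

text \<open>Agrees with \<^term>\<open>relaxation \<rho> (\<kappa> k)\<close> for \<open>t > 0\<close>, but has the right value \<open>1\<close> at \<open>t = 0\<close>.\<close>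

definition Y :: "nat \<Rightarrow> real \<Rightarrow> real" where
  "Y k t = 1 - \<kappa> k * (LINT s:{0<..<t}|lborel. e k s)"

text \<open>For t in (0, T] this is the fractional integral of order 1 - \<rho> of
  \<open>u k\<close> (\<open>abel_conv_u\<close>, and \<open>W_eq_u\<close> when \<rho> = 1). The
  closed form makes sense at t = 0 as well, with value p k, and is continuous there.\<close>

definition W :: "nat \<Rightarrow> real \<Rightarrow> complex" where
  "W k t = Y k t *\<^sub>R p k + conv (Y k) (f k) t"

lemma f_meas [measurable]: "f k \<in> borel_measurable borel"
  using f_cont by (rule borel_measurable_continuous_onI)

lemma f_bound: obtains B where "\<And>k t. norm (f k t) \<le> B k"
proof -
  have "\<forall>k. \<exists>B. \<forall>t. norm (f k t) \<le> B"
    using f_bdd by (auto simp: bounded_iff)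
  then show ?thesis using that by metis
qed

lemma e_nonneg: "0 < t \<Longrightarrow> 0 \<le> e k t"
  using resolvent_nonneg \<rho> \<kappa> by blast

lemma e_int: "set_integrable lborel {0<..<t} (e k)"
proof (cases "0 < t")
  case True
  then show ?thesis using resolvent_integral(1) \<rho> by blast
next
  case False
  then show ?thesis by simp
qed

lemma Y_eq: "0 < t \<Longrightarrow> Y k t = relaxation \<rho> (\<kappa> k) t"
  using resolvent_integral(2)[of \<rho> t "\<kappa> k"] \<rho> by (simp add: Y_def)

lemma Y_0: "Y k 0 = 1" by (simp add: Y_def set_lebesgue_integral_def)

lemma Y_bound: "0 \<le> t \<Longrightarrow> \<bar>Y k t\<bar> \<le> 1"
  using relaxation_nonneg[of \<rho> "\<kappa> k" t] relaxation_le_1[of \<rho> "\<kappa> k" t] \<rho> \<kappa>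
  by (cases "t = 0") (auto simp: Y_0 Y_eq)

lemma W_0: "W k 0 = p k" by (simp add: W_def Y_0 conv_def set_lebesgue_integral_def)

lemma relaxation_int: "set_integrable lborel {0<..<t} (relaxation \<rho> (\<kappa> k))"
proof (rule set_integrable_bound[OF set_integrable_one])
  show "set_borel_measurable lborel {0<..<t} (relaxation \<rho> (\<kappa> k))"
    unfolding set_borel_measurable_def by measurable
  show "AE s in lborel. s \<in> {0<..<t} \<longrightarrow> norm (relaxation \<rho> (\<kappa> k) s) \<le> norm (1::real)"
  proof (intro AE_I2 impI)
    fix s assume "s \<in> {0<..<t}"
    then show "norm (relaxation \<rho> (\<kappa> k) s) \<le> norm (1::real)"
      using Y_bound[of s k] Y_eq[of s k] by simp
  qed
qed

lemma Y_cont: "continuous_on {0..T} (Y k)"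
proof -
  have "continuous_on {0..T} (conv (e k) (\<lambda>_. 1::real))"
    by (rule continuous_on_conv[OF e_int, of _ 1]) (auto intro: continuous_intros)
  moreover have "Y k = (\<lambda>t. 1 - \<kappa> k * conv (e k) (\<lambda>_. 1::real) t)"
    by (auto simp: Y_def conv_flip)
  ultimately show ?thesis by (auto intro!: continuous_intros)
qed

lemma conv_Y: "conv (Y k) g t = conv (relaxation \<rho> (\<kappa> k)) g t"
  by (rule conv_cong) (auto simp: Y_eq)

lemma conv_cont:
  "continuous_on {0..T} (conv (e k) (f k))"
  "continuous_on {0..T} (conv (Y k) (f k))"
  "continuous_on {0..T} (conv (\<lambda>_. 1) (f k))"
proof -
  obtain B where B: "\<And>k t. norm (f k t) \<le> B k" using f_bound by blast
  show "continuous_on {0..T} (conv (e k) (f k))"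
    by (rule continuous_on_conv[OF e_int f_cont B])
  show "continuous_on {0..T} (conv (\<lambda>_. 1) (f k))"
    by (rule continuous_on_conv[OF set_integrable_one f_cont B])
  have "conv (Y k) (f k) = conv (relaxation \<rho> (\<kappa> k)) (f k)"
    by (rule ext) (rule conv_Y)
  then show "continuous_on {0..T} (conv (Y k) (f k))"
    using continuous_on_conv[OF relaxation_int f_cont B] by simp
qed

lemma W_cont: "continuous_on {0..T} (W k)"
  unfolding W_def[abs_def] by (intro continuous_intros Y_cont conv_cont)

lemma e_cont: "continuous_on {0<..} (e k)"
  using continuous_on_ml_kernel[of \<rho> \<rho>] \<rho> by (simp add: resolvent_def)

lemma u_cont: "continuous_on {0<..T} (u k)"
  unfolding u_def[abs_def]
  by (intro continuous_intros continuous_on_subset[OF e_cont] continuous_on_subset[OF conv_cont(1)]) auto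

lemma weight_ge_1: "1 \<le> (1 + \<kappa> k) powr \<epsilon>"
  using \<kappa> \<epsilon> by (intro ge_one_powr_ge_zero) auto

lemma f_unif: "unif_sum UNIV (\<lambda>k t. norm (f k t))"
proof (rule unif_sum_mono[OF f_sum])
  show "norm (f k t) \<le> (1 + \<kappa> k) powr \<epsilon> * norm (f k t)" for k t
    using mult_right_mono[OF weight_ge_1, of "norm (f k t)" k] by simp
qed auto

text \<open>The datum term takes the bound C / t, which is at most C / \<delta> here. The forcing
  term is integrated over times arbitrarily close to 0 and takes the interpolated bound, at the
  price of the weight (1 + \<kappa>)^\<epsilon> on f.\<close>

lemma u_sum:
  assumes "0 < \<delta>"
  shows "unif_sum {\<delta>..T} (\<lambda>k t. (1 + \<kappa> k) * norm (u k t))"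
proof -
  obtain C where C: "0 < C"
    "\<And>\<kappa> t. 0 \<le> \<kappa> \<Longrightarrow> t \<in> {0<..T} \<Longrightarrow> (1 + \<kappa>) * resolvent \<rho> \<kappa> t \<le> C / t"
    "\<And>\<kappa> t. 0 \<le> \<kappa> \<Longrightarrow> t \<in> {0<..T} \<Longrightarrow>
      (1 + \<kappa>) * resolvent \<rho> \<kappa> t \<le> C * (1 + \<kappa>) powr \<epsilon> * t powr (\<epsilon> * \<rho> - 1)"
    using resolvent_interpolation[OF \<rho> \<epsilon> T] by metis
  obtain B where B: "\<And>k t. norm (f k t) \<le> B k" using f_bound by blast
  define q where "q = (\<lambda>s. C * s powr (\<epsilon> * \<rho> - 1))"
  define h where "h = (\<lambda>k t. (1 + \<kappa> k) powr \<epsilon> * norm (f k t))"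
  have q: "set_integrable lborel {0<..<T} q"
    unfolding q_def using powr_set_integrable[of "\<epsilon> * \<rho> - 1" T] \<epsilon> \<rho> T by simp
  have qn: "0 \<le> q s" for s using C(1) by (simp add: q_def)
  have hm: "h k \<in> borel_measurable borel" for k unfolding h_def by measurable
  have hb: "norm (h k s) \<le> (1 + \<kappa> k) powr \<epsilon> * B k" for k s
    using B by (simp add: h_def mult_left_mono)
  have "unif_sum {\<delta>..T} (\<lambda>k t. C / \<delta> * norm (p k) + conv q (h k) t)"
  proof (rule unif_sum_add)
    show "unif_sum {\<delta>..T} (\<lambda>k t. C / \<delta> * norm (p k))"
      using p C(1) assms by (intro unif_sum_const summable_mult) auto
    have "unif_sum {0..T} (\<lambda>k. conv q (h k))"
      using unif_sum_conv[OF q qn hm hb] f_sum by (simp add: h_def)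
    then show "unif_sum {\<delta>..T} (\<lambda>k. conv q (h k))"
      by (rule unif_sum_mono) (use assms in auto)
    show "0 \<le> conv q (h k) t" for k t
      unfolding conv_def by (intro set_integral_nonneg) (auto simp: qn h_def)
  qed (use C(1) assms in auto)
  then show ?thesis
  proof (rule unif_sum_mono)
    fix k t assume t: "t \<in> {\<delta>..T}"
    have "(1 + \<kappa> k) * norm (conv (e k) (f k) t) \<le> conv q (h k) t"
    proof (rule conv_le[OF q e_int f_meas B hm hb])
      fix s r assume s: "s \<in> {0<..<T}"
      have "(1 + \<kappa> k) * e k s * norm (f k r) \<le> C * (1 + \<kappa> k) powr \<epsilon> * s powr (\<epsilon> * \<rho> - 1) * norm (f k r)"
        using s \<kappa> by (intro mult_right_mono C(3)) auto
      then show "(1 + \<kappa> k) * (\<bar>e k s\<bar> * norm (f k r)) \<le> q s * h k r"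
        using e_nonneg[of s k] s by (simp add: q_def h_def mult_ac)
    qed (use \<kappa>[of k] t in auto)
    moreover have "(1 + \<kappa> k) * norm (e k t *\<^sub>R p k) \<le> C / \<delta> * norm (p k)"
    proof -
      have "(1 + \<kappa> k) * e k t \<le> C / t" using C(2)[OF \<kappa>, of t k] t assms by auto
      also have "\<dots> \<le> C / \<delta>" using C(1) t assms by (intro divide_left_mono) auto
      finally have "(1 + \<kappa> k) * e k t * norm (p k) \<le> C / \<delta> * norm (p k)"
        by (rule mult_right_mono) simp
      then show ?thesis using e_nonneg[of t k] t assms by (simp add: mult.assoc)
    qed
    moreover have "(1 + \<kappa> k) * norm (u k t) \<le> (1 + \<kappa> k) * (norm (e k t *\<^sub>R p k) + norm (conv (e k) (f k) t))"
      unfolding u_def using \<kappa>[of k] by (intro mult_left_mono norm_triangle_ineq) auto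
    ultimately show "(1 + \<kappa> k) * norm (u k t) \<le> C / \<delta> * norm (p k) + conv q (h k) t"
      by (simp add: distrib_left)
  qed auto
qed

text \<open>As |Y| is at most 1, the constant kernel 1 dominates every mode; unweighted summability
  of the data suffices and the convergence is uniform down to t = 0.\<close>

lemma W_sum: "unif_sum {0..T} (\<lambda>k t. norm (W k t))"
proof -
  obtain B where B: "\<And>k t. norm (f k t) \<le> B k" using f_bound by blast
  have hm: "(\<lambda>t. norm (f k t)) \<in> borel_measurable borel" for k by measurable
  have hb: "norm (norm (f k t)) \<le> B k" for k t using B by simp
  have "unif_sum {0..T} (\<lambda>k t. norm (p k) + conv (\<lambda>_. 1) (\<lambda>t. norm (f k t)) t)"
  proof (rule unif_sum_add)
    show "unif_sum {0..T} (\<lambda>k t. norm (p k))"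
      using p by (intro unif_sum_const) auto
    show "unif_sum {0..T} (\<lambda>k. conv (\<lambda>_. 1) (\<lambda>t. norm (f k t)))"
      using unif_sum_conv[OF set_integrable_one _ hm hb f_unif] by simp
    show "0 \<le> conv (\<lambda>_. 1) (\<lambda>t. norm (f k t)) t" for k t
      unfolding conv_def by (intro set_integral_nonneg) auto
  qed auto
  then show ?thesis
  proof (rule unif_sum_mono)
    fix k t assume t: "t \<in> {0..T}"
    have "1 * norm (conv (relaxation \<rho> (\<kappa> k)) (f k) t) \<le> conv (\<lambda>_. 1) (\<lambda>t. norm (f k t)) t"
    proof (rule conv_le[OF set_integrable_one relaxation_int f_meas B hm hb])
      fix s r assume s: "s \<in> {0<..<T}"
      then show "1 * (\<bar>relaxation \<rho> (\<kappa> k) s\<bar> * norm (f k r)) \<le> 1 * norm (f k r)"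
        using Y_bound[of s k] Y_eq[of s k] by (simp add: mult_left_le_one_le)
    qed (use t in auto)
    moreover have "norm (Y k t *\<^sub>R p k) \<le> norm (p k)"
      using Y_bound[of t k] t by (simp add: mult_left_le_one_le)
    moreover have "norm (W k t) \<le> norm (Y k t *\<^sub>R p k) + norm (conv (Y k) (f k) t)"
      unfolding W_def by (rule norm_triangle_ineq)
    ultimately show "norm (W k t) \<le> norm (p k) + conv (\<lambda>_. 1) (\<lambda>t. norm (f k t)) t"
      by (simp add: conv_Y)
  qed auto
qed

text \<open>All partial sums blow up at 0 no faster than the Abel kernel of order \<rho>, which
  remains integrable against the kernel of order 1 - \<rho>. This permits the exchange of sum and
  fractional integral in \<open>u_series_abel\<close>.\<close>

lemma u_majorant:
  obtains C where "0 < C" "\<And>M t. t \<in> {0<..T} \<Longrightarrow> (\<Sum>k<M. norm (u k t)) \<le> C * abel_kernel \<rho> t"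
proof -
  obtain B where B: "\<And>k t. norm (f k t) \<le> B k" using f_bound by blast
  have hm: "(\<lambda>t. norm (f k t)) \<in> borel_measurable borel" for k by measurable
  have hb: "norm (norm (f k t)) \<le> B k" for k t using B by simp
  obtain F where F: "0 < F" "\<And>t M. (\<Sum>k<M. norm (f k t)) \<le> F"
    using unif_sum_bounded[OF f_unif] B by (metis UNIV_I)
  have ki: "set_integrable lborel {0<..<t} (abel_kernel \<rho>)" if "0 < t" for t
    using abel_kernel_integral(1)[of \<rho> t] \<rho> that by (simp add: set_integral_flip(2))
  define P where "P = (\<Sum>k. norm (p k))"
  have P: "0 \<le> P" unfolding P_def using p by (intro suminf_nonneg) auto
  define C where "C = P + F * (T / \<rho>)"
  have "(\<Sum>k<M. norm (u k t)) \<le> C * abel_kernel \<rho> t" if t: "t \<in> {0<..T}" for M t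
  proof -
    have "norm (u k t) \<le> norm (p k) * abel_kernel \<rho> t + conv (abel_kernel \<rho>) (\<lambda>t. norm (f k t)) t" for k
    proof -
      have "1 * norm (conv (e k) (f k) t) \<le> conv (abel_kernel \<rho>) (\<lambda>t. norm (f k t)) t"
      proof (rule conv_le[OF ki[OF T] e_int f_meas B hm hb])
        fix s r assume s: "s \<in> {0<..<T}"
        then show "1 * (\<bar>e k s\<bar> * norm (f k r)) \<le> abel_kernel \<rho> s * norm (f k r)"
          using e_nonneg[of s k] resolvent_le_abel_kernel[of \<rho> "\<kappa> k" s] \<rho> \<kappa> by (simp add: mult_right_mono)
      qed (use t in auto)
      moreover have "norm (e k t *\<^sub>R p k) \<le> norm (p k) * abel_kernel \<rho> t"
        using e_nonneg[of t k] resolvent_le_abel_kernel[of \<rho> "\<kappa> k" t] \<rho> \<kappa> t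
        by (simp add: mult.commute[of _ "norm (p k)"] mult_left_mono)
      ultimately show ?thesis
        unfolding u_def by (intro norm_triangle_le) simp
    qed
    then have "(\<Sum>k<M. norm (u k t)) \<le> (\<Sum>k<M. norm (p k)) * abel_kernel \<rho> t
        + (\<Sum>k<M. conv (abel_kernel \<rho>) (\<lambda>t. norm (f k t)) t)"
      unfolding sum_distrib_right sum.distrib[symmetric] by (intro sum_mono)
    also have "(\<Sum>k<M. conv (abel_kernel \<rho>) (\<lambda>t. norm (f k t)) t) \<le> F * (LINT s:{0<..<t}|lborel. abel_kernel \<rho> s)"
      using \<rho> t by (intro conv_sum_le[OF ki[OF T] _ hm hb F(2)]) (auto intro: abel_kernel_nonneg)
    also have "(LINT s:{0<..<t}|lborel. abel_kernel \<rho> s) = t / \<rho> * abel_kernel \<rho> t"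
      using abel_kernel_integral(2)[of \<rho> t] abel_kernel_plus_1[of \<rho> t] \<rho> t by (simp add: set_integral_flip(1))
    also have "F * (t / \<rho> * abel_kernel \<rho> t) \<le> F * (T / \<rho> * abel_kernel \<rho> t)"
      using F \<rho> t by (intro mult_left_mono mult_right_mono divide_right_mono abel_kernel_nonneg) auto
    also have "(\<Sum>k<M. norm (p k)) * abel_kernel \<rho> t \<le> P * abel_kernel \<rho> t"
      unfolding P_def using p \<rho> by (intro mult_right_mono sum_le_suminf abel_kernel_nonneg) auto
    finally show ?thesis by (simp add: C_def algebra_simps)
  qed
  moreover have "0 < C" using P F \<rho> T by (simp add: C_def add_nonneg_pos)
  ultimately show ?thesis using that by blast
qed

text \<open>The kernel of order 1 - \<rho> convolved with e is y; associativity moves it through e *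
  f.\<close>

lemma abel_conv_u:
  assumes "\<rho> < 1" "t \<in> {0<..T}"
  shows "set_integrable lborel {0<..<t} (\<lambda>s. abel_kernel (1 - \<rho>) (t - s) *\<^sub>R u k s)"
    and "conv (abel_kernel (1 - \<rho>)) (u k) t = W k t"
proof -
  obtain B where B: "\<And>k t. norm (f k t) \<le> B k" using f_bound by blast
  let ?a = "abel_kernel (1 - \<rho>)"
  have r: "set_integrable lborel {0<..<r} (\<lambda>s. ?a (r - s) * e k s)"
    "conv ?a (e k) r = relaxation \<rho> (\<kappa> k) r" if "0 < r" for r
    using resolvent_abel[of \<rho> r "\<kappa> k"] \<rho> assms that by (simp_all add: conv_def)
  have rc: "set_integrable lborel {0<..<t} (conv ?a (e k))"
    using relaxation_int[of t k] by (rule iffD1[OF set_integrable_cong, rotated -1]) (auto simp: r)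
  have nn: "0 \<le> ?a s" for s using assms by (simp add: abel_kernel_nonneg)
  have i1: "set_integrable lborel {0<..<t} (\<lambda>s. ?a (t - s) *\<^sub>R conv (e k) (f k) s)"
    and I1: "conv ?a (conv (e k) (f k)) t = conv (conv ?a (e k)) (f k) t"
    using conv_assoc[OF _ _ f_meas nn e_nonneg r(1) rc B] by auto
  have i2: "set_integrable lborel {0<..<t} (\<lambda>s. ?a (t - s) *\<^sub>R e k s *\<^sub>R p k)"
  proof -
    have "set_integrable lborel {0<..<t} (\<lambda>s. (?a (t - s) * e k s) *\<^sub>R p k)"
      using r(1)[of t] assms by (intro set_integrable_scaleR_left) auto
    then show ?thesis by simp
  qed
  show "set_integrable lborel {0<..<t} (\<lambda>s. ?a (t - s) *\<^sub>R u k s)"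
    unfolding u_def scaleR_add_right using i1 i2 by (intro set_integral_add)
  have "conv ?a (u k) t = (LINT s:{0<..<t}|lborel. ?a (t - s) *\<^sub>R e k s *\<^sub>R p k) + conv ?a (conv (e k) (f k)) t"
    unfolding u_def conv_def[of ?a] scaleR_add_right using i1 i2 by (intro set_integral_add)
  also have "conv ?a (conv (e k) (f k)) t = conv (Y k) (f k) t"
    unfolding I1 by (rule conv_cong) (auto simp: r Y_eq)
  also have "(LINT s:{0<..<t}|lborel. ?a (t - s) *\<^sub>R e k s *\<^sub>R p k) = Y k t *\<^sub>R p k"
  proof -
    have "(LINT s:{0<..<t}|lborel. (?a (t - s) * e k s) *\<^sub>R p k) = conv ?a (e k) t *\<^sub>R p k"
      unfolding conv_def set_lebesgue_integral_def
      using integral_scaleR_left[of "p k" lborel "\<lambda>s. indicat_real {0<..<t} s *\<^sub>R (?a (t - s) * e k s)"] r(1)[of t] assms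
      by (simp add: set_integrable_def)
    then show ?thesis using r(2)[of t] assms by (simp add: Y_eq)
  qed
  finally show "conv ?a (u k) t = W k t" by (simp add: W_def)
qed

end

section \<open>Time derivatives of the modes and of their series\<close>

lemma set_integral_eq_integral_Icc:
  fixes g :: "real \<Rightarrow> 'a::euclidean_space"
  assumes "continuous_on {a..b} g"
  shows "(LINT s:{a<..<b}|lborel. g s) = integral {a..b} g"
proof -
  have "set_integrable lborel {a<..<b} g"
    by (rule set_integrable_subset[OF borel_integrable_atLeastAtMost'[OF assms]]) auto
  then show ?thesis
    using set_borel_integral_eq_integral(2) integral_open_interval_real by metis
qed

lemma unif_sum_continuous_on:
  fixes c :: "nat \<Rightarrow> 'a::topological_space \<Rightarrow> complex" and \<psi> :: "nat \<Rightarrow> 'b::topological_space \<Rightarrow> complex"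
  assumes u: "unif_sum I (\<lambda>k t. norm (c k t))"
    and c: "\<And>k. continuous_on I (c k)"
    and \<psi>: "\<And>k. continuous_on UNIV (\<psi> k)" "\<And>k x. norm (\<psi> k x) \<le> 1"
  shows "continuous_on (UNIV \<times> I) (\<lambda>(x, t). \<Sum>k. c k t * \<psi> k x)"
proof -
  have "unif_sum (UNIV \<times> I) (\<lambda>k z. norm (c k (snd z) * \<psi> k (fst z)))"
    unfolding unif_sum_def
  proof (intro allI impI)
    fix e :: real assume "0 < e"
    then obtain N where N: "\<And>t M. t \<in> I \<Longrightarrow> (\<Sum>k=N..<M. norm (c k t)) \<le> e"
      using unif_sumD[OF u] by blast
    have "(\<Sum>k=N..<M. norm (c k (snd z) * \<psi> k (fst z))) \<le> e" if "z \<in> UNIV \<times> I" for z M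
    proof -
      have "(\<Sum>k=N..<M. norm (c k (snd z) * \<psi> k (fst z))) \<le> (\<Sum>k=N..<M. norm (c k (snd z)))"
        using \<psi>(2) by (intro sum_mono) (simp add: norm_mult mult_left_le)
      also have "\<dots> \<le> e" using N that by auto
      finally show ?thesis .
    qed
    then show "\<exists>N. \<forall>z\<in>UNIV \<times> I. \<forall>M. (\<Sum>k=N..<M. norm (c k (snd z) * \<psi> k (fst z))) \<le> e" by blast
  qed
  from unif_sum_uniform_limit[OF this]
  have "continuous_on (UNIV \<times> I) (\<lambda>z. \<Sum>k. c k (snd z) * \<psi> k (fst z))"
  proof (rule uniform_limit_theorem[rotated])
    have "continuous_on (UNIV \<times> I) (\<lambda>z. \<Sum>k<n. c k (snd z) * \<psi> k (fst z))" for n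
      by (intro continuous_on_sum continuous_on_mult continuous_on_compose2[OF c] continuous_on_compose2[OF \<psi>(1)]
          continuous_intros) auto
    then show "\<forall>\<^sub>F n in sequentially. continuous_on (UNIV \<times> I) (\<lambda>z. \<Sum>k<n. c k (snd z) * \<psi> k (fst z))"
      by simp
  qed simp
  then show ?thesis by (simp add: case_prod_beta)
qed

text \<open>Continuity is local and each t > 0 lies in the interior of the half-line from t / 2. The
  series converge uniformly only on intervals [\<delta>, T], so joint continuity has to be assembled
  from these.\<close>

lemma continuous_on_half_open:
  fixes g :: "'a::t2_space \<times> real \<Rightarrow> 'b::t2_space"
  assumes "\<And>\<delta>. 0 < \<delta> \<Longrightarrow> continuous_on (UNIV \<times> {\<delta>..T}) g"
  shows "continuous_on (UNIV \<times> {0<..T}) g"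
  unfolding continuous_on_eq_continuous_within
proof
  fix z assume z: "z \<in> (UNIV :: 'a set) \<times> {0<..T}"
  define \<delta> where "\<delta> = snd z / 2"
  have d: "0 < \<delta>" "\<delta> < snd z" using z by (auto simp: \<delta>_def)
  have "at z within UNIV \<times> {0<..T} = at z within UNIV \<times> {\<delta>..T}"
    using z d by (intro at_within_nhd[of _ "UNIV \<times> {\<delta><..}"]) (auto simp: mem_Times_iff intro!: open_Times)
  moreover have "z \<in> UNIV \<times> {\<delta>..T}" using z d by (simp add: mem_Times_iff)
  then have "continuous (at z within UNIV \<times> {\<delta>..T}) g"
    using assms[OF d(1)] unfolding continuous_on_eq_continuous_within by blast
  ultimately show "continuous (at z within UNIV \<times> {0<..T}) g" by simp
qed

context relaxation_system
begin

text \<open>The resolvent may be singular at 0, so the fundamental theorem is applied to its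
  integral from \<delta> onwards.\<close>

lemma Y_deriv:
  assumes "0 < \<delta>" "t \<in> {\<delta>..T}"
  shows "(Y k has_vector_derivative - \<kappa> k * e k t) (at t within {\<delta>..T})"
proof -
  have c: "continuous_on {\<delta>..r} (e k)" for r
    using assms by (intro continuous_on_subset[OF e_cont]) auto
  have eq: "Y k r = Y k \<delta> - \<kappa> k * integral {\<delta>..r} (e k)" if "r \<in> {\<delta>..T}" for r
  proof (cases "r = \<delta>")
    case False
    then have "(LINT s:{0<..<r}|lborel. e k s) = (LINT s:{0<..<\<delta>}|lborel. e k s) + integral {\<delta>..r} (e k)"
      using that assms e_int[of r] by (subst set_integral_split[of 0 r _ \<delta>]) (auto simp: set_integral_eq_integral_Icc[OF c])
    then show ?thesis by (simp add: Y_def algebra_simps)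
  qed auto
  have "((\<lambda>r. Y k \<delta> - \<kappa> k * integral {\<delta>..r} (e k)) has_vector_derivative 0 - \<kappa> k * e k t) (at t within {\<delta>..T})"
    by (rule has_vector_derivative_diff[OF has_vector_derivative_const
        has_vector_derivative_mult_right[OF integral_has_vector_derivative[OF c assms(2)]]])
  from has_vector_derivative_transform[OF assms(2) eq this] show ?thesis by simp
qed

text \<open>Since f is only continuous and e may be singular, Y * f is not differentiated under the
  integral. Instead Y = 1 - \<kappa> (1 * e) and associativity turn it into the integral of a
  continuous function.\<close>

lemma conv_Y_eq_integral:
  assumes "t \<in> {0..T}"
  shows "conv (Y k) (f k) t = integral {0..t} (\<lambda>s. f k s - \<kappa> k *\<^sub>R conv (e k) (f k) s)"
proof -
  obtain B where B: "\<And>k t. norm (f k t) \<le> B k" using f_bound by blast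
  define c where "c = conv (\<lambda>_. 1) (e k)"
  \<comment> \<open>Convolution with a constant commutes. In the swapped form the continuous bounded
    factor is the constant and e is the integrable kernel, as \<open>continuous_on_conv\<close>
    needs.\<close>
  have c_eq: "c = conv (e k) (\<lambda>_. 1)" by (rule ext) (simp add: c_def conv_flip[of "e k"], simp add: conv_def)
  have "continuous_on {0..T} c"
    unfolding c_eq by (rule continuous_on_conv[OF e_int, of _ 1]) (auto intro: continuous_intros)
  then have ci: "set_integrable lborel {0<..<t} c"
    using assms by (intro set_integrable_subset[OF borel_integrable_atLeastAtMost'[of 0 T c]]) auto
  have Yc: "Y k s = 1 - \<kappa> k * c s" for s by (simp add: Y_def c_def conv_def)
  have i1: "set_integrable lborel {0<..<t} (\<lambda>s. 1 *\<^sub>R f k (t - s))"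
    by (rule set_integrable_bounded_scaleR[OF set_integrable_one _ B[of k]]) auto
  have i2: "set_integrable lborel {0<..<t} (\<lambda>s. c s *\<^sub>R f k (t - s))"
    by (rule set_integrable_bounded_scaleR[OF ci _ B[of k]]) auto
  have A: "conv (\<lambda>_. 1) (conv (e k) (f k)) t = conv c (f k) t"
    unfolding c_def using e_int e_nonneg ci
    by (intro conv_assoc(2)[OF _ _ f_meas _ _ _ _ B[of k]]) (auto simp: c_def)
  have "conv (Y k) (f k) t = (LINT s:{0<..<t}|lborel. 1 *\<^sub>R f k (t - s) - \<kappa> k *\<^sub>R (c s *\<^sub>R f k (t - s)))"
    unfolding conv_flip Yc by (simp add: scaleR_diff_left)
  also have "\<dots> = conv (\<lambda>_. 1) (f k) t - \<kappa> k *\<^sub>R conv c (f k) t"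
    unfolding conv_flip set_integral_scaleR_right[symmetric]
    using i1 i2 by (intro set_integral_diff(2)) (auto simp del: scaleR_scaleR)
  also have "conv (\<lambda>_. 1) (f k) t = integral {0..t} (f k)"
    by (simp add: conv_def set_integral_eq_integral_Icc continuous_on_subset[OF f_cont])
  also have "conv c (f k) t = integral {0..t} (conv (e k) (f k))"
    unfolding A[symmetric] using assms
    by (simp add: conv_def[of "\<lambda>_. 1"] set_integral_eq_integral_Icc continuous_on_subset[OF conv_cont(1)])
  also have "integral {0..t} (f k) - \<kappa> k *\<^sub>R integral {0..t} (conv (e k) (f k))
      = integral {0..t} (\<lambda>s. f k s - \<kappa> k *\<^sub>R conv (e k) (f k) s)"
    using assms by (subst integral_diff)
      (auto intro!: integrable_continuous_real continuous_intros continuous_on_subset[OF f_cont]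
        continuous_on_subset[OF conv_cont(1)])
  finally show ?thesis .
qed

text \<open>The datum contributes through Y' = -\<kappa> e, the forcing through the integral form of
  Y * f. As W is the fractional integral of u, this is the scalar fractional equation.\<close>

lemma W_deriv:
  assumes "0 < \<delta>" "t \<in> {\<delta>..T}"
  shows "(W k has_vector_derivative f k t - \<kappa> k *\<^sub>R u k t) (at t within {\<delta>..T})"
proof -
  let ?D = "\<lambda>s. f k s - \<kappa> k *\<^sub>R conv (e k) (f k) s"
  have "continuous_on {0..T} ?D"
    by (intro continuous_intros conv_cont continuous_on_subset[OF f_cont]) auto
  then have "((\<lambda>r. integral {0..r} ?D) has_vector_derivative ?D t) (at t within {0..T})"
    using assms by (intro integral_has_vector_derivative) auto
  then have "((\<lambda>r. integral {0..r} ?D) has_vector_derivative ?D t) (at t within {\<delta>..T})"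
    by (rule has_vector_derivative_within_subset) (use assms in auto)
  moreover have "((\<lambda>r. Y k r *\<^sub>R p k) has_vector_derivative (- \<kappa> k * e k t) *\<^sub>R p k) (at t within {\<delta>..T})"
    using has_vector_derivative_scaleR[OF Y_deriv[OF assms, unfolded has_real_derivative_iff_has_vector_derivative[symmetric]]
      has_vector_derivative_const[of "p k"]] by simp
  ultimately have "((\<lambda>r. Y k r *\<^sub>R p k + integral {0..r} ?D) has_vector_derivative (- \<kappa> k * e k t) *\<^sub>R p k + ?D t)
      (at t within {\<delta>..T})"
    by (intro has_vector_derivative_add)
  moreover have "(- \<kappa> k * e k t) *\<^sub>R p k + ?D t = f k t - \<kappa> k *\<^sub>R u k t"
    by (simp add: u_def scaleR_add_right)
  moreover have "W k r = Y k r *\<^sub>R p k + integral {0..r} ?D" if "r \<in> {\<delta>..T}" for r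
    using that assms by (simp add: W_def conv_Y_eq_integral)
  ultimately show ?thesis
    using assms by (intro has_vector_derivative_transform[of t "{\<delta>..T}" "W k"]) (simp_all only:)
qed

lemma W'_sum:
  assumes "0 < \<delta>"
  shows "unif_sum {\<delta>..T} (\<lambda>k t. norm (f k t - \<kappa> k *\<^sub>R u k t))"
proof -
  have "unif_sum {\<delta>..T} (\<lambda>k t. norm (f k t) + (1 + \<kappa> k) * norm (u k t))"
    using \<kappa> by (intro unif_sum_add unif_sum_mono[OF f_unif] u_sum assms) auto
  then show ?thesis
  proof (rule unif_sum_mono)
    fix k t
    have "norm (f k t - \<kappa> k *\<^sub>R u k t) \<le> norm (f k t) + \<kappa> k * norm (u k t)"
      using norm_triangle_ineq4[of "f k t" "\<kappa> k *\<^sub>R u k t"] \<kappa>[of k] by simp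
    also have "\<dots> \<le> norm (f k t) + (1 + \<kappa> k) * norm (u k t)" by (simp add: algebra_simps)
    finally show "norm (f k t - \<kappa> k *\<^sub>R u k t) \<le> norm (f k t) + (1 + \<kappa> k) * norm (u k t)" .
  qed auto
qed

lemma unif_sum_mult_bounded:
  assumes "unif_sum I (\<lambda>k t. norm (c k t))" and "\<And>k. norm (b k :: complex) \<le> 1"
  shows "unif_sum I (\<lambda>k t. norm (c k t * b k))"
  using assms by (intro unif_sum_mono[OF assms(1)]) (auto simp: norm_mult mult_left_le)

lemma W_series_deriv:
  assumes b: "\<And>k. norm (b k) \<le> 1" and t: "t \<in> {0<..T}"
  shows "((\<lambda>t. \<Sum>k. W k t * b k) has_vector_derivative (\<Sum>k. (f k t - \<kappa> k *\<^sub>R u k t) * b k))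
    (at t within {0<..T})"
proof -
  \<comment> \<open>The derivatives converge uniformly only away from 0; [t/2, T] and (0, T] look
    alike near t, including the one-sided case t = T.\<close>
  define \<delta> where "\<delta> = t / 2"
  have d: "0 < \<delta>" "\<delta> < t" "t \<in> {\<delta>..T}" using t by (auto simp: \<delta>_def)
  have "((\<lambda>t. \<Sum>k. W k t * b k) has_vector_derivative (\<Sum>k. (f k t - \<kappa> k *\<^sub>R u k t) * b k))
    (at t within {\<delta>..T})"
  proof (rule series_has_vector_derivative)
    show "((\<lambda>r. W k r * b k) has_vector_derivative (f k r - \<kappa> k *\<^sub>R u k r) * b k) (at r within {\<delta>..T})"
      if "r \<in> {\<delta>..T}" for k r
      by (rule has_vector_derivative_mult_left[OF W_deriv[OF d(1) that]])
    show "uniform_limit {\<delta>..T} (\<lambda>n r. \<Sum>k<n. (f k r - \<kappa> k *\<^sub>R u k r) * b k)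
        (\<lambda>r. \<Sum>k. (f k r - \<kappa> k *\<^sub>R u k r) * b k) sequentially"
      by (intro unif_sum_uniform_limit unif_sum_mult_bounded W'_sum d b)
    show "summable (\<lambda>k. W k r * b k)" if "r \<in> {\<delta>..T}" for r
      using that d by (intro summable_norm_cancel[OF unif_sum_summable[OF unif_sum_mult_bounded[OF W_sum b]]]) auto
  qed (use d in auto)
  moreover have "at t within {\<delta>..T} = at t within {0<..T}"
    using d by (intro at_within_nhd[of _ "{\<delta><..}"]) auto
  ultimately show ?thesis by simp
qed

lemma W_eq_u:
  assumes "\<rho> = 1" "0 < t"
  shows "W k t = u k t"
proof -
  have "e k = relaxation \<rho> (\<kappa> k)" using assms(1) by (simp add: resolvent_1_eq_relaxation)
  then show ?thesis by (simp only: W_def u_def Y_eq[OF assms(2)] conv_Y)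
qed

text \<open>Here b k stands for the exponential of mode k at a fixed x. Termwise integration reduces
  to summing the L1 norms of the terms, and these are controlled through
  \<open>u_majorant\<close>.\<close>

lemma u_series_abel:
  assumes b: "\<And>k. norm (b k) \<le> 1" and t: "t \<in> {0<..T}" and "\<rho> < 1"
  shows "set_integrable lborel {0<..<t} (\<lambda>s. abel_kernel (1 - \<rho>) (t - s) *\<^sub>R (\<Sum>k. u k s * b k))"
    and "conv (abel_kernel (1 - \<rho>)) (\<lambda>s. \<Sum>k. u k s * b k) t = (\<Sum>k. W k t * b k)"
proof -
  let ?a = "abel_kernel (1 - \<rho>)"
  let ?f = "\<lambda>k s. (?a (t - s) *\<^sub>R u k s) * b k"
  have a: "0 \<le> ?a s" for s using assms by (simp add: abel_kernel_nonneg)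
  have us: "summable (\<lambda>k. norm (u k s))" if "s \<in> {0<..T}" for s
  proof -
    have "unif_sum {s..T} (\<lambda>k t. norm (u k t))"
      using that \<kappa> by (intro unif_sum_mono[OF u_sum[of s]]) (auto simp: mult_le_cancel_right1 algebra_simps)
    then show ?thesis using that by (intro unif_sum_summable) auto
  qed
  have 1: "set_integrable lborel {0<..<t} (?f k)" for k
    using abel_conv_u(1)[OF \<open>\<rho> < 1\<close> t] by (rule set_integrable_mult_left)
  have 2: "summable (\<lambda>k. norm (?f k s))" if "s \<in> {0<..<t}" for s
  proof (rule summable_comparison_test')
    show "summable (\<lambda>k. ?a (t - s) * norm (u k s))"
      using us[of s] that t by (intro summable_mult) auto
    show "norm (norm (?f k s)) \<le> ?a (t - s) * norm (u k s)" for k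
      using b[of k] a[of "t - s"] by (simp add: norm_mult mult_left_le mult_left_mono)
  qed
  obtain C where C: "0 < C" "\<And>M t. t \<in> {0<..T} \<Longrightarrow> (\<Sum>k<M. norm (u k t)) \<le> C * abel_kernel \<rho> t"
    using u_majorant by blast
  \<comment> \<open>Nonnegative terms with bounded partial sums: each partial sum is at most C times
    the convolution of the kernels of orders 1 - \<rho> and \<rho>, a finite Beta integral.\<close>
  have 3: "summable (\<lambda>k. LINT s:{0<..<t}|lborel. norm (?f k s))"
  proof (rule bounded_imp_summable)
    show "0 \<le> (LINT s:{0<..<t}|lborel. norm (?f k s))" for k
      by (intro set_integral_nonneg) auto
    fix n
    have eq: "(\<lambda>s. \<Sum>k\<le>n. indicat_real {0<..<t} s *\<^sub>R norm (?f k s))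
      = (\<lambda>s. indicat_real {0<..<t} s *\<^sub>R (\<Sum>k\<le>n. norm (?f k s)))"
      by (simp add: scaleR_sum_right sum_distrib_left)
    have i: "integrable lborel (\<lambda>s. indicat_real {0<..<t} s *\<^sub>R norm (?f k s))" for k
      using set_integrable_norm[OF 1[of k]] by (simp add: set_integrable_def)
    have "(\<Sum>k\<le>n. LINT s:{0<..<t}|lborel. norm (?f k s)) = (LINT s:{0<..<t}|lborel. \<Sum>k\<le>n. norm (?f k s))"
      unfolding set_lebesgue_integral_def eq[symmetric]
      by (rule Bochner_Integration.integral_sum[symmetric]) (rule i)
    also have "\<dots> \<le> (LINT s:{0<..<t}|lborel. C * (?a (t - s) * abel_kernel \<rho> s))"
    proof (rule set_integral_mono)
      show "set_integrable lborel {0<..<t} (\<lambda>s. \<Sum>k\<le>n. norm (?f k s))"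
        unfolding set_integrable_def eq[symmetric] by (intro Bochner_Integration.integrable_sum i)
      show "set_integrable lborel {0<..<t} (\<lambda>s. C * (?a (t - s) * abel_kernel \<rho> s))"
        using abel_kernel_Beta(1)[of "1 - \<rho>" \<rho> t] \<rho> assms by simp
      fix s assume s: "s \<in> {0<..<t}"
      have "(\<Sum>k\<le>n. norm (?f k s)) \<le> (\<Sum>k\<le>n. ?a (t - s) * norm (u k s))"
        using b a by (intro sum_mono) (simp add: norm_mult mult_left_le mult_left_mono)
      also have "\<dots> = ?a (t - s) * (\<Sum>k<Suc n. norm (u k s))"
        by (simp add: sum_distrib_left lessThan_Suc_atMost)
      also have "\<dots> \<le> ?a (t - s) * (C * abel_kernel \<rho> s)"
        using s t a by (intro mult_left_mono C(2)) auto
      finally show "(\<Sum>k\<le>n. norm (?f k s)) \<le> C * (?a (t - s) * abel_kernel \<rho> s)"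
        by (simp add: mult_ac)
    qed
    finally show "(\<Sum>k\<le>n. LINT s:{0<..<t}|lborel. norm (?f k s))
        \<le> (LINT s:{0<..<t}|lborel. C * (?a (t - s) * abel_kernel \<rho> s))" .
  qed
  have eq: "(\<Sum>k. ?f k s) = ?a (t - s) *\<^sub>R (\<Sum>k. u k s * b k)" if s: "s \<in> {0<..<t}" for s
  proof -
    have "summable (\<lambda>k. norm (u k s * b k))"
      by (rule summable_comparison_test'[OF us[of s]]) (use s t b in \<open>auto simp: norm_mult mult_left_le\<close>)
    from suminf_scaleR_right[OF summable_norm_cancel[OF this]]
    show ?thesis by (simp add: scaleR_conv_of_real mult.assoc)
  qed
  note * = set_integral_series[of lborel "{0<..<t}" ?f, OF 1 2 3]
  have "set_integrable lborel {0<..<t} (\<lambda>s. \<Sum>k. ?f k s) \<longleftrightarrow>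
      set_integrable lborel {0<..<t} (\<lambda>s. ?a (t - s) *\<^sub>R (\<Sum>k. u k s * b k))"
    by (intro set_integrable_cong refl eq)
  then show "set_integrable lborel {0<..<t} (\<lambda>s. ?a (t - s) *\<^sub>R (\<Sum>k. u k s * b k))"
    using *(1) by simp
  have "(LINT s:{0<..<t}|lborel. ?f k s) = W k t * b k" for k
    using abel_conv_u(2)[OF \<open>\<rho> < 1\<close> t, of k] by (simp only: set_integral_mult_left conv_def)
  moreover have "(LINT s:{0<..<t}|lborel. (\<Sum>k. ?f k s)) = conv ?a (\<lambda>s. \<Sum>k. u k s * b k) t"
    unfolding conv_def by (intro set_lebesgue_integral_cong) (simp, use eq in blast)
  ultimately have "(\<lambda>k. W k t * b k) sums conv ?a (\<lambda>s. \<Sum>k. u k s * b k) t"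
    using *(2) by simp
  then show "conv ?a (\<lambda>s. \<Sum>k. u k s * b k) t = (\<Sum>k. W k t * b k)"
    by (simp add: sums_iff)
qed

end

section \<open>Fourier coefficients on the torus\<close>

lemma torus_borel [measurable]: "torus \<in> sets borel"
proof -
  have "torus = (\<Inter>j. {x. - pi < x $ j \<and> x $ j \<le> pi})" by (auto simp: torus_def)
  also have "\<dots> \<in> sets borel" by (intro sets.finite_INT) auto
  finally show ?thesis .
qed

lemma torus_subset_cbox: "torus \<subseteq> cbox (\<chi> j. - pi) (\<chi> j. pi)"
  by (auto simp: torus_def mem_box_cart less_imp_le)

lemma box_subset_torus: "box (\<chi> j. - pi) (\<chi> j. pi) \<subseteq> torus"
  by (auto simp: torus_def mem_box_cart less_imp_le)

lemma torus_lmeasurable: "(torus :: (real^'n) set) \<in> lmeasurable"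
proof -
  have "bounded (torus :: (real^'n) set)" using torus_subset_cbox bounded_cbox bounded_subset by blast
  then show ?thesis
    using torus_borel by (intro bounded_set_imp_lmeasurable) (auto simp: sets_completionI_sets)
qed

lemma torus_lebesgue: "(torus :: (real^'n) set) \<in> sets lebesgue"
  using torus_lmeasurable by (simp add: fmeasurable_def)

lemma finite_measure_torus: "finite_measure (lebesgue_on (torus :: (real^'n) set))"
  using torus_lmeasurable by (rule finite_measure_lebesgue_on)

text \<open>The measure \<open>lborel\<close> on vectors is the image of the product measure indexed
  by \<open>Basis\<close>, which is reindexed by the coordinates; the product rule then
  applies.\<close>

lemma lborel_integral_prod_vec:
  fixes h :: "'n::finite \<Rightarrow> real \<Rightarrow> complex"
  assumes h: "\<And>j. integrable lborel (h j)"
  shows "(LINT x|lborel. (\<Prod>j\<in>UNIV. h j (x $ j))) = (\<Prod>j\<in>UNIV. LINT s|lborel. h j s)"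
proof -
  interpret product_sigma_finite "\<lambda>_ :: real^'n. lborel :: real measure" by standard
  have [measurable]: "h j \<in> borel_measurable borel" for j using h[of j] by auto
  have basis: "(Basis :: (real^'n) set) = range (\<lambda>j. axis j 1)"
    by (auto simp: Basis_vec_def)
  have inj: "inj (\<lambda>j. axis j 1 :: real^'n)"
    by (auto simp: inj_on_def axis_eq_axis)
  have nth: "(\<Sum>b\<in>(Basis::(real^'n) set). f b *\<^sub>R b) $ j = f (axis j 1)" for f :: "real^'n \<Rightarrow> real" and j
    unfolding basis using inj
    by (simp add: sum.reindex axis_def sum.delta if_distrib cong: if_cong)
  have "(LINT x|lborel. (\<Prod>j\<in>UNIV. h j ((x :: real^'n) $ j)))
      = (LINT f|(\<Pi>\<^sub>M b\<in>(Basis :: (real^'n) set). lborel).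
          (\<Prod>j\<in>UNIV. h j ((\<Sum>b\<in>(Basis::(real^'n) set). f b *\<^sub>R b) $ j)))"
    by (subst lborel_eq, subst integral_distr) measurable
  also have "\<dots> = (LINT f|(\<Pi>\<^sub>M b\<in>(Basis :: (real^'n) set). lborel). (\<Prod>b\<in>Basis. h (axis_index b) (f b)))"
    unfolding nth unfolding basis using inj by (simp add: prod.reindex axis_index_axis)
  also have "\<dots> = (\<Prod>b\<in>(Basis :: (real^'n) set). LINT s|lborel. h (axis_index b) s)"
    using h by (intro product_integral_prod) auto
  also have "\<dots> = (\<Prod>j\<in>UNIV. LINT s|lborel. h j s)"
    unfolding basis using inj by (simp add: prod.reindex axis_index_axis)
  finally show ?thesis .
qed

lemma cis_sum: "finite S \<Longrightarrow> cis (\<Sum>j\<in>S. g j) = (\<Prod>j\<in>S. cis (g j))"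
  by (induction rule: finite_induct) (auto simp: cis_mult[symmetric])

lemma expi_eq_prod: "expi n x = (\<Prod>j\<in>UNIV. cis (real_of_int (n $ j) * x $ j))"
  by (simp add: expi_def inner_vec_def lattice_vec_def cis_sum)

lemma norm_expi [simp]: "norm (expi n x) = 1"
  by (simp add: expi_def)

lemma lattice_vec_add: "lattice_vec (n + k) = lattice_vec n + lattice_vec k"
  by (simp add: lattice_vec_def vec_eq_iff)

lemma lattice_vec_minus: "lattice_vec (- n) = - lattice_vec n"
  by (simp add: lattice_vec_def vec_eq_iff)

lemma lattice_vec_0 [simp]: "lattice_vec 0 = 0"
  by (simp add: lattice_vec_def vec_eq_iff)

lemma expi_0 [simp]: "expi 0 x = 1"
  by (simp add: expi_def)

lemma expi_mult: "expi n x * expi k x = expi (n + k) x"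
  by (simp add: expi_def cis_mult lattice_vec_add inner_add_left)

lemma cnj_expi: "cnj (expi n x) = expi (- n) x"
  by (simp add: expi_def cis_cnj lattice_vec_minus)

lemma continuous_on_expi [continuous_intros]: "continuous_on S (expi n)"
  unfolding expi_def cis_conv_exp by (intro continuous_intros)

lemma cis_integral_period:
  "(LINT s|lborel. indicat_real {- pi<..pi} s *\<^sub>R cis (real_of_int k * s)) = (if k = 0 then of_real (2 * pi) else 0)"
proof -
  have cont: "continuous_on {- pi..pi} (\<lambda>s. cis (real_of_int k * s))"
    unfolding cis_conv_exp by (intro continuous_intros)
  have i: "set_integrable lborel {- pi<..pi} (\<lambda>s. cis (real_of_int k * s))"
    by (rule set_integrable_subset[OF borel_integrable_atLeastAtMost'[OF cont]]) auto
  have "(LINT s|lborel. indicat_real {- pi<..pi} s *\<^sub>R cis (real_of_int k * s))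
      = integral {- pi<..pi} (\<lambda>s. cis (real_of_int k * s))"
    using set_borel_integral_eq_integral(2)[OF i] by (simp add: set_lebesgue_integral_def)
  also have "\<dots> = integral {- pi..pi} (\<lambda>s. cis (real_of_int k * s))"
    by (rule integral_subset_negligible) (auto intro: negligible_subset[OF negligible_sing[of "-pi"]])
  also have "\<dots> = (if k = 0 then of_real (2 * pi) else 0)"
  proof (cases "k = 0")
    case True
    then show ?thesis by (simp add: scaleR_conv_of_real)
  next
    case False
    define c where "c = \<i> * of_real (real_of_int k)"
    have c: "c \<noteq> 0" using False by (simp add: c_def)
    have "((\<lambda>s. cis (real_of_int k * s)) has_integral
        cis (real_of_int k * pi) / c - cis (real_of_int k * (- pi)) / c) {- pi..pi}"
    proof (rule fundamental_theorem_of_calculus)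
      fix s
      have "((\<lambda>z. exp (c * z) / c) has_field_derivative exp (c * of_real s)) (at (of_real s))"
        using c by (auto intro!: derivative_eq_intros)
      from has_vector_derivative_real_field[OF this]
      have "((\<lambda>s. exp (c * of_real s) / c) has_vector_derivative exp (c * of_real s)) (at s within {- pi..pi})" .
      then show "((\<lambda>s. cis (real_of_int k * s) / c) has_vector_derivative cis (real_of_int k * s)) (at s within {- pi..pi})"
        by (simp add: cis_conv_exp c_def mult.assoc)
    qed simp
    moreover have "cis (real_of_int k * (- pi)) = cis (real_of_int k * pi)"
    proof -
      have "sin (real_of_int k * pi) = 0" using sin_integer_2pi sin_times_pi_eq_0 by auto
      then show ?thesis by (simp add: complex_eq_iff)
    qed
    ultimately show ?thesis using False by (simp add: integral_unique)
  qed
  finally show ?thesis .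
qed

lemma torus_integral_lborel:
  fixes g :: "real^'n \<Rightarrow> 'a::{banach, second_countable_topology}"
  assumes "g \<in> borel_measurable borel"
  shows "(LINT x|lebesgue_on torus. g x) = (LINT x|lborel. indicat_real torus x *\<^sub>R g x)"
proof -
  have "(LINT x|lebesgue_on torus. g x) = (LINT x|lebesgue. indicat_real torus x *\<^sub>R g x)"
    using torus_lebesgue by (intro integral_restrict_space) auto
  also have "\<dots> = (LINT x|lborel. indicat_real torus x *\<^sub>R g x)"
    using assms by (intro integral_completion) measurable
  finally show ?thesis .
qed

lemma expi_integral:
  "(LINT x|lebesgue_on torus. expi (n :: int^'n) x) = (if n = 0 then of_real ((2 * pi) ^ CARD('n)) else 0)"
proof -
  have meas: "expi n \<in> borel_measurable borel"
    by (intro borel_measurable_continuous_onI continuous_intros)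
  have eq: "indicat_real torus x *\<^sub>R expi n x
      = (\<Prod>j\<in>UNIV. indicat_real {- pi<..pi} (x $ j) *\<^sub>R cis (real_of_int (n $ j) * x $ j))" for x :: "real^'n"
  proof (cases "x \<in> torus")
    case True
    then show ?thesis by (simp add: expi_eq_prod torus_def)
  next
    case False
    then obtain j where "x $ j \<notin> {- pi<..pi}" by (auto simp: torus_def)
    then have "(\<Prod>j\<in>UNIV. indicat_real {- pi<..pi} (x $ j) *\<^sub>R cis (real_of_int (n $ j) * x $ j)) = 0"
      by (intro prod_zero bexI[of _ j]) auto
    then show ?thesis using False by simp
  qed
  have int: "integrable lborel (\<lambda>s. indicat_real {- pi<..pi} s *\<^sub>R cis (real_of_int k * s))" for k
  proof -
    have "set_integrable lborel {- pi<..pi} (\<lambda>s. cis (real_of_int k * s))"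
      unfolding cis_conv_exp
      by (rule set_integrable_subset[OF borel_integrable_atLeastAtMost'[of "-pi" pi]])
        (auto intro!: continuous_intros)
    then show ?thesis by (simp add: set_integrable_def)
  qed
  have "(LINT x|lebesgue_on torus. expi n x)
      = (\<Prod>j\<in>UNIV. LINT s|lborel. indicat_real {- pi<..pi} s *\<^sub>R cis (real_of_int (n $ j) * s))"
    unfolding torus_integral_lborel[OF meas] eq by (rule lborel_integral_prod_vec[OF int])
  also have "\<dots> = (\<Prod>j\<in>UNIV. if n $ j = 0 then of_real (2 * pi) else 0)"
    by (simp only: cis_integral_period)
  also have "\<dots> = (if n = 0 then of_real ((2 * pi) ^ CARD('n)) else 0)"
  proof (cases "n = 0")
    case False
    then obtain j where "n $ j \<noteq> 0" by (auto simp: vec_eq_iff)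
    then have "(\<Prod>j\<in>UNIV. if n $ j = 0 then of_real (2 * pi) else (0::complex)) = 0"
      by (intro prod_zero bexI[of _ j]) auto
    then show ?thesis using False by simp
  qed simp
  finally show ?thesis .
qed

abbreviation torus_measure :: "(real^'n) measure" where
  "torus_measure \<equiv> lebesgue_on torus"

lemma continuous_torus_measurable:
  assumes "continuous_on UNIV g"
  shows "g \<in> borel_measurable torus_measure"
  using borel_measurable_continuous_onI[OF assms] by (intro measurable_restrict_space1 measurable_completion) simp

lemma bounded_torus_integrable:
  fixes g :: "real^'n \<Rightarrow> 'a::{banach, second_countable_topology}"
  assumes "g \<in> borel_measurable torus_measure" "\<And>x. x \<in> torus \<Longrightarrow> norm (g x) \<le> B"
  shows "integrable torus_measure g"
proof -
  interpret finite_measure "torus_measure :: (real^'n) measure" by (rule finite_measure_torus)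
  show ?thesis by (rule integrable_const_bound[of _ B]) (use assms in auto)
qed

lemma continuous_torus_bounded:
  fixes g :: "real^'n \<Rightarrow> 'a::real_normed_vector"
  assumes "continuous_on UNIV g"
  obtains B where "\<And>x. x \<in> cbox (\<chi> j. - pi) (\<chi> j. pi) \<Longrightarrow> norm (g x) \<le> B"
proof -
  have "compact (g ` cbox (\<chi> j. - pi) (\<chi> j. pi))"
    by (intro compact_continuous_image continuous_on_subset[OF assms]) auto
  then show ?thesis using that compact_imp_bounded bounded_iff by (metis imageI)
qed

lemma continuous_torus_integrable:
  fixes g :: "real^'n \<Rightarrow> 'a::{banach, second_countable_topology}"
  assumes "continuous_on UNIV g"
  shows "integrable torus_measure g"
  using continuous_torus_bounded[OF assms] torus_subset_cbox
  by (metis bounded_torus_integrable[OF continuous_torus_measurable[OF assms]] subsetD)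

lemma L2_continuous: "continuous_on UNIV g \<Longrightarrow> g \<in> L2"
  unfolding L2_def
  by (auto intro!: continuous_torus_measurable continuous_torus_integrable continuous_intros)

lemma L2_integrable:
  assumes "g \<in> L2"
  shows "integrable torus_measure g"
proof (rule Bochner_Integration.integrable_bound)
  interpret finite_measure "torus_measure :: (real^'n) measure" by (rule finite_measure_torus)
  show "integrable torus_measure (\<lambda>x. 1 + (cmod (g x))\<^sup>2)"
    using assms by (auto simp: L2_def)
  have "norm (g x) \<le> norm (1 + (cmod (g x))\<^sup>2)" for x
  proof -
    have "0 \<le> (cmod (g x) - 1)\<^sup>2" by simp
    then have "2 * cmod (g x) \<le> 1 + (cmod (g x))\<^sup>2" by (simp add: power2_eq_square algebra_simps)
    then have "cmod (g x) \<le> 1 + (cmod (g x))\<^sup>2" using norm_ge_zero[of "g x"] by linarith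
    then show ?thesis by simp
  qed
  then show "AE x in torus_measure. norm (g x) \<le> norm (1 + (cmod (g x))\<^sup>2)" by simp
qed (use assms in \<open>auto simp: L2_def\<close>)

lemma integrable_mult_expi:
  assumes "integrable torus_measure g"
  shows "integrable torus_measure (\<lambda>x. g x * expi n x)"
proof (rule Bochner_Integration.integrable_bound[OF assms])
  have [measurable]: "expi n \<in> borel_measurable torus_measure"
    by (intro continuous_torus_measurable continuous_intros)
  show "(\<lambda>x. g x * expi n x) \<in> borel_measurable torus_measure"
    using assms by measurable
qed (simp add: norm_mult)

lemma L2_diff:
  assumes "g \<in> L2" "h \<in> L2"
  shows "(\<lambda>x. g x - h x) \<in> L2"
proof -
  have [measurable]: "g \<in> borel_measurable torus_measure" "h \<in> borel_measurable torus_measure"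
    using assms by (auto simp: L2_def)
  have "integrable torus_measure (\<lambda>x. (cmod (g x - h x))\<^sup>2)"
  proof (rule Bochner_Integration.integrable_bound)
    show "integrable torus_measure (\<lambda>x. 2 * (cmod (g x))\<^sup>2 + 2 * (cmod (h x))\<^sup>2)"
      using assms by (auto simp: L2_def)
    have "(cmod (g x - h x))\<^sup>2 \<le> 2 * (cmod (g x))\<^sup>2 + 2 * (cmod (h x))\<^sup>2" for x
    proof -
      have "(cmod (g x - h x))\<^sup>2 \<le> (cmod (g x) + cmod (h x))\<^sup>2"
        by (intro power_mono norm_triangle_ineq4) auto
      also have "\<dots> \<le> 2 * (cmod (g x))\<^sup>2 + 2 * (cmod (h x))\<^sup>2"
        using zero_le_power2[of "cmod (g x) - cmod (h x)"] by (simp add: power2_eq_square algebra_simps)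
      finally show ?thesis .
    qed
    then show "AE x in torus_measure. norm ((cmod (g x - h x))\<^sup>2) \<le> norm (2 * (cmod (g x))\<^sup>2 + 2 * (cmod (h x))\<^sup>2)"
      by simp
  qed measurable
  then show ?thesis by (simp add: L2_def)
qed

lemma fourier_coeff_diff:
  assumes "integrable torus_measure g" "integrable torus_measure h"
  shows "fourier_coeff (\<lambda>x. g x - h x) n = fourier_coeff g n - fourier_coeff h n"
  using integrable_mult_expi[OF assms(1), of "- n"] integrable_mult_expi[OF assms(2), of "- n"]
  by (simp add: fourier_coeff_def left_diff_distrib diff_divide_distrib)

lemma fourier_coeff_trig_sum:
  fixes d :: "int^'n \<Rightarrow> complex"
  assumes "finite S"
  shows "fourier_coeff (\<lambda>x. \<Sum>k\<in>S. d k * expi k x) n = (if n \<in> S then d n else 0)"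
proof -
  have "(LINT x|torus_measure. (\<Sum>k\<in>S. d k * expi k x) * expi (- n) x)
      = (LINT x|torus_measure. (\<Sum>k\<in>S. d k * expi (k - n) x))"
    by (simp add: sum_distrib_right mult.assoc expi_mult)
  also have "\<dots> = (\<Sum>k\<in>S. LINT x|torus_measure. d k * expi (k - n) x)"
    by (intro Bochner_Integration.integral_sum continuous_torus_integrable continuous_intros)
  also have "\<dots> = (\<Sum>k\<in>S. if k = n then d k * of_real ((2 * pi) ^ CARD('n)) else 0)"
    by (intro sum.cong refl) (simp add: expi_integral)
  also have "\<dots> = (if n \<in> S then d n * of_real ((2 * pi) ^ CARD('n)) else 0)"
    using assms by (simp add: sum.delta')
  finally show ?thesis by (simp add: fourier_coeff_def)
qed

text \<open>Expand the squared norm of h - P for the Fourier partial sum P: the cross pairing and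
  the squared norm of P both equal V \<Sigma>. The factor V is there because the coefficients are
  normalised by the torus volume while \<open>L2_norm\<close> is not.\<close>

lemma bessel:
  fixes h :: "real^'n \<Rightarrow> complex"
  assumes h: "h \<in> L2" and S: "finite S"
  shows "(2 * pi) ^ CARD('n) * (\<Sum>n\<in>S. (cmod (fourier_coeff h n))\<^sup>2) \<le> (L2_norm h)\<^sup>2"
proof -
  define c where "c = fourier_coeff h"
  define V where "V = (2 * pi) ^ CARD('n)"
  define P where "P = (\<lambda>x. \<Sum>k\<in>S. c k * expi k x)"
  have V: "0 < V" by (simp add: V_def)
  have hi: "integrable torus_measure h" by (rule L2_integrable[OF h])
  have Pc: "continuous_on UNIV P" unfolding P_def by (intro continuous_intros)
  have cnjP: "cnj (P x) = (\<Sum>k\<in>S. cnj (c k) * expi (- k) x)" for x by (simp add: P_def cnj_expi)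
  have coeff: "(LINT x|torus_measure. g x * expi (- k) x) = V * fourier_coeff g k" for g :: "real^'n \<Rightarrow> complex" and k
    by (simp add: fourier_coeff_def V_def)
  have pair: "integrable torus_measure (\<lambda>x. g x * cnj (P x))"
    "(LINT x|torus_measure. g x * cnj (P x)) = V * (\<Sum>k\<in>S. fourier_coeff g k * cnj (c k))"
    if g: "integrable torus_measure g" for g :: "real^'n \<Rightarrow> complex"
  proof -
    have eq: "g x * cnj (P x) = (\<Sum>k\<in>S. cnj (c k) * (g x * expi (- k) x))" for x
      by (simp add: cnjP sum_distrib_left mult_ac)
    show "integrable torus_measure (\<lambda>x. g x * cnj (P x))"
      unfolding eq using integrable_mult_expi[OF g] by (intro Bochner_Integration.integrable_sum) simp
    have "(LINT x|torus_measure. g x * cnj (P x)) = (\<Sum>k\<in>S. LINT x|torus_measure. cnj (c k) * (g x * expi (- k) x))"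
      unfolding eq using integrable_mult_expi[OF g] by (intro Bochner_Integration.integral_sum) simp
    also have "\<dots> = (\<Sum>k\<in>S. cnj (c k) * (V * fourier_coeff g k))"
      by (simp only: integral_mult_right_zero coeff)
    also have "\<dots> = V * (\<Sum>k\<in>S. fourier_coeff g k * cnj (c k))"
      by (simp add: sum_distrib_left mult_ac)
    finally show "(LINT x|torus_measure. g x * cnj (P x)) = V * (\<Sum>k\<in>S. fourier_coeff g k * cnj (c k))" .
  qed
  have cc: "z * cnj z = of_real ((cmod z)\<^sup>2)" for z by (rule complex_norm_square[symmetric])
  define \<Sigma> where "\<Sigma> = (\<Sum>k\<in>S. (cmod (c k))\<^sup>2)"
  have hP: "(LINT x|torus_measure. h x * cnj (P x)) = of_real (V * \<Sigma>)"
    unfolding pair(2)[OF hi] by (simp add: c_def[symmetric] cc \<Sigma>_def)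
  have PP: "(LINT x|torus_measure. P x * cnj (P x)) = of_real (V * \<Sigma>)"
  proof -
    have "fourier_coeff P k = c k" if "k \<in> S" for k
      unfolding P_def using fourier_coeff_trig_sum[OF S, of c k] that by simp
    then have "(\<Sum>k\<in>S. fourier_coeff P k * cnj (c k)) = of_real \<Sigma>"
      by (simp add: cc \<Sigma>_def)
    then show ?thesis using pair(2)[OF continuous_torus_integrable[OF Pc]] by simp
  qed
  have i1: "integrable torus_measure (\<lambda>x. (cmod (h x))\<^sup>2)" using h by (simp add: L2_def)
  have i2: "integrable torus_measure (\<lambda>x. Re (h x * cnj (P x)))" using pair(1)[OF hi] by (rule integrable_Re)
  have i3: "integrable torus_measure (\<lambda>x. Re (P x * cnj (P x)))"
    using pair(1)[OF continuous_torus_integrable[OF Pc]] by (rule integrable_Re)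
  have lin: "(LINT x|torus_measure. A x - 2 * B x + C x) =
      (LINT x|torus_measure. A x) - 2 * (LINT x|torus_measure. B x) + (LINT x|torus_measure. C x)"
    if "integrable torus_measure A" "integrable torus_measure B" "integrable torus_measure C"
    for A B C :: "real^'n \<Rightarrow> real"
    using that by simp
  have "0 \<le> (LINT x|torus_measure. (cmod (h x - P x))\<^sup>2)"
    by (intro integral_nonneg_AE) simp
  also have "(\<lambda>x. (cmod (h x - P x))\<^sup>2) = (\<lambda>x. (cmod (h x))\<^sup>2 - 2 * Re (h x * cnj (P x)) + Re (P x * cnj (P x)))"
    by (rule ext, simp add: cmod_power2) (simp add: power2_eq_square algebra_simps)
  also have "(LINT x|torus_measure. (cmod (h x))\<^sup>2 - 2 * Re (h x * cnj (P x)) + Re (P x * cnj (P x)))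
      = (LINT x|torus_measure. (cmod (h x))\<^sup>2) - 2 * (LINT x|torus_measure. Re (h x * cnj (P x)))
        + (LINT x|torus_measure. Re (P x * cnj (P x)))"
    by (rule lin[OF i1 i2 i3])
  also have "(LINT x|torus_measure. Re (h x * cnj (P x))) = V * \<Sigma>"
    using integral_Re[OF pair(1)[OF hi]] hP by simp
  also have "(LINT x|torus_measure. Re (P x * cnj (P x))) = V * \<Sigma>"
    using integral_Re[OF pair(1)[OF continuous_torus_integrable[OF Pc]]] PP by simp
  finally have "V * \<Sigma> \<le> (LINT x|torus_measure. (cmod (h x))\<^sup>2)" by simp
  moreover have "(L2_norm h)\<^sup>2 = (LINT x|torus_measure. (cmod (h x))\<^sup>2)"
    by (simp add: L2_norm_def integral_nonneg_AE)
  ultimately show ?thesis by (simp add: V_def \<Sigma>_def c_def)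
qed

text \<open>The image h is given only as an L2 limit. Bessel at the single index n bounds the n-th
  coefficient of the remainder by its norm; once S contains n that coefficient no longer depends on
  S, while the norm tends to 0.\<close>

lemma fourier_coeff_A_power:
  fixes g h :: "real^'n \<Rightarrow> complex"
  assumes "A_power a m \<sigma> g h"
  shows "fourier_coeff h n = symbZ a m n powr of_real \<sigma> * fourier_coeff g n"
proof -
  define d where "d = (\<lambda>n. symbZ a m n powr of_real \<sigma> * fourier_coeff g n)"
  define R where "R = (\<lambda>S x. (\<Sum>n\<in>S. d n * expi n x) - h x)"
  have h: "h \<in> L2" and lim: "((\<lambda>S. L2_norm (R S)) \<longlongrightarrow> 0) (finite_subsets_at_top UNIV)"
    using assms by (auto simp: A_power_def d_def R_def[abs_def])
  have bound: "(2 * pi) ^ CARD('n) * (cmod (d n - fourier_coeff h n))\<^sup>2 \<le> (L2_norm (R S))\<^sup>2"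
    if S: "finite S" "n \<in> S" for S
  proof -
    have c: "continuous_on UNIV (\<lambda>x. \<Sum>n\<in>S. d n * expi n x)" by (intro continuous_intros)
    then have "R S \<in> L2" unfolding R_def by (intro L2_diff L2_continuous h)
    from bessel[OF this, of "{n}"] have
      "(2 * pi) ^ CARD('n) * (cmod (fourier_coeff (R S) n))\<^sup>2 \<le> (L2_norm (R S))\<^sup>2" by simp
    also have "fourier_coeff (R S) n = d n - fourier_coeff h n"
      unfolding R_def using S
      by (subst fourier_coeff_diff[OF continuous_torus_integrable[OF c] L2_integrable[OF h]])
        (simp add: fourier_coeff_trig_sum)
    finally show ?thesis .
  qed
  have "eventually (\<lambda>S. finite S \<and> {n} \<subseteq> S) (finite_subsets_at_top UNIV)"
    by (rule eventually_finite_subsets_at_top_weakI[THEN eventually_conj]) (auto simp: eventually_finite_subsets_at_top)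
  then have ev: "eventually (\<lambda>S. (2 * pi) ^ CARD('n) * (cmod (d n - fourier_coeff h n))\<^sup>2 \<le> (L2_norm (R S))\<^sup>2)
      (finite_subsets_at_top UNIV)"
    by eventually_elim (use bound in auto)
  have "(2 * pi) ^ CARD('n) * (cmod (d n - fourier_coeff h n))\<^sup>2 \<le> 0"
  proof (rule tendsto_lowerbound[OF _ ev])
    show "((\<lambda>S. (L2_norm (R S))\<^sup>2) \<longlongrightarrow> 0) (finite_subsets_at_top UNIV)"
      using tendsto_power[OF lim, of 2] by simp
  qed simp
  moreover have "0 < (2 * pi) ^ CARD('n)" by simp
  ultimately have "(cmod (d n - fourier_coeff h n))\<^sup>2 \<le> 0"
    by (meson mult_pos_pos not_le)
  then show ?thesis by (simp add: d_def)
qed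

section \<open>Uniqueness and inversion of Fourier series\<close>

lemma periodic_lattice_shift:
  fixes g :: "real^'n \<Rightarrow> complex"
  assumes g: "periodic g"
  shows "g (x + (2 * pi) *\<^sub>R lattice_vec k) = g x"
proof -
  have step: "g (y + (2 * pi) *\<^sub>R axis j 1) = g y" for y j
    using g by (simp add: periodic_def)
  have one: "g (y + (of_int i * (2 * pi)) *\<^sub>R axis j 1) = g y" for y j and i :: int
  proof (induction i arbitrary: y rule: int_induct[where k = 0])
    case (step1 i)
    have "y + (of_int (i + 1) * (2 * pi)) *\<^sub>R axis j 1
        = y + (2 * pi) *\<^sub>R axis j 1 + (of_int i * (2 * pi)) *\<^sub>R axis j 1"
      by (simp add: algebra_simps)
    then show ?case using step1(2)[of "y + (2 * pi) *\<^sub>R axis j 1"] step[of y j] by (simp only:)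
  next
    case (step2 i)
    define z where "z = y + (of_int (i - 1) * (2 * pi)) *\<^sub>R axis j 1"
    have "z + (2 * pi) *\<^sub>R axis j 1 = y + (of_int i * (2 * pi)) *\<^sub>R axis j 1"
      by (simp add: z_def algebra_simps)
    then have "g z = g (y + (of_int i * (2 * pi)) *\<^sub>R axis j 1)" using step[of z j] by simp
    then show ?case using step2(2)[of y] by (simp add: z_def)
  qed simp
  have A: "g (y + (\<Sum>j\<in>J. (of_int (k $ j) * (2 * pi)) *\<^sub>R axis j 1)) = g y" if "finite J" for J y
    using that
  proof (induction J arbitrary: y)
    case (insert j J)
    then show ?case
      using insert.IH[of "y + (of_int (k $ j) * (2 * pi)) *\<^sub>R axis j 1"] one by (simp add: add.assoc)
  qed simp
  have B: "(\<Sum>j\<in>UNIV. (of_int (k $ j) * (2 * pi)) *\<^sub>R axis j 1) = (2 * pi) *\<^sub>R lattice_vec k"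
    by (simp add: vec_eq_iff lattice_vec_def axis_def if_distrib cong: if_cong)
  show ?thesis using A[of UNIV x] by (simp only: B finite)
qed

lemma lattice_reduction:
  fixes x :: "real^'n"
  obtains k :: "int^'n" where "x + (2 * pi) *\<^sub>R lattice_vec k \<in> cbox (\<chi> j. - pi) (\<chi> j. pi)"
proof
  define k :: "int^'n" where "k = (\<chi> j. - \<lfloor>(x $ j + pi) / (2 * pi)\<rfloor>)"
  have "- pi \<le> x $ j + 2 * pi * of_int (k $ j) \<and> x $ j + 2 * pi * of_int (k $ j) \<le> pi" for j
  proof -
    define f where "f = \<lfloor>(x $ j + pi) / (2 * pi)\<rfloor>"
    have "of_int f \<le> (x $ j + pi) / (2 * pi)" "(x $ j + pi) / (2 * pi) < of_int f + 1"
      unfolding f_def by linarith+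
    then have "of_int f * (2 * pi) \<le> x $ j + pi" "x $ j + pi < (of_int f + 1) * (2 * pi)"
      by (simp_all add: pos_le_divide_eq pos_divide_less_eq)
    moreover have "k $ j = - f" by (simp add: k_def f_def)
    ultimately show ?thesis by (simp add: algebra_simps)
  qed
  then show "x + (2 * pi) *\<^sub>R lattice_vec k \<in> cbox (\<chi> j. - pi) (\<chi> j. pi)"
    by (simp add: mem_box_cart lattice_vec_def)
qed

text \<open>A continuous map from a compact set to a Hausdorff space is closed, hence a quotient map
  onto its image. Thus H is continuous there even when it is written with a discontinuous inverse of
  q, as happens with \<open>Arg\<close> below.\<close>

lemma continuous_on_factor:
  fixes q :: "'a::topological_space \<Rightarrow> 'b::t2_space" and H :: "'b \<Rightarrow> 'c::topological_space"
  assumes "compact S" "continuous_on S q" "continuous_on S (\<lambda>x. H (q x))"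
  shows "continuous_on (q ` S) H"
  unfolding continuous_on_closed_invariant
proof (intro allI impI)
  fix B :: "'c set" assume "closed B"
  then obtain A where A: "closed A" "A \<inter> S = (\<lambda>x. H (q x)) -` B \<inter> S"
    using assms(3) unfolding continuous_on_closed_invariant by meson
  have "compact (q ` (S \<inter> A))"
    using assms A by (intro compact_continuous_image) (auto intro: continuous_on_subset compact_Int_closed)
  then have "closed (q ` (S \<inter> A))" by (rule compact_imp_closed)
  moreover have "q ` (S \<inter> A) \<inter> q ` S = H -` B \<inter> q ` S" using A(2) by auto
  ultimately show "\<exists>A. closed A \<and> A \<inter> q ` S = H -` B \<inter> q ` S" by blast
qed

section \<open>Density of trigonometric polynomials\<close>

text \<open>Sums of monomials without an explicit frequency set, so that closure under products is a
  double induction (\<open>trig_mult\<close>).\<close>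

inductive trig :: "(real^'n \<Rightarrow> complex) \<Rightarrow> bool" where
  monomial: "trig (\<lambda>x. c * expi n x)"
| add: "trig p \<Longrightarrow> trig q \<Longrightarrow> trig (\<lambda>x. p x + q x)"

lemma trig_const: "trig (\<lambda>x. c)"
  using trig.monomial[of c 0] by simp

lemma trig_mult:
  assumes "trig p" "trig q"
  shows "trig (\<lambda>x. p x * q x)"
  using assms
proof (induction p)
  case (monomial c n)
  from monomial show ?case
  proof (induction q)
    case (monomial d k)
    have "(\<lambda>x. c * expi n x * (d * expi k x)) = (\<lambda>x. (c * d) * expi (n + k) x)"
      by (simp add: expi_mult[symmetric] mult_ac)
    then show ?case by (simp add: trig.monomial)
  next
    case (add p q)
    then show ?case by (simp add: distrib_left trig.add)
  qed
next
  case (add p q)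
  then show ?case by (simp add: distrib_right trig.add)
qed

lemma trig_sum: "finite S \<Longrightarrow> (\<And>k. k \<in> S \<Longrightarrow> trig (p k)) \<Longrightarrow> trig (\<lambda>x. \<Sum>k\<in>S. p k x)"
proof (induction rule: finite_induct)
  case empty
  then show ?case by (simp add: trig_const)
next
  case (insert k S)
  then show ?case by (simp add: trig.add)
qed

lemma trig_cos_sin:
  "trig (\<lambda>x. of_real (cos (x $ j)))" "trig (\<lambda>x. of_real (sin (x $ j)))"
proof -
  have ip: "lattice_vec (axis j 1) \<bullet> x = x $ j" for x
  proof -
    have "lattice_vec (axis j 1) = axis j 1" by (simp add: lattice_vec_def vec_eq_iff axis_def)
    then show ?thesis by (simp add: inner_axis' )
  qed
  have "trig (\<lambda>x. 1 / 2 * expi (axis j 1) x + 1 / 2 * expi (- axis j 1) x)"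
    by (intro trig.intros)
  also have "(\<lambda>x. 1 / 2 * expi (axis j 1) x + 1 / 2 * expi (- axis j 1) x) = (\<lambda>x. of_real (cos (x $ j)))"
    by (auto simp: expi_def lattice_vec_minus ip complex_eq_iff)
  finally show "trig (\<lambda>x. of_real (cos (x $ j)))" .
  have "trig (\<lambda>x. (- \<i> / 2) * expi (axis j 1) x + (\<i> / 2) * expi (- axis j 1) x)"
    by (intro trig.intros)
  also have "(\<lambda>x. (- \<i> / 2) * expi (axis j 1) x + (\<i> / 2) * expi (- axis j 1) x) = (\<lambda>x. of_real (sin (x $ j)))"
    by (auto simp: expi_def lattice_vec_minus ip complex_eq_iff)
  finally show "trig (\<lambda>x. of_real (sin (x $ j)))" .
qed

text \<open>Glues opposite faces of the period cube. Continuous periodic functions become continuous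
  functions on a compact subset of a Euclidean space, where Stone-Weierstrass is available for
  polynomials, and polynomials in cosines and sines are trigonometric.\<close>

definition torus_embed :: "real^'n \<Rightarrow> complex^'n" where
  "torus_embed x = (\<chi> j. cis (x $ j))"

lemma continuous_on_torus_embed: "continuous_on S torus_embed"
  unfolding torus_embed_def cis_conv_exp by (intro continuous_intros)

lemma trig_polynomial_torus_embed:
  assumes "real_polynomial_function p"
  shows "trig (\<lambda>x. of_real (p (torus_embed x)))"
  using assms
proof induction
  case (linear f)
  have "f (torus_embed x) = (\<Sum>j\<in>UNIV. f (axis j 1) * cos (x $ j) + f (axis j \<i>) * sin (x $ j))" for x
  proof -
    have "torus_embed x = (\<Sum>j\<in>UNIV. cos (x $ j) *\<^sub>R axis j 1 + sin (x $ j) *\<^sub>R axis j \<i>)"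
      by (simp add: torus_embed_def vec_eq_iff axis_def if_distrib complex_eq_iff sum.distrib cong: if_cong)
    then show ?thesis
      using linear by (simp add: linear_sum linear_add linear_scale bounded_linear.linear mult.commute)
  qed
  then have eq: "(\<lambda>x. complex_of_real (f (torus_embed x)))
      = (\<lambda>x. \<Sum>j\<in>UNIV. of_real (f (axis j 1)) * of_real (cos (x $ j)) + of_real (f (axis j \<i>)) * of_real (sin (x $ j)))"
    by simp
  show ?case unfolding eq
    by (intro trig_sum trig.add trig_mult trig_const trig_cos_sin) auto
next
  case (const c)
  then show ?case by (rule trig_const)
next
  case (add f g)
  then show ?case by (simp add: trig.add)
next
  case (mult f g)
  then show ?case by (simp add: trig_mult)
qed

lemma trig_dense:
  fixes h :: "real^'n \<Rightarrow> complex"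
  assumes per: "periodic h" and cont: "continuous_on UNIV h" and "0 < e"
  obtains p where "trig p" "\<And>x. x \<in> cbox (\<chi> j. - pi) (\<chi> j. pi) \<Longrightarrow> norm (h x - p x) < e"
proof -
  let ?S = "cbox (\<chi> j. - pi) (\<chi> j. pi) :: (real^'n) set"
  \<comment> \<open>\<open>Arg\<close> selects angles and jumps, but only by multiples of 2 pi,
    which h does not see.\<close>
  define H where "H = (\<lambda>z :: complex^'n. h (\<chi> j. Arg (z $ j)))"
  have H: "H (torus_embed x) = h x" for x
  proof -
    have "\<exists>i::int. Arg (cis (x $ j)) = x $ j + 2 * pi * of_int i" for j
    proof -
      have "cis (Arg (cis (x $ j))) = cis (x $ j)" by (simp add: cis_Arg)
      then have "sin (Arg (cis (x $ j))) = sin (x $ j) \<and> cos (Arg (cis (x $ j))) = cos (x $ j)"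
        by (simp add: complex_eq_iff)
      then show ?thesis using sin_cos_eq_iff by auto
    qed
    then obtain k where k: "\<And>j. Arg (cis (x $ j)) = x $ j + 2 * pi * of_int (k j)" by metis
    have "(\<chi> j. Arg (torus_embed x $ j)) = x + (2 * pi) *\<^sub>R lattice_vec (\<chi> j. k j)"
      by (simp add: vec_eq_iff torus_embed_def k lattice_vec_def)
    then show ?thesis using periodic_lattice_shift[OF per] by (simp add: H_def)
  qed
  have Hc: "continuous_on (torus_embed ` ?S) H"
    by (rule continuous_on_factor) (auto simp: H intro: continuous_on_torus_embed continuous_on_subset[OF cont])
  have K: "compact (torus_embed ` ?S)"
    by (intro compact_continuous_image continuous_on_torus_embed) auto
  obtain p where p: "real_polynomial_function p" "\<And>z. z \<in> torus_embed ` ?S \<Longrightarrow> \<bar>Re (H z) - p z\<bar> < e / 2"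
    by (rule Stone_Weierstrass_real_polynomial_function[OF K, of "\<lambda>z. Re (H z)" "e / 2"])
      (use Hc \<open>0 < e\<close> in \<open>auto intro: continuous_intros\<close>)
  obtain q where q: "real_polynomial_function q" "\<And>z. z \<in> torus_embed ` ?S \<Longrightarrow> \<bar>Im (H z) - q z\<bar> < e / 2"
    by (rule Stone_Weierstrass_real_polynomial_function[OF K, of "\<lambda>z. Im (H z)" "e / 2"])
      (use Hc \<open>0 < e\<close> in \<open>auto intro: continuous_intros\<close>)
  define P where "P = (\<lambda>x. of_real (p (torus_embed x)) + \<i> * of_real (q (torus_embed x)))"
  show ?thesis
  proof
    show "trig P" unfolding P_def
      by (intro trig.add trig_mult trig_const trig_polynomial_torus_embed p q)
    fix x assume "x \<in> ?S"
    then have "\<bar>Re (h x) - p (torus_embed x)\<bar> < e / 2" "\<bar>Im (h x) - q (torus_embed x)\<bar> < e / 2"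
      using p(2)[of "torus_embed x"] q(2)[of "torus_embed x"] by (auto simp: H)
    then show "norm (h x - P x) < e"
      using cmod_le[of "h x - P x"] by (simp add: P_def)
  qed
qed

lemma trig_continuous: "trig p \<Longrightarrow> continuous_on S p"
  by (induction rule: trig.induct) (auto intro!: continuous_intros)

lemma trig_orthogonal:
  fixes h :: "real^'n \<Rightarrow> complex"
  assumes "trig p" and h: "integrable torus_measure h" and z: "\<And>n. fourier_coeff h n = 0"
  shows "integrable torus_measure (\<lambda>x. h x * p x) \<and> (LINT x|torus_measure. h x * p x) = 0"
  using assms(1)
proof induction
  case (monomial c n)
  have eq: "(\<lambda>x. h x * (c * expi n x)) = (\<lambda>x. c * (h x * expi n x))" by (simp add: mult_ac)
  have "(LINT x|torus_measure. h x * expi n x) = 0" using z[of "- n"] by (simp add: fourier_coeff_def)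
  then show ?case unfolding eq using integrable_mult_expi[OF h] by simp
next
  case (add p q)
  then show ?case by (simp add: distrib_left)
qed

lemma periodic_cnj: "periodic h \<Longrightarrow> periodic (\<lambda>x. cnj (h x))"
  by (simp add: periodic_def)

text \<open>Trigonometric polynomials p integrate to 0 against h, so the integral of |h|^2 equals
  that of h (cnj h - p), which uniform approximation of cnj h makes arbitrarily small. Continuity
  then gives h = 0 on the closed cube, and periodicity everywhere.\<close>

lemma fourier_uniqueness:
  fixes h :: "real^'n \<Rightarrow> complex"
  assumes per: "periodic h" and cont: "continuous_on UNIV h" and z: "\<And>n. fourier_coeff h n = 0"
  shows "h x = 0"
proof -
  let ?S = "cbox (\<chi> j. - pi) (\<chi> j. pi) :: (real^'n) set"
  let ?I = "LINT x|torus_measure. (cmod (h x))\<^sup>2"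
  have hi: "integrable torus_measure h" by (rule continuous_torus_integrable[OF cont])
  have i2: "integrable torus_measure (\<lambda>x. (cmod (h x))\<^sup>2)"
    by (intro continuous_torus_integrable continuous_intros cont)
  define L where "L = (LINT x|torus_measure. cmod (h x))"
  have L: "0 \<le> L" unfolding L_def by (intro integral_nonneg_AE) simp
  have small: "?I \<le> e * L" if e: "0 < e" for e
  proof -
    obtain p where p: "trig p" "\<And>x. x \<in> ?S \<Longrightarrow> norm (cnj (h x) - p x) < e"
      using trig_dense[OF periodic_cnj[OF per] _ e] cont by (auto intro: continuous_intros)
    have pi: "integrable torus_measure (\<lambda>x. h x * (cnj (h x) - p x))"
      using trig_continuous[OF p(1)] cont by (intro continuous_torus_integrable continuous_intros)
    have "complex_of_real ?I = (LINT x|torus_measure. h x * cnj (h x))"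
      by (simp add: complex_norm_square[symmetric] of_real_power[symmetric] del: of_real_power)
    also have "\<dots> = (LINT x|torus_measure. h x * (cnj (h x) - p x) + h x * p x)"
      by (simp add: algebra_simps)
    also have "\<dots> = (LINT x|torus_measure. h x * (cnj (h x) - p x))"
      using trig_orthogonal[OF p(1) hi z] pi by simp
    finally have eq: "complex_of_real ?I = (LINT x|torus_measure. h x * (cnj (h x) - p x))" .
    have "\<bar>?I\<bar> = norm (LINT x|torus_measure. h x * (cnj (h x) - p x))"
      by (simp only: eq[symmetric] norm_of_real)
    also have "\<dots> \<le> (LINT x|torus_measure. norm (h x * (cnj (h x) - p x)))"
      by (rule integral_norm_bound)
    also have "\<dots> \<le> (LINT x|torus_measure. e * cmod (h x))"
    proof (rule integral_mono)
      show "integrable torus_measure (\<lambda>x. norm (h x * (cnj (h x) - p x)))" using pi by (rule integrable_norm)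
      show "integrable torus_measure (\<lambda>x. e * cmod (h x))" using hi by simp
      fix x assume "x \<in> space (torus_measure :: (real^'n) measure)"
      then have "x \<in> ?S" using torus_subset_cbox by auto
      from p(2)[OF this] show "norm (h x * (cnj (h x) - p x)) \<le> e * cmod (h x)"
        by (simp add: norm_mult mult.commute[of e] mult_left_mono)
    qed
    also have "\<dots> = e * L" by (simp add: L_def)
    finally show ?thesis by simp
  qed
  have "?I \<le> 0"
  proof (rule ccontr)
    assume "\<not> ?I \<le> 0"
    then have "0 < ?I / (L + 1)" using L by simp
    from small[OF this] have "?I * (L + 1) \<le> ?I * L" using L by (simp add: field_simps)
    then show False using \<open>\<not> ?I \<le> 0\<close> by (simp add: algebra_simps)
  qed
  then have I0: "?I = 0" by (simp add: antisym integral_nonneg_AE)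
  have "?I = integral torus (\<lambda>x. (cmod (h x))\<^sup>2)"
    using i2 torus_lebesgue by (rule lebesgue_integral_eq_integral)
  also have "\<dots> = integral ?S (\<lambda>x. (cmod (h x))\<^sup>2)"
  proof (rule integral_subset_negligible[OF torus_subset_cbox])
    show "negligible (?S - torus)"
      by (rule negligible_subset[OF negligible_frontier_interval]) (use box_subset_torus in auto)
  qed
  finally have "integral ?S (\<lambda>x. (cmod (h x))\<^sup>2) = 0" using I0 by simp
  moreover have c: "continuous_on ?S (\<lambda>x. (cmod (h x))\<^sup>2)"
    by (intro continuous_intros continuous_on_subset[OF cont]) auto
  ultimately have 0: "((\<lambda>x. (cmod (h x))\<^sup>2) has_integral 0) ?S"
    using integrable_integral[OF integrable_continuous[OF c]] by simp
  have "box (\<chi> j. - pi) (\<chi> j. pi) \<noteq> ({} :: (real^'n) set)"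
    by (simp add: interval_ne_empty_cart)
  then have zero: "h x = 0" if "x \<in> ?S" for x
    using has_integral_0_cbox_imp_0[OF c _ 0 _ that] by simp
  obtain k where "x + (2 * pi) *\<^sub>R lattice_vec k \<in> ?S" by (rule lattice_reduction)
  from zero[OF this] show "h x = 0" using periodic_lattice_shift[OF per] by simp
qed

lemma periodic_expi: "periodic (expi n)"
proof -
  have "cis (lattice_vec n \<bullet> (x + (2 * pi) *\<^sub>R axis j 1)) = cis (lattice_vec n \<bullet> x)" for x j
  proof -
    have "cis (lattice_vec n \<bullet> (x + (2 * pi) *\<^sub>R axis j 1)) = cis (lattice_vec n \<bullet> x) * cis (2 * pi * of_int (n $ j))"
      by (simp add: inner_add_right inner_axis lattice_vec_def cis_mult mult.commute)
    then show ?thesis by (simp add: cis_multiple_2pi)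
  qed
  then show ?thesis by (simp add: periodic_def expi_def)
qed

text \<open>The series converges uniformly to a continuous periodic function with the same
  coefficients as g; uniqueness identifies the two at every point, not just almost
  everywhere.\<close>

lemma fourier_inversion:
  fixes g :: "real^'n \<Rightarrow> complex"
  assumes per: "periodic g" and cont: "continuous_on UNIV g"
    and summ: "(\<lambda>n. cmod (fourier_coeff g n)) summable_on UNIV"
  shows "((\<lambda>n. fourier_coeff g n * expi n x) has_sum g x) UNIV"
proof -
  define c where "c = fourier_coeff g"
  define G where "G = (\<lambda>x. \<Sum>\<^sub>\<infinity>n. c n * expi n x)"
  define P where "P = (\<lambda>S x. \<Sum>n\<in>S. c n * expi n x)"
  have lim: "uniform_limit UNIV P G (finite_subsets_at_top UNIV)"
    unfolding P_def G_def using summ by (intro Weierstrass_m_test_general[of _ _ _ "\<lambda>n. cmod (c n)"])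
      (auto simp: norm_mult c_def)
  have Pc: "continuous_on UNIV (P S)" for S unfolding P_def by (intro continuous_intros)
  have Gc: "continuous_on UNIV G"
    by (rule uniform_limit_theorem[OF _ lim]) (use Pc in auto)
  have abs: "(\<lambda>n. norm (c n * expi n x)) summable_on UNIV" for x
    using summ by (simp add: norm_mult c_def)
  have Gsum: "((\<lambda>n. c n * expi n x) has_sum G x) UNIV" for x
    unfolding G_def by (intro has_sum_infsum abs_summable_summable[OF abs])
  have Gper: "periodic G"
    by (simp add: G_def periodic_def periodic_expi[unfolded periodic_def, rule_format])
  have coeff: "fourier_coeff G n = c n" for n
  proof -
    define V where "V = (2 * pi) ^ CARD('n)"
    have V: "0 < V" by (simp add: V_def)
    interpret finite_measure "torus_measure :: (real^'n) measure" by (rule finite_measure_torus)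
    define M where "M = measure torus_measure (torus :: (real^'n) set)"
    have M: "0 \<le> M" by (simp add: M_def)
    \<comment> \<open>A partial sum containing n has n-th coefficient exactly c n, so the error is
      that of a uniform approximation of G.\<close>
    have close: "norm (fourier_coeff G n - c n) \<le> e * M / V" if "0 < e" for e
    proof -
      have "eventually (\<lambda>S. finite S \<and> {n} \<subseteq> S) (finite_subsets_at_top UNIV)"
        by (rule eventually_finite_subsets_at_top_weakI[THEN eventually_conj]) (auto simp: eventually_finite_subsets_at_top)
      with uniform_limitD[OF lim that]
      have "eventually (\<lambda>S. (\<forall>x\<in>UNIV. dist (P S x) (G x) < e) \<and> finite S \<and> {n} \<subseteq> S) (finite_subsets_at_top UNIV)"
        by (rule eventually_conj)
      then obtain S where S: "\<And>x. dist (P S x) (G x) < e" "finite S" "n \<in> S"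
        using eventually_happens'[OF finite_subsets_at_top_neq_bot] by force
      have "fourier_coeff G n - c n = fourier_coeff (\<lambda>x. G x - P S x) n"
      proof -
        have "fourier_coeff (\<lambda>x. G x - P S x) n = fourier_coeff G n - fourier_coeff (P S) n"
          by (intro fourier_coeff_diff continuous_torus_integrable Gc Pc)
        then show ?thesis using S by (simp add: P_def fourier_coeff_trig_sum)
      qed
      also have "norm \<dots> = norm (LINT x|torus_measure. (G x - P S x) * expi (- n) x) / V"
        by (simp add: fourier_coeff_def V_def norm_divide norm_power norm_mult)
      also have "\<dots> \<le> (LINT x|(torus_measure :: (real^'n) measure). e) / V"
      proof (intro divide_right_mono)
        have "norm (LINT x|torus_measure. (G x - P S x) * expi (- n) x)
            \<le> (LINT x|torus_measure. norm ((G x - P S x) * expi (- n) x))"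
          by (rule integral_norm_bound)
        also have "\<dots> \<le> (LINT x|(torus_measure :: (real^'n) measure). e)"
        proof (rule integral_mono)
          show "integrable torus_measure (\<lambda>x. norm ((G x - P S x) * expi (- n) x))"
            by (intro integrable_norm continuous_torus_integrable continuous_intros Gc Pc)
          show "norm ((G x - P S x) * expi (- n) x) \<le> e" for x
            using S(1)[of x] by (simp add: norm_mult dist_norm norm_minus_commute)
        qed simp
        finally show "norm (LINT x|torus_measure. (G x - P S x) * expi (- n) x) \<le> (LINT x|(torus_measure :: (real^'n) measure). e)" .
      qed (use V in simp)
      also have "\<dots> = e * M / V" by (simp add: M_def)
      finally show ?thesis .
    qed
    have "norm (fourier_coeff G n - c n) \<le> 0"
    proof (rule field_le_epsilon)
      fix e :: real assume "0 < e"
      have "norm (fourier_coeff G n - c n) \<le> (e * V / (M + 1)) * M / V"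
        using \<open>0 < e\<close> V M by (intro close) auto
      also have "\<dots> = e * (M / (M + 1))" using V by simp
      also have "\<dots> \<le> e * 1" using M \<open>0 < e\<close> by (intro mult_left_mono) auto
      finally show "norm (fourier_coeff G n - c n) \<le> 0 + e" by simp
    qed
    then show ?thesis by simp
  qed
  have "g x - G x = 0"
  proof (rule fourier_uniqueness)
    show "periodic (\<lambda>x. g x - G x)" using per Gper by (simp add: periodic_def)
    show "continuous_on UNIV (\<lambda>x. g x - G x)" by (intro continuous_intros cont Gc)
    show "fourier_coeff (\<lambda>x. g x - G x) n = 0" for n
      by (subst fourier_coeff_diff) (auto intro: continuous_torus_integrable Gc cont simp: coeff c_def)
  qed
  then show ?thesis using Gsum[of x] by (simp add: c_def)
qed

section \<open>Termwise differentiation of trigonometric series\<close>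

lemma int_powr_summable:
  assumes "1 / 2 < r"
  shows "(\<lambda>k::int. (1 + (real_of_int k)\<^sup>2) powr (- r)) summable_on UNIV"
proof -
  let ?g = "\<lambda>k::int. (1 + (real_of_int k)\<^sup>2) powr (- r)"
  have nat: "(\<lambda>k::nat. ?g (int k)) summable_on UNIV"
  proof -
    have "summable (\<lambda>k::nat. ?g (int k))"
    proof (rule summable_comparison_test')
      show "summable (\<lambda>k::nat. real k powr (- (2 * r)))"
        using assms by (subst summable_real_powr_iff) auto
      fix k :: nat assume "1 \<le> k"
      then have "(1 + (real k)\<^sup>2) powr (- r) \<le> ((real k)\<^sup>2) powr (- r)"
        using assms by (intro powr_mono2') auto
      also have "\<dots> = real k powr (- (2 * r))"
        using \<open>1 \<le> k\<close> by (simp add: powr_powr flip: powr_numeral)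
      finally show "norm (?g (int k)) \<le> real k powr (- (2 * r))" by simp
    qed
    then show ?thesis by (subst summable_on_UNIV_nonneg_real_iff) auto
  qed
  have 1: "?g summable_on range int"
    by (subst summable_on_reindex) (use nat in \<open>auto simp: comp_def\<close>)
  have 2: "?g summable_on range (\<lambda>n. - int n)"
    by (subst summable_on_reindex) (use nat in \<open>auto simp: comp_def inj_on_def\<close>)
  have "?g summable_on (range int \<union> (range (\<lambda>n. - int n) - range int))"
    by (intro summable_on_Un_disjoint 1 summable_on_subset_banach[OF 2]) auto
  moreover have "range int \<union> (range (\<lambda>n. - int n) - range int) = UNIV"
  proof -
    have "k \<in> range int \<or> k \<in> range (\<lambda>n. - int n)" for k :: int
      by (cases k rule: int_cases2) auto
    then show ?thesis by auto
  qed
  ultimately show ?thesis by simp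
qed

text \<open>Share the exponent equally among the coordinates: each of the N factors (1 +
  |n|^2)^(-s/N) is at most (1 + n_j^2)^(-s/N). The lattice sum is thus dominated by a product of
  one-dimensional sums, convergent because s/N > 1/2.\<close>

lemma lattice_powr_summable:
  assumes "real CARD('n) / 2 < s"
  shows "(\<lambda>n::int^'n. (1 + (norm (lattice_vec n))\<^sup>2) powr (- s)) summable_on UNIV"
proof -
  define r where "r = s / real CARD('n)"
  have r: "1 / 2 < r" using assms by (simp add: r_def field_simps)
  define g where "g = (\<lambda>k::int. (1 + (real_of_int k)\<^sup>2) powr (- r))"
  have g: "g summable_on UNIV" using int_powr_summable[OF r] by (simp add: g_def)
  have g0: "0 \<le> g k" for k by (simp add: g_def)
  define Q where "Q = infsum g UNIV"
  have gB: "sum g B \<le> Q" if "finite B" for B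
    unfolding Q_def using g g0 that by (intro finite_sum_le_infsum) auto
  have le: "(1 + (norm (lattice_vec n))\<^sup>2) powr (- s) \<le> (\<Prod>j\<in>UNIV. g (n $ j))" for n :: "int^'n"
  proof -
    let ?w = "1 + (norm (lattice_vec n))\<^sup>2"
    have w: "0 < ?w" by (intro add_pos_nonneg) auto
    have "?w powr (- s) = (\<Prod>j\<in>(UNIV::'n set). ?w powr (- r))"
      using w by (simp add: powr_power r_def)
    also have "\<dots> \<le> (\<Prod>j\<in>UNIV. g (n $ j))"
    proof (rule prod_mono)
      fix j
      have "\<bar>lattice_vec n $ j\<bar> \<le> norm (lattice_vec n)" by (rule component_le_norm_cart)
      then have "(real_of_int (n $ j))\<^sup>2 \<le> (norm (lattice_vec n))\<^sup>2"
        by (simp add: lattice_vec_def abs_le_square_iff[symmetric])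
      then have "?w powr (- r) \<le> g (n $ j)"
        unfolding g_def using r by (intro powr_mono2') (auto intro: add_pos_nonneg)
      then show "0 \<le> ?w powr (- r) \<and> ?w powr (- r) \<le> g (n $ j)" by simp
    qed
    finally show ?thesis .
  qed
  have "(\<lambda>n::int^'n. \<Prod>j\<in>UNIV. g (n $ j)) summable_on UNIV"
  proof (rule nonneg_bdd_above_summable_on)
    show "0 \<le> (\<Prod>j\<in>UNIV. g (n $ j))" for n :: "int^'n" by (intro prod_nonneg) (simp add: g0)
    show "bdd_above (sum (\<lambda>n::int^'n. \<Prod>j\<in>UNIV. g (n $ j)) ` {F. F \<subseteq> UNIV \<and> finite F})"
    proof (rule bdd_aboveI2)
      fix F :: "(int^'n) set" assume "F \<in> {F. F \<subseteq> UNIV \<and> finite F}"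
      then have F: "finite F" by simp
      \<comment> \<open>A finite set of lattice points lies in the box of its coordinate
        projections, over which the sum of products factors.\<close>
      define B where "B = (\<lambda>j. (\<lambda>n. n $ j) ` F)"
      have B: "finite (B j)" for j using F by (simp add: B_def)
      have "(\<Sum>n\<in>F. \<Prod>j\<in>UNIV. g (n $ j)) = (\<Sum>h\<in>(\<lambda>n j. n $ j) ` F. \<Prod>j\<in>UNIV. g (h j))"
        by (subst sum.reindex) (auto simp: inj_on_def vec_eq_iff fun_eq_iff)
      also have "\<dots> \<le> (\<Sum>h\<in>PiE UNIV B. \<Prod>j\<in>UNIV. g (h j))"
        using B by (intro sum_mono2 finite_PiE prod_nonneg) (auto simp: g0 B_def)
      also have "\<dots> = (\<Prod>j\<in>UNIV. \<Sum>k\<in>B j. g k)"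
        using B by (subst prod_sum_PiE) auto
      also have "\<dots> \<le> (\<Prod>j\<in>(UNIV :: 'n set). Q)"
        using gB[OF B] by (intro prod_mono) (auto simp: g0 sum_nonneg)
      finally show "(\<Sum>n\<in>F. \<Prod>j\<in>UNIV. g (n $ j)) \<le> (\<Prod>j\<in>(UNIV :: 'n set). Q)" .
    qed
  qed
  then show ?thesis
    by (rule summable_on_comparison_test) (use le in auto)
qed

section \<open>Trigonometric series with summable derivatives\<close>

text \<open>The lattice is enumerated by \<nu>, so that the results on series indexed by natural
  numbers apply; coefficients are indexed by position and not by lattice point.\<close>

definition trig_series :: "(nat \<Rightarrow> int^'n) \<Rightarrow> (nat \<Rightarrow> complex) \<Rightarrow> real^'n \<Rightarrow> complex" where
  "trig_series \<nu> c x = (\<Sum>k. c k * expi (\<nu> k) x)"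

text \<open>Ensures absolute convergence, uniformly in x, of the series and of its formal
  derivatives up to order m.\<close>

definition weighted_summable :: "(nat \<Rightarrow> int^'n) \<Rightarrow> nat \<Rightarrow> (nat \<Rightarrow> complex) \<Rightarrow> bool" where
  "weighted_summable \<nu> m c \<longleftrightarrow> summable (\<lambda>k. (1 + norm (lattice_vec (\<nu> k))) ^ m * norm (c k))"

text \<open>The bookkeeping of differentiation: a multiplier growing like the i-th power of the
  weight uses up i of the m orders.\<close>

lemma weighted_summable_mono:
  assumes c: "weighted_summable \<nu> m c"
    and le: "\<And>k. norm (d k) \<le> (1 + norm (lattice_vec (\<nu> k))) ^ i * norm (c k)" and "i + l \<le> m"
  shows "weighted_summable \<nu> l d"
  unfolding weighted_summable_def
proof (rule summable_comparison_test')
  show "summable (\<lambda>k. (1 + norm (lattice_vec (\<nu> k))) ^ m * norm (c k))"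
    using c by (simp add: weighted_summable_def)
  fix k
  let ?w = "1 + norm (lattice_vec (\<nu> k))"
  have "?w ^ l * norm (d k) \<le> ?w ^ l * (?w ^ i * norm (c k))"
    by (intro mult_left_mono le) auto
  also have "\<dots> = ?w ^ (i + l) * norm (c k)" by (simp add: power_add mult_ac)
  also have "\<dots> \<le> ?w ^ m * norm (c k)"
    using assms(3) by (intro mult_right_mono power_increasing) auto
  finally show "norm (?w ^ l * norm (d k)) \<le> ?w ^ m * norm (c k)" by simp
qed

lemma weighted_summable_norm: "weighted_summable \<nu> m c \<Longrightarrow> summable (\<lambda>k. norm (c k))"
  using weighted_summable_mono[of \<nu> m c c 0 0] by (simp add: weighted_summable_def)

lemma trig_series_summable:
  assumes "weighted_summable \<nu> m c"
  shows "summable (\<lambda>k. c k * expi (\<nu> k) x)"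
  by (rule summable_norm_cancel) (use weighted_summable_norm[OF assms] in \<open>simp add: norm_mult\<close>)

lemma trig_series_continuous:
  assumes "weighted_summable \<nu> m c"
  shows "continuous_on UNIV (trig_series \<nu> c)"
proof -
  have "uniform_limit UNIV (\<lambda>n x. \<Sum>k<n. c k * expi (\<nu> k) x) (trig_series \<nu> c) sequentially"
    unfolding trig_series_def using weighted_summable_norm[OF assms]
    by (intro Weierstrass_m_test[of _ _ "\<lambda>k. norm (c k)"]) (simp_all add: norm_mult)
  then show ?thesis
    by (rule uniform_limit_theorem[rotated]) (auto intro!: always_eventually continuous_intros)
qed

lemma abs_component_le_weight: "\<bar>real_of_int (n $ j)\<bar> \<le> 1 + norm (lattice_vec n)"
  using component_le_norm_cart[of "lattice_vec n" j] by (simp add: lattice_vec_def)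

lemma trig_series_derivative:
  fixes \<nu> :: "nat \<Rightarrow> int^'n"
  assumes c: "weighted_summable \<nu> (Suc m) c"
  shows "((\<lambda>s. trig_series \<nu> c (x + s *\<^sub>R axis j 1)) has_vector_derivative
    trig_series \<nu> (\<lambda>k. \<i> * of_int (\<nu> k $ j) * c k) x) (at 0)"
proof -
  let ?c' = "\<lambda>k. \<i> * of_int (\<nu> k $ j) * c k"
  have c': "weighted_summable \<nu> m ?c'"
    by (rule weighted_summable_mono[OF c, of _ 1]) (auto simp: norm_mult intro!: mult_right_mono abs_component_le_weight)
  have "((\<lambda>s. \<Sum>k. c k * expi (\<nu> k) (x + s *\<^sub>R axis j 1)) has_vector_derivative
      trig_series \<nu> ?c' (x + 0 *\<^sub>R axis j 1)) (at 0 within UNIV)"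
  proof (rule series_has_vector_derivative)
    show "uniform_limit UNIV (\<lambda>n r. \<Sum>k<n. ?c' k * expi (\<nu> k) (x + r *\<^sub>R axis j 1))
        (\<lambda>r. trig_series \<nu> ?c' (x + r *\<^sub>R axis j 1)) sequentially"
      unfolding trig_series_def using weighted_summable_norm[OF c']
      by (intro Weierstrass_m_test[of _ _ "\<lambda>k. norm (?c' k)"]) (simp_all add: norm_mult)
    show "summable (\<lambda>k. c k * expi (\<nu> k) (x + r *\<^sub>R axis j 1))" for r
      by (rule trig_series_summable[OF c])
    fix k r
    let ?n = "\<nu> k"
    have inner: "lattice_vec ?n \<bullet> (x + s *\<^sub>R axis j 1) = lattice_vec ?n \<bullet> x + s * real_of_int (?n $ j)" for s
      by (simp add: inner_add_right inner_axis lattice_vec_def)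
    have "((\<lambda>z. exp (\<i> * (of_real (lattice_vec ?n \<bullet> x) + z * of_int (?n $ j)))) has_field_derivative
        \<i> * of_int (?n $ j) * exp (\<i> * (of_real (lattice_vec ?n \<bullet> x) + of_real r * of_int (?n $ j)))) (at (of_real r))"
      by (auto intro!: derivative_eq_intros)
    from has_vector_derivative_real_field[OF this]
    have "((\<lambda>s. expi ?n (x + s *\<^sub>R axis j 1)) has_vector_derivative
        \<i> * of_int (?n $ j) * expi ?n (x + r *\<^sub>R axis j 1)) (at r within UNIV)"
      by (simp add: expi_def inner cis_conv_exp)
    from has_vector_derivative_mult_right[OF this, of "c k"]
    show "((\<lambda>s. c k * expi ?n (x + s *\<^sub>R axis j 1)) has_vector_derivative
        ?c' k * expi ?n (x + r *\<^sub>R axis j 1)) (at r within UNIV)"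
      by (simp add: mult_ac)
  qed auto
  then show ?thesis by (simp add: trig_series_def)
qed

lemma partial_trig_series:
  assumes "weighted_summable \<nu> (Suc m) c"
  shows "partial j (trig_series \<nu> c) = trig_series \<nu> (\<lambda>k. \<i> * of_int (\<nu> k $ j) * c k)"
  using trig_series_derivative[OF assms] by (auto simp: partial_def fun_eq_iff vector_derivative_at)

lemma Ck_trig_series: "weighted_summable \<nu> m c \<Longrightarrow> Ck m (trig_series \<nu> c)"
proof (induction m arbitrary: c)
  case 0
  then show ?case using trig_series_continuous by auto
next
  case (Suc m)
  show ?case
    unfolding Ck.simps
  proof (intro conjI allI)
    show "continuous_on UNIV (trig_series \<nu> c)" by (rule trig_series_continuous[OF Suc.prems])
    fix j
    show "(\<lambda>s. trig_series \<nu> c (x + s *\<^sub>R axis j 1)) differentiable at 0" for x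
      using trig_series_derivative[OF Suc.prems] differentiableI_vector by blast
    show "Ck m (partial j (trig_series \<nu> c))"
      unfolding partial_trig_series[OF Suc.prems]
      by (intro Suc.IH weighted_summable_mono[OF Suc.prems, of _ 1])
        (auto simp: norm_mult intro!: mult_right_mono abs_component_le_weight)
  qed
qed

lemma foldr_Dj_trig_series:
  assumes "weighted_summable \<nu> m c" "length js \<le> m"
  shows "foldr Dj js (trig_series \<nu> c) = trig_series \<nu> (\<lambda>k. (\<Prod>j\<leftarrow>js. of_int (\<nu> k $ j)) * c k)"
  using assms(2)
proof (induction js)
  case (Cons j js)
  let ?d = "\<lambda>k. (\<Prod>j\<leftarrow>js. of_int (\<nu> k $ j)) * c k"
  have le: "norm (\<Prod>j\<leftarrow>js. complex_of_int (n $ j)) \<le> (1 + norm (lattice_vec n)) ^ length js" for n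
    by (induction js) (auto simp: norm_mult intro!: mult_mono abs_component_le_weight)
  have d: "weighted_summable \<nu> (Suc 0) ?d"
    using Cons.prems by (intro weighted_summable_mono[OF assms(1), of _ "length js"])
      (auto simp: norm_mult intro!: mult_right_mono le)
  have "foldr Dj (j # js) (trig_series \<nu> c) = Dj j (trig_series \<nu> ?d)"
    using Cons by simp
  also have "\<dots> = trig_series \<nu> (\<lambda>k. (\<Prod>j\<leftarrow>j # js. of_int (\<nu> k $ j)) * c k)"
  proof
    fix x
    have "weighted_summable \<nu> 0 (\<lambda>k. \<i> * of_int (\<nu> k $ j) * ?d k)"
      by (rule weighted_summable_mono[OF d, of _ 1]) (auto simp: norm_mult intro!: mult_right_mono abs_component_le_weight)
    from suminf_mult[OF trig_series_summable[OF this, of x], of "1 / \<i>"]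
    show "Dj j (trig_series \<nu> ?d) x = trig_series \<nu> (\<lambda>k. (\<Prod>j\<leftarrow>j # js. of_int (\<nu> k $ j)) * c k) x"
      unfolding Dj_def partial_trig_series[OF d] unfolding trig_series_def by (simp add: mult_ac)
  qed
  finally show ?case .
qed simp

lemma prod_list_count: "(\<Prod>j\<leftarrow>js. g j) = (\<Prod>j\<in>(UNIV::'n::finite set). (g j :: 'a::comm_monoid_mult) ^ count_list js j)"
proof (induction js)
  case (Cons i js)
  have "(\<Prod>j\<in>UNIV. g j ^ count_list (i # js) j) = (\<Prod>j\<in>UNIV. (if j = i then g i else 1) * g j ^ count_list js j)"
    by (intro prod.cong) auto
  then show ?case using Cons by (simp add: prod.distrib)
qed simp

lemma length_count: "length js = (\<Sum>j\<in>(UNIV::'n::finite set). count_list js j)"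
  using sum_count_set[of js UNIV] by simp

lemma ex_list_count: "\<exists>js. \<forall>j. count_list js j = (\<alpha> :: nat^'n) $ j"
proof -
  obtain xs :: "'n list" where xs: "set xs = UNIV" "distinct xs"
    using finite_distinct_list[OF finite[of UNIV]] by blast
  define js where "js = concat (map (\<lambda>i. replicate (\<alpha> $ i) i) xs)"
  have "count_list (concat (map (\<lambda>i. replicate (\<alpha> $ i) i) ys)) j = (if j \<in> set ys then \<alpha> $ j else 0)"
    if "distinct ys" for ys j
  proof -
    have r: "count_list (replicate n i) j = (if i = j then n else 0)" for n and i :: 'n
      by (induction n) auto
    show ?thesis using that by (induction ys) (auto simp: r)
  qed
  then show ?thesis using xs by (intro exI[of _ js]) (simp add: js_def)
qed

text \<open>The choice operator may return any list with the prescribed counts. Such a list exists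
  and has length m, and on the series only its counts enter, since the multipliers commute.\<close>

lemma D_multi_trig_series:
  assumes c: "weighted_summable \<nu> m c" and \<alpha>: "\<alpha> \<in> multi_indices m"
  shows "D_multi \<alpha> (trig_series \<nu> c) = trig_series \<nu> (\<lambda>k. (\<Prod>j\<in>UNIV. of_int (\<nu> k $ j) ^ (\<alpha> $ j)) * c k)"
proof -
  define js where "js = (SOME js. \<forall>j. count_list js j = \<alpha> $ j)"
  have js: "count_list js j = \<alpha> $ j" for j
    using someI_ex[OF ex_list_count[of \<alpha>]] by (simp add: js_def)
  have "length js = m" using \<alpha> by (simp add: length_count js multi_indices_def)
  then show ?thesis
    using foldr_Dj_trig_series[OF c, of js] by (simp add: D_multi_def js_def[symmetric] prod_list_count js)
qed

lemma symbZ_eq: "symbZ a m n = (\<Sum>\<alpha>\<in>multi_indices m. a \<alpha> * (\<Prod>j\<in>UNIV. of_int (n $ j) ^ (\<alpha> $ j)))"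
  by (simp add: symbZ_def symb_def lattice_vec_def)

lemma monomial_le_weight:
  assumes "\<alpha> \<in> multi_indices m"
  shows "norm (\<Prod>j\<in>UNIV. complex_of_int (n $ j) ^ (\<alpha> $ j)) \<le> (1 + norm (lattice_vec n)) ^ m"
proof -
  have "norm (\<Prod>j\<in>UNIV. complex_of_int (n $ j) ^ (\<alpha> $ j)) \<le> (\<Prod>j\<in>UNIV. (1 + norm (lattice_vec n)) ^ (\<alpha> $ j))"
    unfolding prod_norm[symmetric] norm_power
    by (intro prod_mono conjI power_mono) (auto simp: abs_component_le_weight)
  also have "\<dots> = (1 + norm (lattice_vec n)) ^ m"
    using assms by (simp add: power_sum[symmetric] multi_indices_def)
  finally show ?thesis .
qed

lemma AD_trig_series:
  assumes c: "weighted_summable \<nu> m c"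
  shows "AD a m (trig_series \<nu> c) = trig_series \<nu> (\<lambda>k. symbZ a m (\<nu> k) * c k)"
proof
  fix x
  let ?d = "\<lambda>\<alpha> k. (\<Prod>j\<in>UNIV. of_int (\<nu> k $ j) ^ (\<alpha> $ j)) * c k"
  have s: "summable (\<lambda>k. ?d \<alpha> k * expi (\<nu> k) x)" if "\<alpha> \<in> multi_indices m" for \<alpha>
  proof (rule trig_series_summable)
    show "weighted_summable \<nu> 0 (?d \<alpha>)"
      using monomial_le_weight[OF that]
      by (intro weighted_summable_mono[OF c, of _ m]) (auto simp: norm_mult intro!: mult_right_mono)
  qed
  have "AD a m (trig_series \<nu> c) x = (\<Sum>\<alpha>\<in>multi_indices m. a \<alpha> * (\<Sum>k. ?d \<alpha> k * expi (\<nu> k) x))"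
    by (simp add: AD_def D_multi_trig_series[OF c] trig_series_def)
  also have "\<dots> = (\<Sum>\<alpha>\<in>multi_indices m. \<Sum>k. a \<alpha> * (?d \<alpha> k * expi (\<nu> k) x))"
    by (intro sum.cong refl suminf_mult[symmetric] s)
  also have "\<dots> = (\<Sum>k. \<Sum>\<alpha>\<in>multi_indices m. a \<alpha> * (?d \<alpha> k * expi (\<nu> k) x))"
    by (intro suminf_sum[symmetric] summable_mult s)
  also have "\<dots> = trig_series \<nu> (\<lambda>k. symbZ a m (\<nu> k) * c k) x"
    unfolding trig_series_def symbZ_eq sum_distrib_right by (simp only: mult.assoc)
  finally show "AD a m (trig_series \<nu> c) x = trig_series \<nu> (\<lambda>k. symbZ a m (\<nu> k) * c k) x" .
qed

lemma periodic_trig_series: "periodic (trig_series \<nu> c)"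
  by (simp add: periodic_def trig_series_def periodic_expi[unfolded periodic_def, rule_format])

section \<open>The elliptic operator and the assembly of the solution\<close>

lemma symb_scale: "symb a m (r *\<^sub>R \<xi>) = of_real (r ^ m) * symb a m \<xi>"
proof -
  have "(\<Prod>j\<in>UNIV. (r * \<xi> $ j) ^ (\<alpha> $ j)) = r ^ m * (\<Prod>j\<in>UNIV. (\<xi> $ j) ^ (\<alpha> $ j))"
    if "\<alpha> \<in> multi_indices m" for \<alpha>
    using that by (simp add: power_mult_distrib prod.distrib power_sum[symmetric] multi_indices_def)
  then show ?thesis
    unfolding symb_def sum_distrib_left by (intro sum.cong refl) simp
qed

text \<open>The minimum over the compact unit sphere is positive and spreads by homogeneity. At
  \<xi> = 0 the symbol vanishes because m is positive.\<close>

lemma elliptic_lower_bound: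
  assumes e: "positive_elliptic a m" and "0 < m"
  obtains c where "0 < c" "\<And>\<xi>. symb a m \<xi> = of_real (Re (symb a m \<xi>))"
    "\<And>\<xi>. c * norm \<xi> ^ m \<le> Re (symb a m \<xi>)"
proof -
  have zero: "symb a m 0 = 0"
    using symb_scale[of a m 0 0] \<open>0 < m\<close> by (auto simp: zero_power)
  have real: "symb a m \<xi> = of_real (Re (symb a m \<xi>))" for \<xi>
    using e zero by (cases "\<xi> = 0") (auto simp: positive_elliptic_def complex_is_Real_iff complex_eq_iff)
  have cont: "continuous_on (sphere 0 1) (\<lambda>\<xi>. Re (symb a m \<xi>))"
    unfolding symb_def by (intro continuous_intros)
  \<comment> \<open>Any unit vector, to show that the sphere is not empty.\<close>
  have "axis undefined 1 \<in> (sphere 0 1 :: (real^'a) set)" by simp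
  then obtain \<xi>0 where \<xi>0: "\<xi>0 \<in> sphere 0 1" "\<And>\<xi>. \<xi> \<in> sphere 0 1 \<Longrightarrow> Re (symb a m \<xi>0) \<le> Re (symb a m \<xi>)"
    using continuous_attains_inf[OF compact_sphere _ cont] by blast
  define c where "c = Re (symb a m \<xi>0)"
  show ?thesis
  proof
    have "\<xi>0 \<noteq> 0" using \<xi>0(1) by auto
    then show "0 < c" using e by (simp add: c_def positive_elliptic_def)
    show "symb a m \<xi> = of_real (Re (symb a m \<xi>))" for \<xi> by (rule real)
    show "c * norm \<xi> ^ m \<le> Re (symb a m \<xi>)" for \<xi>
    proof (cases "\<xi> = 0")
      case True
      then show ?thesis using zero \<open>0 < m\<close> by (simp add: zero_power)
    next
      case False
      define \<eta> where "\<eta> = (1 / norm \<xi>) *\<^sub>R \<xi>"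
      have "\<eta> \<in> sphere 0 1" using False by (simp add: \<eta>_def)
      moreover have "\<xi> = norm \<xi> *\<^sub>R \<eta>" using False by (simp add: \<eta>_def)
      then have "Re (symb a m \<xi>) = norm \<xi> ^ m * Re (symb a m \<eta>)"
        by (metis symb_scale Re_complex_of_real real of_real_mult)
      ultimately show ?thesis
        using \<xi>0(2)[of \<eta>] by (simp add: c_def mult.commute mult_left_mono)
    qed
  qed
qed

lemma norm_lattice_vec_ge_1:
  assumes "n \<noteq> 0"
  shows "1 \<le> norm (lattice_vec n)"
proof -
  obtain j where "n $ j \<noteq> 0" using assms by (auto simp: vec_eq_iff)
  then have "1 \<le> \<bar>lattice_vec n $ j\<bar>" by (simp add: lattice_vec_def)
  also have "\<dots> \<le> norm (lattice_vec n)" by (rule component_le_norm_cart)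
  finally show ?thesis .
qed

lemma lattice_enumeration:
  obtains \<nu> :: "nat \<Rightarrow> int^'n" where "bij \<nu>"
proof -
  have "inj (\<lambda>i::int. (\<chi> j. i) :: int^'n)" by (auto simp: inj_on_def vec_eq_iff)
  then have "infinite (UNIV :: (int^'n) set)"
    using finite_subset[OF subset_UNIV] infinite_UNIV_int finite_imageD by metis
  moreover have "countable (UNIV :: (int^'n) set)" by simp
  ultimately show ?thesis using that bij_betw_from_nat_into by blast
qed

lemma summable_enumeration:
  fixes h :: "'b \<Rightarrow> real"
  assumes \<nu>: "bij \<nu>" and h: "\<And>n. 0 \<le> h n"
  shows "summable (\<lambda>k::nat. h (\<nu> k)) \<longleftrightarrow> h summable_on UNIV"
  using summable_on_reindex_bij_betw[OF \<nu>, of h] summable_on_UNIV_nonneg_real_iff[of "\<lambda>k. h (\<nu> k)"] h by simp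

lemma has_sum_enumeration:
  fixes h :: "'b \<Rightarrow> 'c::banach"
  assumes \<nu>: "bij \<nu>" and h: "summable (\<lambda>k::nat. norm (h (\<nu> k)))"
  shows "(h has_sum (\<Sum>k. h (\<nu> k))) UNIV"
proof -
  have "((\<lambda>k. h (\<nu> k)) has_sum (\<Sum>k. h (\<nu> k))) UNIV"
    using h by (rule norm_summable_imp_has_sum) (rule summable_sums[OF summable_norm_cancel[OF h]])
  then show ?thesis using has_sum_reindex_bij_betw[OF \<nu>, of h] by simp
qed

text \<open>Cauchy-Schwarz in the form 2xy \<le> x^2 + y^2: with A the weight to the power \<tau>/2,
  the coefficient is (A |g_n|) (1/A), and the squares of both factors are summable because \<tau> >
  N/2.\<close>

lemma sobolev_abs_summable:
  fixes g :: "real^'n \<Rightarrow> complex"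
  assumes "g \<in> L2_sobolev \<tau>" "real CARD('n) / 2 < \<tau>"
  shows "(\<lambda>n. cmod (fourier_coeff g n)) summable_on UNIV"
proof -
  let ?w = "\<lambda>n::int^'n. 1 + (norm (lattice_vec n))\<^sup>2"
  have "(\<lambda>n. ?w n powr \<tau> * (cmod (fourier_coeff g n))\<^sup>2 + ?w n powr (- \<tau>)) summable_on UNIV"
    using assms lattice_powr_summable[OF assms(2)] by (intro summable_on_add) (auto simp: L2_sobolev_def)
  then show ?thesis
  proof (rule summable_on_comparison_test)
    fix n
    have w: "0 < ?w n" by (intro add_pos_nonneg) auto
    define A where "A = ?w n powr (\<tau> / 2)"
    have A: "0 < A" using w by (simp add: A_def)
    have "?w n powr \<tau> = A\<^sup>2" "?w n powr (- \<tau>) = (1 / A)\<^sup>2"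
      using w by (simp_all add: A_def powr_power powr_minus_divide power_divide)
    moreover have "2 * (A * cmod (fourier_coeff g n)) * (1 / A) \<le> (A * cmod (fourier_coeff g n))\<^sup>2 + (1 / A)\<^sup>2"
      by (rule sum_squares_bound)
    ultimately have "2 * cmod (fourier_coeff g n) \<le> ?w n powr \<tau> * (cmod (fourier_coeff g n))\<^sup>2 + ?w n powr (- \<tau>)"
      using A by (simp add: power_mult_distrib)
    then show "cmod (fourier_coeff g n) \<le> ?w n powr \<tau> * (cmod (fourier_coeff g n))\<^sup>2 + ?w n powr (- \<tau>)"
      using norm_ge_zero[of "fourier_coeff g n"] by linarith
  qed auto
qed

lemma fourier_inversion_enumeration:
  fixes g :: "real^'n \<Rightarrow> complex"
  assumes \<nu>: "bij \<nu>" and "periodic g" "continuous_on UNIV g"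
    and s: "summable (\<lambda>k. cmod (fourier_coeff g (\<nu> k)))"
  shows "(\<Sum>k. fourier_coeff g (\<nu> k) * expi (\<nu> k) x) = g x"
proof -
  have A: "((\<lambda>n. fourier_coeff g n * expi n x) has_sum g x) UNIV"
    using assms summable_enumeration[OF \<nu>, of "\<lambda>n. cmod (fourier_coeff g n)"] by (intro fourier_inversion) auto
  have B: "((\<lambda>n. fourier_coeff g n * expi n x) has_sum (\<Sum>k. fourier_coeff g (\<nu> k) * expi (\<nu> k) x)) UNIV"
    using has_sum_enumeration[OF \<nu>, of "\<lambda>n. fourier_coeff g n * expi n x"] s by (simp add: norm_mult)
  show ?thesis using infsumI[OF A] infsumI[OF B] by simp
qed

lemma L2_norm_le:
  assumes "g \<in> L2" "h \<in> L2"
  shows "(L2_norm g)\<^sup>2 \<le> 2 * (L2_norm (\<lambda>x. g x - h x))\<^sup>2 + 2 * (L2_norm h)\<^sup>2"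
proof -
  have sq: "(L2_norm k)\<^sup>2 = (LINT x|torus_measure. (cmod (k x))\<^sup>2)" for k
    by (simp add: L2_norm_def integral_nonneg_AE)
  have i: "integrable torus_measure (\<lambda>x. (cmod (g x))\<^sup>2)" "integrable torus_measure (\<lambda>x. (cmod (h x))\<^sup>2)"
    "integrable torus_measure (\<lambda>x. (cmod (g x - h x))\<^sup>2)"
    using assms L2_diff[OF assms] by (auto simp: L2_def)
  have "(LINT x|torus_measure. (cmod (g x))\<^sup>2)
      \<le> (LINT x|torus_measure. 2 * (cmod (g x - h x))\<^sup>2 + 2 * (cmod (h x))\<^sup>2)"
  proof (rule integral_mono)
    fix x
    have "(cmod (g x))\<^sup>2 \<le> (cmod (g x - h x) + cmod (h x))\<^sup>2"
      using norm_triangle_ineq[of "g x - h x" "h x"] by (intro power_mono) auto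
    also have "\<dots> \<le> 2 * (cmod (g x - h x))\<^sup>2 + 2 * (cmod (h x))\<^sup>2"
      using zero_le_power2[of "cmod (g x - h x) - cmod (h x)"] by (simp add: power2_eq_square algebra_simps)
    finally show "(cmod (g x))\<^sup>2 \<le> 2 * (cmod (g x - h x))\<^sup>2 + 2 * (cmod (h x))\<^sup>2" .
  qed (use i in auto)
  then show ?thesis unfolding sq using i by simp
qed

text \<open>Elements of \<open>L2\<close> are plain functions and not points of a normed space, so
  boundedness on a compact interval is shown by hand: near t the squared norm is at most 2 + 2
  ||F(t)||^2, and finitely many such neighbourhoods cover [0, T].\<close>

lemma L2_continuous_bounded:
  assumes L2: "\<And>t. t \<in> {0..T::real} \<Longrightarrow> F t \<in> L2"
    and cont: "\<And>t. t \<in> {0..T} \<Longrightarrow> ((\<lambda>s. L2_norm (\<lambda>x. F s x - F t x)) \<longlongrightarrow> 0) (at t within {0..T})"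
  obtains M where "\<And>t. t \<in> {0..T} \<Longrightarrow> (L2_norm (F t))\<^sup>2 \<le> M"
proof -
  have "\<exists>d>0. \<forall>s\<in>{0..T}. dist s t < d \<longrightarrow> (L2_norm (F s))\<^sup>2 \<le> 2 + 2 * (L2_norm (F t))\<^sup>2"
    if t: "t \<in> {0..T}" for t
  proof -
    have "\<forall>\<^sub>F s in at t within {0..T}. dist (L2_norm (\<lambda>x. F s x - F t x)) 0 < 1"
      using cont[OF t] by (rule tendstoD) simp
    then obtain d where d: "0 < d"
      "\<And>s. s \<in> {0..T} \<Longrightarrow> s \<noteq> t \<Longrightarrow> dist s t < d \<Longrightarrow> \<bar>L2_norm (\<lambda>x. F s x - F t x)\<bar> < 1"
      unfolding eventually_at by auto
    have "(L2_norm (F s))\<^sup>2 \<le> 2 + 2 * (L2_norm (F t))\<^sup>2" if s: "s \<in> {0..T}" "dist s t < d" for s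
    proof (cases "s = t")
      case False
      have "(L2_norm (F s))\<^sup>2 \<le> 2 * (L2_norm (\<lambda>x. F s x - F t x))\<^sup>2 + 2 * (L2_norm (F t))\<^sup>2"
        by (intro L2_norm_le L2 s t)
      moreover have "(L2_norm (\<lambda>x. F s x - F t x))\<^sup>2 \<le> 1"
        using d(2)[OF s(1) False s(2)] by (simp add: abs_square_le_1)
      ultimately show ?thesis by linarith
    qed simp
    then show ?thesis using d(1) by blast
  qed
  then obtain d where d: "\<And>t. t \<in> {0..T} \<Longrightarrow> 0 < d t"
    "\<And>t s. t \<in> {0..T} \<Longrightarrow> s \<in> {0..T} \<Longrightarrow> dist s t < d t \<Longrightarrow> (L2_norm (F s))\<^sup>2 \<le> 2 + 2 * (L2_norm (F t))\<^sup>2"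
    by metis
  have "{0..T} \<subseteq> (\<Union>t\<in>{0..T}. ball t (d t))" using d(1) by force
  then obtain C where C: "C \<subseteq> {0..T}" "finite C" "{0..T} \<subseteq> (\<Union>t\<in>C. ball t (d t))"
    using compactE_image[OF compact_Icc, of "{0..T}" "\<lambda>t. ball t (d t)" 0 T] by (metis open_ball)
  have "(L2_norm (F s))\<^sup>2 \<le> 2 + 2 * (\<Sum>t\<in>C. (L2_norm (F t))\<^sup>2)" if s: "s \<in> {0..T}" for s
  proof -
    obtain t where t: "t \<in> C" "dist s t < d t" using C(3) s by (force simp: dist_commute)
    then have "(L2_norm (F s))\<^sup>2 \<le> 2 + 2 * (L2_norm (F t))\<^sup>2" using d(2) C(1) s by blast
    also have "(L2_norm (F t))\<^sup>2 \<le> (\<Sum>t\<in>C. (L2_norm (F t))\<^sup>2)"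
      using t C(2) by (intro member_le_sum) auto
    finally show ?thesis by simp
  qed
  then show ?thesis using that by blast
qed

section \<open>Translation between kernels and the notions of the statement\<close>

lemma mittag_leffler_of_real:
  assumes "0 < \<rho>" "0 < \<beta>"
  shows "mittag_leffler \<rho> \<beta> (of_real z) = of_real (ml_fun \<rho> \<beta> z)"
  using suminf_of_real[OF ml_series_summable'[OF assms, of z], symmetric, where 'a = complex]
  by (simp add: mittag_leffler_def ml_fun_def)

lemma mittag_leffler_resolvent:
  assumes "0 < \<rho>" "0 < t"
  shows "of_real (t powr (\<rho> - 1)) * mittag_leffler \<rho> \<rho> (- of_real \<kappa> * of_real (t powr \<rho>))
    = of_real (resolvent \<rho> \<kappa> t)"
  using mittag_leffler_of_real[OF assms(1,1), of "- \<kappa> * t powr \<rho>"] assms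
  by (simp add: resolvent_def ml_kernel_eq_ml_fun)

text \<open>Integration of order \<rho> - 1 is convolution with the Abel kernel of order 1 - \<rho>;
  the Gamma factor of the definition is part of that kernel. At \<rho> = 1 the operator is the
  identity and is treated apart.\<close>

lemma rl_integral_eq_conv:
  assumes "\<rho> < 1"
  shows "rl_integral (\<rho> - 1) h t = conv (abel_kernel (1 - \<rho>)) h t"
    and "rl_integral_exists (\<rho> - 1) h t \<longleftrightarrow>
      set_integrable lborel {0<..<t} (\<lambda>s. abel_kernel (1 - \<rho>) (t - s) *\<^sub>R h s)"
proof -
  have G: "Gamma (1 - \<rho>) \<noteq> 0" using less_imp_neq[OF Gamma_real_pos[of "1 - \<rho>"]] assms by auto
  have eq: "h s / of_real ((t - s) powr (\<rho> - 1 + 1)) = of_real (Gamma (1 - \<rho>)) * (abel_kernel (1 - \<rho>) (t - s) *\<^sub>R h s)" for s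
    using G by (simp add: abel_kernel_def scaleR_conv_of_real powr_minus divide_simps)
  show "rl_integral (\<rho> - 1) h t = conv (abel_kernel (1 - \<rho>)) h t"
    unfolding rl_integral_def eq set_integral_mult_right conv_def using assms G by simp
  show "rl_integral_exists (\<rho> - 1) h t \<longleftrightarrow>
      set_integrable lborel {0<..<t} (\<lambda>s. abel_kernel (1 - \<rho>) (t - s) *\<^sub>R h s)"
    unfolding rl_integral_exists_def eq using assms G
    by (subst set_integrable_mult_right_iff) auto
qed

text \<open>Since \<kappa> is bounded below away from n = 0, the quotient behaves like
  \<kappa>^\<theta> with \<theta> < 0, hence decays at least like |n|^(-\<sigma>) with \<sigma> =
  \<tau> - \<epsilon> m. Its square is summable exactly because \<sigma> > N/2 was reserved by the
  choice of \<epsilon>.\<close>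

lemma elliptic_weight_summable:
  fixes \<kappa> :: "int^'n \<Rightarrow> real"
  assumes c: "0 < c" "\<And>n. c * norm (lattice_vec n) ^ m \<le> \<kappa> n" and "0 < m" "0 < \<epsilon>"
    and s: "real CARD('n) / 2 < \<tau> - \<epsilon> * real m"
  shows "(\<lambda>n. if n = 0 then 0 else ((1 + \<kappa> n) powr \<epsilon> / \<kappa> n powr (\<tau> / real m))\<^sup>2) summable_on UNIV"
proof -
  define \<sigma> where "\<sigma> = \<tau> - \<epsilon> * real m"
  have \<sigma>: "0 < \<sigma>" using s zero_less_card_finite[where 'a = 'n] unfolding \<sigma>_def by linarith
  define \<theta> where "\<theta> = \<epsilon> - \<tau> / real m"
  have \<theta>: "\<theta> < 0" "real m * \<theta> = - \<sigma>"
    using \<sigma> \<open>0 < m\<close> by (simp_all add: \<theta>_def \<sigma>_def field_simps)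
  \<comment> \<open>From \<kappa> \<ge> c follows 1 + \<kappa> \<le> (1/c + 1) \<kappa>; the power
    of c comes from \<kappa> \<ge> c |n|^m.\<close>
  define A where "A = (1 / c + 1) powr \<epsilon> * c powr \<theta>"
  have "(\<lambda>n::int^'n. A\<^sup>2 * 2 powr \<sigma> * (1 + (norm (lattice_vec n))\<^sup>2) powr (- \<sigma>)) summable_on UNIV"
    using lattice_powr_summable[of \<sigma>] s by (intro summable_on_cmult_right) (simp add: \<sigma>_def)
  then show ?thesis
  proof (rule summable_on_comparison_test)
    fix n :: "int^'n"
    show "(if n = 0 then 0 else ((1 + \<kappa> n) powr \<epsilon> / \<kappa> n powr (\<tau> / real m))\<^sup>2)
        \<le> A\<^sup>2 * 2 powr \<sigma> * (1 + (norm (lattice_vec n))\<^sup>2) powr (- \<sigma>)"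
    proof (cases "n = 0")
      case False
      define L where "L = norm (lattice_vec n)"
      have L: "1 \<le> L" using norm_lattice_vec_ge_1[OF False] by (simp add: L_def)
      have cL: "c * L ^ m \<le> \<kappa> n" using c(2) by (simp add: L_def)
      have "c \<le> c * L ^ m" using mult_left_mono[OF one_le_power[OF L], of c m] c(1) by simp
      then have \<kappa>: "c \<le> \<kappa> n" "0 < \<kappa> n" using cL c(1) by linarith+
      have "1 + \<kappa> n \<le> (1 / c + 1) * \<kappa> n" using \<kappa> c(1) by (simp add: field_simps)
      then have "(1 + \<kappa> n) powr \<epsilon> \<le> ((1 / c + 1) * \<kappa> n) powr \<epsilon>"
        using \<kappa> \<open>0 < \<epsilon>\<close> by (intro powr_mono2) auto
      also have "\<dots> = (1 / c + 1) powr \<epsilon> * \<kappa> n powr \<epsilon>"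
        using \<kappa> c(1) by (simp add: powr_mult)
      finally have "(1 + \<kappa> n) powr \<epsilon> / \<kappa> n powr (\<tau> / real m) \<le> (1 / c + 1) powr \<epsilon> * \<kappa> n powr \<epsilon> / \<kappa> n powr (\<tau> / real m)"
        by (rule divide_right_mono) simp
      also have "\<dots> = (1 / c + 1) powr \<epsilon> * \<kappa> n powr \<theta>"
        by (simp add: \<theta>_def powr_diff)
      also have "\<kappa> n powr \<theta> \<le> (c * L ^ m) powr \<theta>"
        using c(1) L \<theta> cL by (intro powr_mono2') auto
      also have "(c * L ^ m) powr \<theta> = c powr \<theta> * L powr (- \<sigma>)"
        using c(1) L \<theta>(2) by (simp add: powr_mult powr_powr flip: powr_realpow)
      finally have "(1 + \<kappa> n) powr \<epsilon> / \<kappa> n powr (\<tau> / real m) \<le> A * L powr (- \<sigma>)"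
        by (simp add: A_def mult_left_mono mult.assoc)
      then have "((1 + \<kappa> n) powr \<epsilon> / \<kappa> n powr (\<tau> / real m))\<^sup>2 \<le> (A * L powr (- \<sigma>))\<^sup>2"
        by (intro power_mono) auto
      also have "\<dots> = A\<^sup>2 * (L\<^sup>2) powr (- \<sigma>)"
        using L by (simp add: power_mult_distrib powr_power powr_powr mult.commute flip: powr_numeral)
      \<comment> \<open>Prepares 1 + L^2 \<le> 2 L^2, valid as L \<ge> 1; the factor 2^\<sigma> pays
        for it.\<close>
      also have "(L\<^sup>2) powr (- \<sigma>) = 2 powr \<sigma> * (2 * L\<^sup>2) powr (- \<sigma>)"
        using L by (simp add: powr_mult powr_minus)
      also have "(2 * L\<^sup>2) powr (- \<sigma>) \<le> (1 + L\<^sup>2) powr (- \<sigma>)"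
      proof -
        have "1 \<le> L\<^sup>2" using L by (intro one_le_power)
        then show ?thesis using \<sigma> by (intro powr_mono2') auto
      qed
      finally show ?thesis using False by (simp add: L_def mult_left_mono mult.assoc)
    qed simp
  qed simp
qed

text \<open>The tails of d^2 do not depend on t, so a bound on the square sums of b, with no uniform
  convergence of them, already gives uniform tails. The threshold k0 allows finitely many terms to
  escape the domination; below it is what disposes of the zero mode.\<close>

lemma unif_sum_Cauchy_Schwarz:
  fixes h b :: "nat \<Rightarrow> 'a \<Rightarrow> real" and d :: "nat \<Rightarrow> real"
  assumes d: "summable (\<lambda>k. (d k)\<^sup>2)"
    and le: "\<And>k t. k0 \<le> k \<Longrightarrow> t \<in> I \<Longrightarrow> h k t \<le> d k * b k t"
    and b: "\<And>N M t. t \<in> I \<Longrightarrow> (\<Sum>k=N..<M. (b k t)\<^sup>2) \<le> B"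
  shows "unif_sum I h"
proof (cases "I = {}")
  case True
  then show ?thesis by (simp add: unif_sum_def)
next
  case False
  then have "0 \<le> B" using b[of _ 0 0] by auto
  show ?thesis
    unfolding unif_sum_def
  proof (intro allI impI)
    fix e :: real assume "0 < e"
    have "unif_sum I (\<lambda>k t. (d k)\<^sup>2)" using d by (intro unif_sum_const) auto
    then obtain N where N: "\<And>t M. t \<in> I \<Longrightarrow> (\<Sum>k=N..<M. (d k)\<^sup>2) \<le> e\<^sup>2 / (B + 1)"
      using unif_sumD[of I _ "e\<^sup>2 / (B + 1)"] \<open>0 < e\<close> \<open>0 \<le> B\<close> by auto
    have "(\<Sum>k=max k0 N..<M. h k t) \<le> e" if t: "t \<in> I" for t M
    proof -
      have "(\<Sum>k=max k0 N..<M. h k t) \<le> (\<Sum>k=max k0 N..<M. d k * b k t)"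
        using t by (intro sum_mono le) auto
      also have "\<dots> \<le> e"
      proof (rule power2_le_imp_le)
        have "(\<Sum>k=max k0 N..<M. d k * b k t)\<^sup>2 \<le> (\<Sum>k=max k0 N..<M. (d k)\<^sup>2) * (\<Sum>k=max k0 N..<M. (b k t)\<^sup>2)"
          by (rule Cauchy_Schwarz_ineq_sum)
        also have "\<dots> \<le> e\<^sup>2 / (B + 1) * B"
        proof (intro mult_mono)
          have "(\<Sum>k=max k0 N..<M. (d k)\<^sup>2) \<le> (\<Sum>k=N..<M. (d k)\<^sup>2)" by (intro sum_mono2) auto
          then show "(\<Sum>k=max k0 N..<M. (d k)\<^sup>2) \<le> e\<^sup>2 / (B + 1)" using N[OF t, of M] by linarith
        qed (use b[OF t] \<open>0 \<le> B\<close> in \<open>auto intro: sum_nonneg\<close>)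
        also have "\<dots> \<le> e\<^sup>2" using \<open>0 \<le> B\<close> by (simp add: field_simps)
        finally show "(\<Sum>k=max k0 N..<M. d k * b k t)\<^sup>2 \<le> e\<^sup>2" .
      qed (use \<open>0 < e\<close> in simp)
      finally show ?thesis .
    qed
    then show "\<exists>N. \<forall>t\<in>I. \<forall>M. (\<Sum>k=N..<M. h k t) \<le> e" by blast
  qed
qed

theorem theorem4p1:
  fixes a :: "nat^'n \<Rightarrow> complex"
    and m :: nat
    and \<rho> T \<tau> :: real
    and \<phi> :: "real^'n \<Rightarrow> complex"
    and f :: "real^'n \<Rightarrow> real \<Rightarrow> complex"
    and F :: "real \<Rightarrow> real^'n \<Rightarrow> complex"
  assumes "0 < \<rho>" and "\<rho> \<le> 1" and "0 < T"
    and "0 < m" and "symmetric_op a m" and "positive_elliptic a m"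
    and "\<tau> > real CARD('n) / 2"
    and "periodic \<phi>" and "\<phi> \<in> L2_sobolev \<tau>"
    and "\<And>t. t \<in> {0..T} \<Longrightarrow> periodic (\<lambda>x. f x t)"
    and "\<And>t. t \<in> {0..T} \<Longrightarrow> (\<lambda>x. f x t) \<in> L2_sobolev \<tau>"
    and phi_continuous_representative: "continuous_on UNIV \<phi>"
    and f_continuous_representative: "\<And>t. t \<in> {0..T} \<Longrightarrow> continuous_on UNIV (\<lambda>x. f x t)"
    and F_def: "\<And>t. t \<in> {0..T} \<Longrightarrow> A_power a m (\<tau> / real m) (\<lambda>x. f x t) (F t)"
    and F_continuous: "\<And>t. t \<in> {0..T} \<Longrightarrow>
          ((\<lambda>s. L2_norm (\<lambda>x. F s x - F t x)) \<longlongrightarrow> 0) (at t within {0..T})"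
    and zero_mode_continuous: "continuous_on {0..T} (\<lambda>t. fourier_coeff (\<lambda>x. f x t) 0)"
  shows "\<exists>u. regular_solution a m \<rho> T \<phi> f u \<and>
    (\<forall>t\<in>{0<..T}.
       (\<forall>x. (\<lambda>n. cmod (solution_coeff a m \<rho> \<phi> f n t * expi n x)) summable_on UNIV \<and>
            ((\<lambda>n. solution_coeff a m \<rho> \<phi> f n t * expi n x) has_sum u x t) UNIV) \<and>
       uniform_limit UNIV
         (\<lambda>S x. \<Sum>n\<in>S. solution_coeff a m \<rho> \<phi> f n t * expi n x)
         (\<lambda>x. u x t) (finite_subsets_at_top UNIV))"
proof -
  obtain c where c: "0 < c" and symb_real: "\<And>\<xi>. symb a m \<xi> = of_real (Re (symb a m \<xi>))"
    and symb_ge: "\<And>\<xi>. c * norm \<xi> ^ m \<le> Re (symb a m \<xi>)"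
    using elliptic_lower_bound[OF \<open>positive_elliptic a m\<close> \<open>0 < m\<close>] by metis
  define \<kappa> where "\<kappa> = (\<lambda>n. Re (symbZ a m n))"
  have symbZ: "symbZ a m n = of_real (\<kappa> n)" for n
    unfolding \<kappa>_def symbZ_def by (rule symb_real)
  have \<kappa>_ge: "c * norm (lattice_vec n) ^ m \<le> \<kappa> n" for n
    unfolding \<kappa>_def symbZ_def by (rule symb_ge)
  have \<kappa>_nonneg: "0 \<le> \<kappa> n" for n
    using \<kappa>_ge[of n] c by (meson mult_nonneg_nonneg norm_ge_zero order_trans zero_le_power less_imp_le)

  \<comment> \<open>With this choice \<epsilon> m takes at most half of the margin \<tau> - N/2, and
    the cap 1/2 keeps \<epsilon> below 1.\<close>
  define \<epsilon> where "\<epsilon> = min (1 / 2) ((\<tau> - real CARD('n) / 2) / (2 * real m))"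
  have \<epsilon>: "0 < \<epsilon>" "\<epsilon> < 1" using assms(4,7) by (auto simp: \<epsilon>_def)
  have "\<epsilon> * real m \<le> (\<tau> - real CARD('n) / 2) / (2 * real m) * real m"
    unfolding \<epsilon>_def by (intro mult_right_mono) auto
  also have "\<dots> = (\<tau> - real CARD('n) / 2) / 2" using \<open>0 < m\<close> by simp
  finally have \<epsilon>_slack: "real CARD('n) / 2 < \<tau> - \<epsilon> * real m" using assms(7) by (simp add: field_simps)

  obtain \<nu> :: "nat \<Rightarrow> int^'n" where \<nu>: "bij \<nu>" by (rule lattice_enumeration)
  define p where "p = (\<lambda>k. fourier_coeff \<phi> (\<nu> k))"
  define fc where "fc = (\<lambda>n t. fourier_coeff (\<lambda>x. f x t) n)"
  \<comment> \<open>Extends the forcing constantly beyond [0, T], so that it is continuous and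
    bounded on the whole line.\<close>
  define clamp where "clamp = (\<lambda>t. max 0 (min T t))"
  have clamp: "clamp t \<in> {0..T}" "t \<in> {0..T} \<Longrightarrow> clamp t = t" for t
    using \<open>0 < T\<close> by (auto simp: clamp_def)
  define g where "g = (\<lambda>k t. fc (\<nu> k) (clamp t))"

  have F_L2: "F t \<in> L2" if "t \<in> {0..T}" for t using F_def[OF that] by (simp add: A_power_def)
  have F_coeff: "fourier_coeff (F t) n = of_real (\<kappa> n powr (\<tau> / real m)) * fc n t" if "t \<in> {0..T}" for t n
    using fourier_coeff_A_power[OF F_def[OF that], of n]
    unfolding symbZ fc_def powr_of_real[OF \<kappa>_nonneg] .
  have \<kappa>_pos: "0 < \<kappa> n" if "n \<noteq> 0" for n
  proof -
    have "0 < c * norm (lattice_vec n) ^ m"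
      using norm_lattice_vec_ge_1[OF that] c by (intro mult_pos_pos zero_less_power) auto
    then show ?thesis using \<kappa>_ge[of n] by linarith
  qed
  define V where "V = (2 * pi) ^ CARD('n)"
  have V: "0 < V" by (simp add: V_def)

  \<comment> \<open>For n other than 0, Bessel for F(s) - F(t) controls the mode after division by
    \<kappa>^(\<tau>/m) > 0. At n = 0 this factor is 0 and F carries no information, so the
    continuity is the hypothesis on the zero mode.\<close>
  have fc_cont: "continuous_on {0..T} (fc n)" for n
  proof (cases "n = 0")
    case True
    then show ?thesis using zero_mode_continuous by (simp add: fc_def)
  next
    case False
    define b where "b = \<kappa> n powr (\<tau> / real m)"
    have b: "0 < b" using \<kappa>_pos[OF False] by (simp add: b_def)
    show ?thesis
      unfolding continuous_on_def
    proof
      fix t assume t: "t \<in> {0..T}"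
      have le: "norm (fc n s - fc n t) \<le> L2_norm (\<lambda>x. F s x - F t x) * (1 / (b * sqrt V))" if s: "s \<in> {0..T}" for s
      proof -
        have "fourier_coeff (\<lambda>x. F s x - F t x) n = of_real b * (fc n s - fc n t)"
          by (subst fourier_coeff_diff[OF L2_integrable[OF F_L2[OF s]] L2_integrable[OF F_L2[OF t]]])
            (simp add: F_coeff[OF s] F_coeff[OF t] b_def right_diff_distrib)
        then have "V * (b * norm (fc n s - fc n t))\<^sup>2 \<le> (L2_norm (\<lambda>x. F s x - F t x))\<^sup>2"
          using bessel[OF L2_diff[OF F_L2[OF s] F_L2[OF t]], of "{n}"] b by (simp add: V_def norm_mult)
        moreover have "V * (b * norm (fc n s - fc n t))\<^sup>2 = (sqrt V * b * norm (fc n s - fc n t))\<^sup>2"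
          using V by (simp add: power_mult_distrib)
        ultimately have "(sqrt V * b * norm (fc n s - fc n t))\<^sup>2 \<le> (L2_norm (\<lambda>x. F s x - F t x))\<^sup>2"
          by linarith
        then have "sqrt V * b * norm (fc n s - fc n t) \<le> L2_norm (\<lambda>x. F s x - F t x)"
          by (rule power2_le_imp_le) (simp_all add: L2_norm_def integral_nonneg_AE)
        then show ?thesis using V b by (simp add: field_simps)
      qed
      have "((\<lambda>s. L2_norm (\<lambda>x. F s x - F t x) * (1 / (b * sqrt V))) \<longlongrightarrow> 0) (at t within {0..T})"
        using tendsto_mult_left_zero[OF F_continuous[OF t]] .
      then have "((\<lambda>s. fc n s - fc n t) \<longlongrightarrow> 0) (at t within {0..T})"
        by (rule Lim_null_comparison[rotated]) (use le in \<open>auto simp: eventually_at_filter\<close>)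
      then show "(fc n \<longlongrightarrow> fc n t) (at t within {0..T})" by (rule LIM_zero_cancel)
    qed
  qed

  obtain M where M: "\<And>t. t \<in> {0..T} \<Longrightarrow> (L2_norm (F t))\<^sup>2 \<le> M"
    using L2_continuous_bounded[OF F_L2 F_continuous] by metis
  obtain k0 where k0: "\<nu> k0 = 0" using \<nu> by (metis bij_pointE)

  interpret R: relaxation_system \<rho> T \<epsilon> "\<lambda>k. \<kappa> (\<nu> k)" p g
  proof
    show "0 < \<rho>" "\<rho> \<le> 1" "0 < T" "0 < \<epsilon>" "\<epsilon> < 1" "\<And>k. 0 \<le> \<kappa> (\<nu> k)"
      by (fact assms \<epsilon> \<kappa>_nonneg)+
    show "summable (\<lambda>k. norm (p k))"
      unfolding p_def using sobolev_abs_summable[OF assms(9,7)]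
      by (subst summable_enumeration[OF \<nu>, of "\<lambda>n. cmod (fourier_coeff \<phi> n)"]) auto
    have gc: "g k = fc (\<nu> k) \<circ> clamp" for k by (auto simp: g_def)
    have "continuous_on UNIV clamp" unfolding clamp_def by (intro continuous_intros)
    then show "continuous_on UNIV (g k)" for k
      unfolding gc by (intro continuous_on_compose continuous_on_subset[OF fc_cont]) (use clamp in auto)
    have "bounded (fc n ` {0..T})" for n
      by (intro compact_imp_bounded compact_continuous_image fc_cont compact_Icc)
    then show "bounded (range (g k))" for k
      by (rule bounded_subset) (use clamp in \<open>auto simp: g_def\<close>)
    show "unif_sum UNIV (\<lambda>k t. (1 + \<kappa> (\<nu> k)) powr \<epsilon> * norm (g k t))"
    proof (rule unif_sum_Cauchy_Schwarz)
      \<comment> \<open>Past the index k0 of the zero mode, each term factors into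
        \<open>?d\<close>, which is square summable, and a coefficient of F(t), whose square sums
        Bessel bounds by M / V.\<close>
      let ?d = "\<lambda>n. if n = 0 then 0 else (1 + \<kappa> n) powr \<epsilon> / \<kappa> n powr (\<tau> / real m)"
      have "(\<lambda>n. (?d n)\<^sup>2) = (\<lambda>n. if n = 0 then 0 else ((1 + \<kappa> n) powr \<epsilon> / \<kappa> n powr (\<tau> / real m))\<^sup>2)"
        by auto
      then have "(\<lambda>n. (?d n)\<^sup>2) summable_on UNIV"
        using elliptic_weight_summable[OF c \<kappa>_ge \<open>0 < m\<close> \<epsilon>(1) \<epsilon>_slack] by simp
      then show "summable (\<lambda>k. (?d (\<nu> k))\<^sup>2)"
        by (subst summable_enumeration[OF \<nu>, of "\<lambda>n. (?d n)\<^sup>2"]) auto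
      show "(1 + \<kappa> (\<nu> k)) powr \<epsilon> * norm (g k t) \<le> ?d (\<nu> k) * norm (fourier_coeff (F (clamp t)) (\<nu> k))"
        if "Suc k0 \<le> k" for k t
      proof -
        have "\<nu> k \<noteq> 0" using that injD[OF bij_is_inj[OF \<nu>], of k k0] k0 by auto
        then show ?thesis
          using \<kappa>_pos[of "\<nu> k"] by (simp add: F_coeff[OF clamp(1)] g_def norm_mult)
      qed
      show "(\<Sum>k=N..<N'. (norm (fourier_coeff (F (clamp t)) (\<nu> k)))\<^sup>2) \<le> M / V" for N N' t
      proof -
        have "(\<Sum>k=N..<N'. (norm (fourier_coeff (F (clamp t)) (\<nu> k)))\<^sup>2)
            = (\<Sum>n\<in>\<nu> ` {N..<N'}. (norm (fourier_coeff (F (clamp t)) n))\<^sup>2)"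
          using bij_is_inj[OF \<nu>] by (subst sum.reindex) (auto intro: inj_on_subset)
        also have "\<dots> \<le> (L2_norm (F (clamp t)))\<^sup>2 / V"
          using bessel[OF F_L2[OF clamp(1)], of "\<nu> ` {N..<N'}" t] V by (simp add: V_def field_simps)
        also have "\<dots> \<le> M / V"
          using M[OF clamp(1), of t] V by (intro divide_right_mono) auto
        finally show ?thesis .
      qed
    qed
  qed

  \<comment> \<open>The value at t = 0 matters when \<rho> = 1: there the integral of order 0 is u
    itself and has to agree with w at t = 0 too.\<close>
  define u where "u = (\<lambda>x t. if t = 0 then \<phi> x else \<Sum>k. R.u k t * expi (\<nu> k) x)"
  have u_eq: "u x t = (\<Sum>k. R.u k t * expi (\<nu> k) x)" if "t \<in> {0<..T}" for x t
    using that by (simp add: u_def)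
  have u_series: "(\<lambda>x. u x t) = trig_series \<nu> (\<lambda>k. R.u k t)" if "t \<in> {0<..T}" for t
    using u_eq[OF that] by (auto simp: trig_series_def)

  \<comment> \<open>From (1 + L)^m \<le> 2^m (1 + L^m) and L^m \<le> \<kappa> / c.\<close>
  define C where "C = 2 ^ m * (1 + 1 / c)"
  have C: "0 \<le> C" using c by (simp add: C_def)
  have weight: "(1 + norm (lattice_vec n)) ^ m \<le> C * (1 + \<kappa> n)" for n
  proof -
    define L where "L = norm (lattice_vec n)"
    have "(1 + L) ^ m \<le> (2 * max 1 L) ^ m"
      by (intro power_mono) (auto simp: L_def)
    also have "\<dots> \<le> 2 ^ m * (1 + L ^ m)"
      by (auto simp: power_mult_distrib max_def L_def)
    also have "L ^ m \<le> \<kappa> n / c" using \<kappa>_ge[of n] c by (simp add: L_def field_simps)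
    also have "2 ^ m * (1 + \<kappa> n / c) \<le> C * (1 + \<kappa> n)"
      unfolding C_def mult.assoc using c \<kappa>_nonneg[of n] by (intro mult_left_mono) (auto simp: field_simps)
    finally show ?thesis by (simp add: L_def)
  qed
  \<comment> \<open>Ellipticity converts the weight 1 + \<kappa> into m powers of |n|, so every
    derivative of order m converges, not only the combination A(D)u.\<close>
  have weighted_sum: "unif_sum {\<delta>..T} (\<lambda>k t. (1 + norm (lattice_vec (\<nu> k))) ^ m * norm (R.u k t))"
    if "0 < \<delta>" for \<delta>
  proof (rule unif_sum_comparison[OF R.u_sum[OF that] _ C])
    show "(1 + norm (lattice_vec (\<nu> k))) ^ m * norm (R.u k t) \<le> C * ((1 + \<kappa> (\<nu> k)) * norm (R.u k t))" for k t
      unfolding mult.assoc[symmetric] by (intro mult_right_mono weight) auto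
  qed
  have weighted: "weighted_summable \<nu> m (\<lambda>k. R.u k t)" if "t \<in> {0<..T}" for t
    unfolding weighted_summable_def
    using that by (intro unif_sum_summable[OF weighted_sum[of t]]) auto
  have u_summable: "summable (\<lambda>k. norm (R.u k t))" if "t \<in> {0<..T}" for t
    by (rule weighted_summable_norm[OF weighted[OF that]])

  have D_cont: "continuous_on (UNIV \<times> {0<..T}) (\<lambda>(x, t). D_multi \<alpha> (\<lambda>y. u y t) x)"
    if \<alpha>: "\<alpha> \<in> multi_indices m" for \<alpha>
  proof (rule continuous_on_half_open)
    fix \<delta> :: real assume "0 < \<delta>"
    let ?c = "\<lambda>k t. (\<Prod>j\<in>UNIV. of_int (\<nu> k $ j) ^ (\<alpha> $ j)) * R.u k t"
    have "continuous_on (UNIV \<times> {\<delta>..T}) (\<lambda>(x, t). \<Sum>k. ?c k t * expi (\<nu> k) x)"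
    proof (rule unif_sum_continuous_on)
      show "unif_sum {\<delta>..T} (\<lambda>k t. norm (?c k t))"
        by (rule unif_sum_mono[OF weighted_sum[OF \<open>0 < \<delta>\<close>]])
          (auto simp: norm_mult intro!: mult_right_mono monomial_le_weight \<alpha>)
      show "continuous_on {\<delta>..T} (?c k)" for k
        using \<open>0 < \<delta>\<close> by (intro continuous_intros continuous_on_subset[OF R.u_cont]) auto
    qed (auto intro: continuous_intros)
    then show "continuous_on (UNIV \<times> {\<delta>..T}) (\<lambda>(x, t). D_multi \<alpha> (\<lambda>y. u y t) x)"
    proof (rule continuous_on_eq)
      fix z assume "z \<in> (UNIV :: (real^'n) set) \<times> {\<delta>..T}"
      then have "snd z \<in> {0<..T}" using \<open>0 < \<delta>\<close> by auto
      then show "(case z of (x, t) \<Rightarrow> \<Sum>k. ?c k t * expi (\<nu> k) x) = (case z of (x, t) \<Rightarrow> D_multi \<alpha> (\<lambda>y. u y t) x)"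
        by (auto simp: case_prod_beta u_series D_multi_trig_series[OF weighted \<alpha>] trig_series_def)
    qed
  qed
  have AD_cont: "continuous_on (UNIV \<times> {0<..T}) (\<lambda>(x, t). AD a m (\<lambda>y. u y t) x)"
    using D_cont by (auto simp: AD_def case_prod_beta intro!: continuous_intros)

  \<comment> \<open>The candidate for the fractional derivative: the termwise derivative of
    w.\<close>
  define v where "v = (\<lambda>x t. \<Sum>k. (g k t - \<kappa> (\<nu> k) *\<^sub>R R.u k t) * expi (\<nu> k) x)"
  have v_cont: "continuous_on (UNIV \<times> {0<..T}) (\<lambda>(x, t). v x t)"
  proof (rule continuous_on_half_open)
    fix \<delta> :: real assume "0 < \<delta>"
    then show "continuous_on (UNIV \<times> {\<delta>..T}) (\<lambda>(x, t). v x t)"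
      unfolding v_def
      by (intro unif_sum_continuous_on R.W'_sum continuous_intros continuous_on_subset[OF R.u_cont]
          continuous_on_subset[OF R.f_cont]) auto
  qed
  define w where "w = (\<lambda>x t. \<Sum>k. R.W k t * expi (\<nu> k) x)"
  have w_cont: "continuous_on (UNIV \<times> {0..T}) (\<lambda>(x, t). w x t)"
    unfolding w_def
    by (intro unif_sum_continuous_on R.W_sum R.W_cont) (auto intro: continuous_intros)
  have w_0: "w x 0 = \<phi> x" for x
    unfolding w_def R.W_0 unfolding p_def
    using R.p by (intro fourier_inversion_enumeration[OF \<nu>] assms) (simp add: p_def)

  have exists: "rl_integral_exists (\<rho> - 1) (u x) t"
    and rl_eq: "rl_integral (\<rho> - 1) (u x) t = w x t" if t: "t \<in> {0<..T}" for x t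
  proof -
    have "rl_integral_exists (\<rho> - 1) (u x) t \<and> rl_integral (\<rho> - 1) (u x) t = w x t"
    proof (cases "\<rho> = 1")
      case True
      then have "R.W k t = R.u k t" for k using t by (intro R.W_eq_u) auto
      then show ?thesis using t True by (simp add: rl_integral_exists_def rl_integral_def w_def u_eq)
    next
      case False
      then have \<rho>1: "\<rho> < 1" using \<open>\<rho> \<le> 1\<close> by simp
      have b: "norm (expi (\<nu> k) x) \<le> 1" for k by simp
      have "set_integrable lborel {0<..<t} (\<lambda>s. abel_kernel (1 - \<rho>) (t - s) *\<^sub>R (\<Sum>k. R.u k s * expi (\<nu> k) x)) \<longleftrightarrow>
          set_integrable lborel {0<..<t} (\<lambda>s. abel_kernel (1 - \<rho>) (t - s) *\<^sub>R u x s)"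
        using t by (intro set_integrable_cong) (auto simp: u_eq)
      moreover have "conv (abel_kernel (1 - \<rho>)) (u x) t
          = conv (abel_kernel (1 - \<rho>)) (\<lambda>s. \<Sum>k. R.u k s * expi (\<nu> k) x) t"
        using t by (intro conv_cong) (auto simp: u_eq)
      ultimately show ?thesis
        using R.u_series_abel[OF b t \<rho>1] rl_integral_eq_conv[OF \<rho>1] by (simp add: w_def)
    qed
    then show "rl_integral_exists (\<rho> - 1) (u x) t" "rl_integral (\<rho> - 1) (u x) t = w x t" by auto
  qed

  have deriv: "has_rl_derivative T \<rho> (u x) (v x t) t" if t: "t \<in> {0<..T}" for x t
  proof -
    have "((\<lambda>t. w x t) has_vector_derivative v x t) (at t within {0<..T})"
      unfolding w_def v_def by (rule R.W_series_deriv[OF _ t]) simp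
    then have "(rl_integral (\<rho> - 1) (u x) has_vector_derivative v x t) (at t within {0<..T})"
      by (rule has_vector_derivative_transform[OF t, rotated]) (rule rl_eq)
    then show ?thesis using exists by (simp add: has_rl_derivative_def)
  qed

  \<comment> \<open>In the sum the terms \<kappa> u cancel against those of A(D)u. What remains is
    the Fourier series of f(., t), and inversion for its continuous representative returns f at
    every x.\<close>
  have equation: "v x t + AD a m (\<lambda>y. u y t) x = f x t" if t: "t \<in> {0<..T}" for x t
  proof -
    have t': "t \<in> {0..T}" using t by auto
    have gt: "g k t = fourier_coeff (\<lambda>x. f x t) (\<nu> k)" for k
      using clamp(2)[OF t'] by (simp add: g_def fc_def)
    have gs: "summable (\<lambda>k. norm (g k t))"
      by (rule unif_sum_summable[OF R.f_unif]) auto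
    have "unif_sum {t..T} (\<lambda>k t. norm (g k t - \<kappa> (\<nu> k) *\<^sub>R R.u k t))"
      using t by (intro R.W'_sum) auto
    then have vs: "summable (\<lambda>k. norm (g k t - \<kappa> (\<nu> k) *\<^sub>R R.u k t))"
      using t by (intro unif_sum_summable) auto
    have s1: "summable (\<lambda>k. (g k t - \<kappa> (\<nu> k) *\<^sub>R R.u k t) * expi (\<nu> k) x)"
      using vs by (intro summable_norm_cancel[of "\<lambda>k. _ k * expi (\<nu> k) x"]) (simp add: norm_mult)
    have s2: "summable (\<lambda>k. g k t * expi (\<nu> k) x)"
      using gs by (intro summable_norm_cancel[of "\<lambda>k. _ k * expi (\<nu> k) x"]) (simp add: norm_mult)
    have AD_eq: "AD a m (\<lambda>y. u y t) x = (\<Sum>k. g k t * expi (\<nu> k) x - (g k t - \<kappa> (\<nu> k) *\<^sub>R R.u k t) * expi (\<nu> k) x)"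
      unfolding u_series[OF t] AD_trig_series[OF weighted[OF t]] trig_series_def
      by (simp add: symbZ algebra_simps scaleR_conv_of_real)
    have "v x t + AD a m (\<lambda>y. u y t) x = (\<Sum>k. g k t * expi (\<nu> k) x)"
      unfolding AD_eq suminf_diff[OF s2 s1, symmetric] v_def by simp
    also have "\<dots> = f x t"
      unfolding gt using t' gs
      by (intro fourier_inversion_enumeration[OF \<nu>] assms(10) f_continuous_representative) (simp_all add: gt)
    finally show ?thesis .
  qed

  \<comment> \<open>The initial condition is continuity of w at t = 0, where w is the Fourier series
    of \<phi>.\<close>
  have limit: "(rl_integral (\<rho> - 1) (u x) \<longlongrightarrow> \<phi> x) (at_right 0)" for x
  proof -
    have "continuous_on {0..T} (\<lambda>t. (x, t))" by (intro continuous_intros)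
    from continuous_on_compose2[OF w_cont this] have "continuous_on {0..T} (\<lambda>t. w x t)" by auto
    then have "((\<lambda>t. w x t) \<longlongrightarrow> w x 0) (at 0 within {0..T})"
      using \<open>0 < T\<close> by (auto simp: continuous_on_def)
    then have "((\<lambda>t. w x t) \<longlongrightarrow> \<phi> x) (at_right 0)"
      using at_within_Icc_at_right[OF \<open>0 < T\<close>] by (simp add: w_0)
    moreover have "eventually (\<lambda>t. w x t = rl_integral (\<rho> - 1) (u x) t) (at_right 0)"
      unfolding eventually_at_right_field using \<open>0 < T\<close> by (intro exI[of _ T]) (auto simp: rl_eq)
    ultimately show ?thesis by (rule Lim_transform_eventually)
  qed

  have "regular_solution a m \<rho> T \<phi> f u"
    unfolding regular_solution_def
  proof (intro conjI)
    show "\<forall>t\<in>{0<..T}. periodic (\<lambda>x. u x t) \<and> Ck m (\<lambda>x. u x t)"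
      by (auto simp: u_series intro: periodic_trig_series Ck_trig_series weighted)
    show "\<exists>v. continuous_on (UNIV \<times> {0<..T}) (\<lambda>(x, t). v x t) \<and>
        (\<forall>x. \<forall>t\<in>{0<..T}. has_rl_derivative T \<rho> (u x) (v x t) t \<and> v x t + AD a m (\<lambda>y. u y t) x = f x t)"
      using v_cont deriv equation by blast
    have "w x t = rl_integral (\<rho> - 1) (u x) t" if "t \<in> {0..T}" "0 < t \<or> \<rho> = 1" for x t
    proof (cases "t = 0")
      case True
      then show ?thesis using that by (simp add: rl_integral_def w_0 u_def)
    next
      case False
      then show ?thesis using that by (intro rl_eq[symmetric]) auto
    qed
    then show "\<exists>w. continuous_on (UNIV \<times> {0..T}) (\<lambda>(x, t). w x t) \<and>
        (\<forall>x. \<forall>t\<in>{0..T}. 0 < t \<or> \<rho> = 1 \<longrightarrow> w x t = rl_integral (\<rho> - 1) (u x) t)"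
      using w_cont by blast
  qed (use D_cont AD_cont limit in auto)
  moreover
  \<comment> \<open>For t in (0, T] the times t - s stay in [0, T], where clamping changes nothing;
    so the modes are the coefficients of the stated formula.\<close>
  have coeff: "solution_coeff a m \<rho> \<phi> f (\<nu> k) t = R.u k t" if t: "t \<in> {0<..T}" for k t
  proof -
    have ml: "of_real (s powr (\<rho> - 1)) * mittag_leffler \<rho> \<rho> (- (symbZ a m (\<nu> k) * of_real (s powr \<rho>)))
        = of_real (resolvent \<rho> (\<kappa> (\<nu> k)) s)" if "0 < s" for s
      using mittag_leffler_resolvent[OF \<open>0 < \<rho>\<close> that] by (simp add: symbZ)
    have "(LINT s:{0<..<t}|lborel. fourier_coeff (\<lambda>x. f x (t - s)) (\<nu> k) * of_real (s powr (\<rho> - 1)) *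
        mittag_leffler \<rho> \<rho> (- symbZ a m (\<nu> k) * of_real (s powr \<rho>))) = conv (resolvent \<rho> (\<kappa> (\<nu> k))) (g k) t"
      unfolding conv_flip
    proof (rule set_lebesgue_integral_cong)
      show "\<forall>s. s \<in> {0<..<t} \<longrightarrow> fourier_coeff (\<lambda>x. f x (t - s)) (\<nu> k) * of_real (s powr (\<rho> - 1)) *
        mittag_leffler \<rho> \<rho> (- symbZ a m (\<nu> k) * of_real (s powr \<rho>)) = resolvent \<rho> (\<kappa> (\<nu> k)) s *\<^sub>R g k (t - s)"
        using t clamp(2) by (simp add: mult.assoc ml g_def fc_def scaleR_conv_of_real)
    qed simp
    moreover have "fourier_coeff \<phi> (\<nu> k) = p k" by (simp add: p_def)
    ultimately show ?thesis
      using ml[of t] t by (simp add: solution_coeff_def R.u_def mult.assoc mult.commute[of "p k"] scaleR_conv_of_real)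
  qed
  have "(\<forall>x. (\<lambda>n. cmod (solution_coeff a m \<rho> \<phi> f n t * expi n x)) summable_on UNIV \<and>
            ((\<lambda>n. solution_coeff a m \<rho> \<phi> f n t * expi n x) has_sum u x t) UNIV) \<and>
       uniform_limit UNIV
         (\<lambda>S x. \<Sum>n\<in>S. solution_coeff a m \<rho> \<phi> f n t * expi n x)
         (\<lambda>x. u x t) (finite_subsets_at_top UNIV)" if t: "t \<in> {0<..T}" for t
  proof -
    let ?s = "\<lambda>n. solution_coeff a m \<rho> \<phi> f n t"
    have abs: "(\<lambda>n. cmod (?s n)) summable_on UNIV"
      using summable_enumeration[OF \<nu>, of "\<lambda>n. cmod (?s n)"] u_summable[OF t] by (simp add: coeff[OF t])
    have sum: "((\<lambda>n. ?s n * expi n x) has_sum u x t) UNIV" for x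
      using has_sum_enumeration[OF \<nu>, of "\<lambda>n. ?s n * expi n x"] u_summable[OF t]
      by (simp add: coeff[OF t] norm_mult u_eq[OF t])
    \<comment> \<open>The exponentials have modulus 1, so the absolute sum of the coefficients is a
      majorant independent of x.\<close>
    have "uniform_limit UNIV (\<lambda>S x. \<Sum>n\<in>S. ?s n * expi n x) (\<lambda>x. u x t) (finite_subsets_at_top UNIV)"
      by (rule Weierstrass_m_test_general'[OF _ sum abs]) (simp add: norm_mult)
    then show ?thesis using abs sum by (simp add: norm_mult)
  qed
  ultimately show ?thesis by blast
qed

end
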